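(* For any $n\ge2$, a hypersurface $X\subseteq\mathbb{P}^n$ of degree $n$ that admits an induced additive action is unique up to automorphism of $\mathbb{P}^n$; that is, for any two such hypersurfaces $X_1,X_2\subseteq\mathbb{P}^n$ there is an automorphism $\psi$ of $\mathbb{P}^n$ with $\psi(X_1)=X_2$.
   Context: The base field $\mathbb{K}$ is algebraically closed of characteristic zero; all varieties are over $\mathbb{K}$ and $\mathbb{G}_a^m=(\mathbb{K}^m,+)$. An additive action on an (irreducible) variety $X$ is an effective regular action of $\mathbb{G}_a^m$ on $X$ with an open orbit. An additive action $\mathbb{G}_a^{n-1}\times X\to X$ on a projective hypersurface $X\subseteq\mathbb{P}^n$ is called induced if it extends to a regular action of $\mathbb{G}_a^{n-1}$ on the ambient space $\mathbb{P}^n$. *)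

theory Defs
  imports
    "HOL-Analysis.Analysis"
    "HOL-Library.Poly_Mapping"
    "HOL-Computational_Algebra.Computational_Algebra"
begin

subsection \<open>Multivariate polynomials\<close>

text \<open>
  The polynomial ring \<open>k[x\<^sub>v : v \<in> 'v]\<close> is the type of finitely supported functions from
  exponent vectors to coefficients, with the ring structure of \<^theory>\<open>HOL-Library.Poly_Mapping\<close>.
\<close>

type_synonym ('v, 'k) mpoly = "('v \<Rightarrow>\<^sub>0 nat) \<Rightarrow>\<^sub>0 'k"

definition mpoly_eval :: "('v \<Rightarrow> 'k) \<Rightarrow> ('v, 'k::comm_semiring_1) mpoly \<Rightarrow> 'k" where
  "mpoly_eval a f =
    (\<Sum>m\<in>Poly_Mapping.keys f. Poly_Mapping.lookup f m *
      (\<Prod>v\<in>Poly_Mapping.keys m. a v ^ Poly_Mapping.lookup m v))"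

text \<open>Homogeneity of degree \<open>d\<close> in the variables from \<open>V\<close>; the zero polynomial is included.\<close>

definition homogeneous_in :: "'v::finite set \<Rightarrow> nat \<Rightarrow> ('v, 'k::zero) mpoly \<Rightarrow> bool" where
  "homogeneous_in V d f \<longleftrightarrow>
    (\<forall>m\<in>Poly_Mapping.keys f. (\<Sum>v\<in>V. Poly_Mapping.lookup m v) = d)"

abbreviation homogeneous :: "nat \<Rightarrow> ('v::finite, 'k::zero) mpoly \<Rightarrow> bool" where
  "homogeneous \<equiv> homogeneous_in UNIV"

subsection \<open>Projective space and its Zariski topology\<close>

text \<open>
  Points are the lines through the origin of \<open>k\<^sup>N\<close> with \<open>N = CARD('n)\<close>, so \<open>('k, 'n) proj\<close> is the
  projective space of dimension \<open>CARD('n) - 1\<close>.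
\<close>

typedef (overloaded) ('k::field, 'n::finite) proj =
  "{vec.span {x} | x :: 'k ^ 'n. x \<noteq> 0}"
  by (rule exI [of _ "vec.span {axis undefined 1}"]) (auto simp: axis_eq_0_iff)

text \<open>\<open>x\<close> is a vector of homogeneous coordinates of the point \<open>p\<close>.\<close>

definition hom_coords :: "('k::field, 'n::finite) proj \<Rightarrow> 'k ^ 'n \<Rightarrow> bool" where
  "hom_coords p x \<longleftrightarrow> x \<noteq> 0 \<and> Rep_proj p = vec.span {x}"

text \<open>Only meant for homogeneous \<open>f\<close>, for which the choice of coordinates does not matter.\<close>

definition vanishes_at :: "('n::finite, 'k::field) mpoly \<Rightarrow> ('k, 'n) proj \<Rightarrow> bool" where
  "vanishes_at f p \<longleftrightarrow> (\<forall>x. hom_coords p x \<longrightarrow> mpoly_eval (($) x) f = 0)"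

definition zariski_closed :: "('k::field, 'n::finite) proj set \<Rightarrow> bool" where
  "zariski_closed Z \<longleftrightarrow>
    (\<exists>S. (\<forall>f\<in>S. \<exists>d. homogeneous d f) \<and> Z = {p. \<forall>f\<in>S. vanishes_at f p})"

definition zariski_open_in :: "('k::field, 'n::finite) proj set \<Rightarrow> ('k, 'n) proj set \<Rightarrow> bool" where
  "zariski_open_in X U \<longleftrightarrow> (\<exists>Z. zariski_closed Z \<and> U = X - Z)"

text \<open>
  Hypersurfaces are irreducible varieties here, so the degree is the degree of the
  irreducible defining form, which is unique up to a scalar factor when the field is
  algebraically closed.
\<close>

definition hypersurface :: "nat \<Rightarrow> ('k::field, 'n::finite) proj set \<Rightarrow> bool" where
  "hypersurface d X \<longleftrightarrow>
    (\<exists>f :: ('n, 'k) mpoly. irreducible f \<and> homogeneous d f \<and> X = {p. vanishes_at f p})"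

subsection \<open>Morphisms\<close>

text \<open>
  A map between projective spaces is regular if around every point it is given by forms
  \<open>F\<^sub>i\<close> of a common degree. The neighbourhood in question is the open set where the \<open>F\<^sub>i\<close> have
  no common zero; any smaller open neighbourhood can be brought into this shape by multiplying
  all \<open>F\<^sub>i\<close> with a form that vanishes outside of it but not at the given point.
\<close>

definition regular_proj_map :: "(('k::field, 'n::finite) proj \<Rightarrow> ('k, 'l::finite) proj) \<Rightarrow> bool" where
  "regular_proj_map \<phi> \<longleftrightarrow>
    (\<forall>p. \<exists>d (F :: 'l \<Rightarrow> ('n, 'k) mpoly).
      (\<forall>i. homogeneous d (F i)) \<and>
      (\<exists>x i. hom_coords p x \<and> mpoly_eval (($) x) (F i) \<noteq> 0) \<and>
      (\<forall>q y. hom_coords q y \<and> (\<exists>i. mpoly_eval (($) y) (F i) \<noteq> 0) \<longrightarrow>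
        hom_coords (\<phi> q) (\<chi> i. mpoly_eval (($) y) (F i))))"

definition proj_automorphism :: "(('k::field, 'n::finite) proj \<Rightarrow> ('k, 'n) proj) \<Rightarrow> bool" where
  "proj_automorphism \<psi> \<longleftrightarrow> bij \<psi> \<and> regular_proj_map \<psi> \<and> regular_proj_map (inv \<psi>)"

text \<open>
  Likewise for a map from \<open>k\<^sup>m \<times> X\<close>, with \<open>X\<close> closed in a projective space, to that projective
  space. The \<open>F\<^sub>i\<close> are polynomials in the affine coordinates (variables \<^term>\<open>Inl j\<close>) and in the
  homogeneous coordinates (variables \<^term>\<open>Inr i\<close>), homogeneous of a common degree in the latter.
\<close>

definition regular_on :: "('k::field, 'n::finite) proj set \<Rightarrow>
    ('k ^ 'm::finite \<Rightarrow> ('k, 'n) proj \<Rightarrow> ('k, 'n) proj) \<Rightarrow> bool" where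
  "regular_on X \<alpha> \<longleftrightarrow>
    (\<forall>t. \<forall>p\<in>X. \<exists>d (F :: 'n \<Rightarrow> ('m + 'n, 'k) mpoly).
      (\<forall>i. homogeneous_in (range Inr) d (F i)) \<and>
      (\<exists>x i. hom_coords p x \<and> mpoly_eval (case_sum (($) t) (($) x)) (F i) \<noteq> 0) \<and>
      (\<forall>s. \<forall>q\<in>X. \<forall>y. hom_coords q y \<and>
          (\<exists>i. mpoly_eval (case_sum (($) s) (($) y)) (F i) \<noteq> 0) \<longrightarrow>
        hom_coords (\<alpha> s q) (\<chi> i. mpoly_eval (case_sum (($) s) (($) y)) (F i))))"

subsection \<open>Additive actions\<close>

text \<open>
  Actions of the vector group \<open>k\<^sup>m\<close> with \<open>m = CARD('m)\<close>. Only the values \<open>\<alpha> t p\<close> with \<open>p \<in> X\<close> matter.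
\<close>

definition regular_action :: "('k::field, 'n::finite) proj set \<Rightarrow>
    ('k ^ 'm::finite \<Rightarrow> ('k, 'n) proj \<Rightarrow> ('k, 'n) proj) \<Rightarrow> bool" where
  "regular_action X \<alpha> \<longleftrightarrow>
    (\<forall>t. \<forall>p\<in>X. \<alpha> t p \<in> X) \<and>
    (\<forall>p\<in>X. \<alpha> 0 p = p) \<and>
    (\<forall>s t. \<forall>p\<in>X. \<alpha> (s + t) p = \<alpha> s (\<alpha> t p)) \<and>
    regular_on X \<alpha>"

definition additive_action :: "('k::field, 'n::finite) proj set \<Rightarrow>
    ('k ^ 'm::finite \<Rightarrow> ('k, 'n) proj \<Rightarrow> ('k, 'n) proj) \<Rightarrow> bool" where
  "additive_action X \<alpha> \<longleftrightarrow>
    regular_action X \<alpha> \<and>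
    (\<forall>t. (\<forall>p\<in>X. \<alpha> t p = p) \<longrightarrow> t = 0) \<and>
    (\<exists>p\<in>X. zariski_open_in X (range (\<lambda>t. \<alpha> t p)))"

definition induced_additive_action :: "('k::field, 'n::finite) proj set \<Rightarrow>
    ('k ^ 'm::finite \<Rightarrow> ('k, 'n) proj \<Rightarrow> ('k, 'n) proj) \<Rightarrow> bool" where
  "induced_additive_action X \<alpha> \<longleftrightarrow>
    additive_action X \<alpha> \<and>
    (\<exists>\<beta>. regular_action UNIV \<beta> \<and> (\<forall>t. \<forall>p\<in>X. \<beta> t p = \<alpha> t p))"

end

theory Submission
  imports Defs "HOL-Computational_Algebra.Field_as_Ring"
begin

text \<open>
  The degree of the image of a line under the acting group is constant along a one-parameter
  subgroup, hence equal to one. So the action on the projective space is linear, and the orbit of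
  a point lifts to \<open>exp(D\<^sub>t) v\<close> with commuting nilpotent \<open>D\<^sub>t\<close>. As the orbit is open in a
  hypersurface that is not a hyperplane, \<open>v\<close> is a cyclic vector for the local algebra generated
  by the \<open>D\<^sub>t\<close>, and with a linear functional \<open>l\<close> whose kernel is spanned by \<open>v\<close> and the
  \<open>D\<^sub>t v\<close> the hypersurface is given by the homogenization of \<open>l(log(1 + a) v)\<close> for \<open>a\<close> in
  the maximal ideal. Degree \<open>n\<close> forces \<open>l(a\<^sup>n v) \<noteq> 0\<close> for some \<open>a\<close>, so the algebra is
  \<open>k[z]/(z\<^sup>n\<^sup>+\<^sup>1)\<close>, and in characteristic zero the generator \<open>z\<close> can be chosen such that
  \<open>l(z\<^sup>i v) = 0\<close> for \<open>i < n\<close>. This determines the equation up to a scalar.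
\<close>

text \<open>Regularity provides forms only locally and only up to a factor, so a lift of the action
  to vectors has to be constructed. Along a line of points and a one-parameter subgroup the local
  forms are polynomials in two variables, whose common divisor can be cancelled by unique
  factorization. The resulting lift is nowhere zero, hence unique up to a constant, since a
  polynomial without roots over an algebraically closed field is constant. Fixing the value at time
  zero removes the constant, and with it the scalar ambiguity in the group law. That
  \<open>v\<close> is cyclic rests on the fact that no open piece of the hypersurface lies in a
  hyperplane; restriction to a plane and division with remainder replace a general Nullstellensatz
  here. Vanishing on the orbit shows only that the logarithmic expression divides the equation on an
  affine chart. Homogenization and irreducibility make the cofactor constant, and this is what
  forces the part of degree \<open>n\<close> to be nonzero. Polynomials are treated as functions,
  which loses nothing over an infinite field and turns exponential, logarithm and linear
  substitution into composition.\<close>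

no_notation fps_nth (infixl \<open>$\<close> 75)

subsection \<open>Polynomial functions\<close>

definition mon_eval :: "('v \<Rightarrow> 'k::comm_semiring_1) \<Rightarrow> ('v \<Rightarrow>\<^sub>0 nat) \<Rightarrow> 'k" where
  "mon_eval a m = (\<Prod>v\<in>Poly_Mapping.keys m. a v ^ Poly_Mapping.lookup m v)"

lemma mon_eval_UNIV: "mon_eval a m = (\<Prod>v\<in>UNIV. a (v::'v::finite) ^ Poly_Mapping.lookup m v)"
  unfolding mon_eval_def by (rule prod.mono_neutral_left) (auto simp: in_keys_iff)

lemma mon_eval_0 [simp]: "mon_eval a 0 = 1"
  by (simp add: mon_eval_def)

lemma mon_eval_add: "mon_eval a (m + m') = mon_eval a m * mon_eval (a :: 'v::finite \<Rightarrow> _) m'"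
  by (simp add: mon_eval_UNIV lookup_add power_add prod.distrib)

lemma mon_eval_mult: "mon_eval (\<lambda>v. a v * b v) m = mon_eval a m * mon_eval (b :: 'v::finite \<Rightarrow> _) m"
  by (simp add: mon_eval_UNIV power_mult_distrib prod.distrib)

lemma mon_eval_const: "mon_eval (\<lambda>v. s) m = s ^ (\<Sum>v\<in>UNIV. Poly_Mapping.lookup m (v::'v::finite))"
  by (simp add: mon_eval_UNIV power_sum)

lemma mpoly_eval_mon:
  "mpoly_eval a f = (\<Sum>m\<in>Poly_Mapping.keys f. Poly_Mapping.lookup f m * mon_eval a m)"
  by (simp add: mpoly_eval_def mon_eval_def)

lemma mpoly_eval_superset:
  assumes "finite S" "Poly_Mapping.keys f \<subseteq> S"
  shows "mpoly_eval a f = (\<Sum>m\<in>S. Poly_Mapping.lookup f m * mon_eval a m)"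
  unfolding mpoly_eval_mon
  by (rule sum.mono_neutral_left) (use assms in \<open>auto simp: in_keys_iff\<close>)

lemma mpoly_eval_single: "mpoly_eval a (Poly_Mapping.single m c) = c * mon_eval a m"
  by (subst mpoly_eval_superset[of "{m}"]) auto

lemma mpoly_eval_0 [simp]: "mpoly_eval a 0 = 0"
  by (simp add: mpoly_eval_mon)

lemma mpoly_eval_1 [simp]: "mpoly_eval a 1 = 1"
  using mpoly_eval_single[of a 0 1] by simp

lemma mpoly_eval_add: "mpoly_eval a (f + g) = mpoly_eval a f + mpoly_eval a g"
proof -
  have "Poly_Mapping.keys (f + g) \<subseteq> Poly_Mapping.keys f \<union> Poly_Mapping.keys g"
    by (rule Poly_Mapping.keys_add)
  then show ?thesis
    by (subst (1 2 3) mpoly_eval_superset[of "Poly_Mapping.keys f \<union> Poly_Mapping.keys g"])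
       (auto simp: lookup_add sum.distrib distrib_right)
qed

lemma mpoly_eval_sum: "mpoly_eval a (sum f S) = (\<Sum>i\<in>S. mpoly_eval a (f i))"
  by (induction S rule: infinite_finite_induct) (auto simp: mpoly_eval_add)

lemma mpoly_single_induct [case_names zero add]:
  assumes "P 0" "\<And>m c f. P f \<Longrightarrow> P (Poly_Mapping.single m c + f)"
  shows "P (f :: ('v, 'k::comm_semiring_1) mpoly)"
proof (induction f rule: update_induct)
  case const
  then show ?case by (rule assms)
next
  case (update f a b)
  have "Poly_Mapping.update a b f = Poly_Mapping.single a b + f"
    using update(1)
    by (intro poly_mapping_eqI) (auto simp: lookup_update lookup_add lookup_single in_keys_iff when_def)
  then show ?case using assms(2)[OF update(3)] by simp
qed

lemma mpoly_eval_single_mult: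
  "mpoly_eval (a::'v::finite \<Rightarrow> _) (Poly_Mapping.single m c * g) = c * mon_eval a m * mpoly_eval a g"
  by (induction g rule: mpoly_single_induct)
     (simp_all add: distrib_left mpoly_eval_add mult_single mpoly_eval_single mon_eval_add mult_ac)

lemma mpoly_eval_mult:
  "mpoly_eval (a::'v::finite \<Rightarrow> _) (f * g) = mpoly_eval a f * mpoly_eval a g"
  by (induction f rule: mpoly_single_induct)
     (simp_all add: distrib_right mpoly_eval_add mpoly_eval_single mpoly_eval_single_mult)

lemma two_power_inj: "(2::'k::field_char_0) ^ i = 2 ^ j \<Longrightarrow> i = j"
proof -
  assume "(2::'k) ^ i = 2 ^ j"
  then have "of_nat (2 ^ i) = (of_nat (2 ^ j) :: 'k)" by simp
  then have "(2::nat) ^ i = 2 ^ j" by (simp only: of_nat_eq_iff)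
  then show "i = j" by simp
qed

text \<open>Artin's argument for the linear independence of characters.\<close>

lemma mon_eval_independent:
  fixes c :: "('v::finite \<Rightarrow>\<^sub>0 nat) \<Rightarrow> 'k::field_char_0"
  assumes "finite S" "\<And>a. (\<Sum>m\<in>S. c m * mon_eval a m) = 0" "m \<in> S"
  shows "c m = 0"
  using assms
proof (induction S arbitrary: c m rule: finite_induct)
  case empty
  then show ?case by simp
next
  case (insert m0 S)
  have IH: "c m * (mon_eval b m - mon_eval b m0) = 0" if "m \<in> S" for b m
  proof (rule insert.IH[of "\<lambda>m. c m * (mon_eval b m - mon_eval b m0)"])
    fix a
    have "0 = (\<Sum>m\<in>insert m0 S. c m * mon_eval (\<lambda>v. b v * a v) m)
        - mon_eval b m0 * (\<Sum>m\<in>insert m0 S. c m * mon_eval a m)"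
      using insert.prems(1) by simp
    also have "\<dots> = (\<Sum>m\<in>insert m0 S. c m * (mon_eval b m - mon_eval b m0) * mon_eval a m)"
      by (simp add: sum_distrib_left mon_eval_mult algebra_simps flip: sum_subtractf)
    finally show "(\<Sum>m\<in>S. c m * (mon_eval b m - mon_eval b m0) * mon_eval a m) = 0"
      using insert.hyps by simp
  qed (use that in auto)
  have S: "c m = 0" if m: "m \<in> S" for m
  proof -
    obtain v where v: "Poly_Mapping.lookup m v \<noteq> Poly_Mapping.lookup m0 v"
      using m insert.hyps(2) by (metis poly_mapping_eqI)
    \<comment> \<open>Doubling only the variable \<open>v\<close> separates \<open>m\<close> from
      \<open>m0\<close>, since distinct powers of 2 differ in characteristic zero.\<close>
    define b where "b = (\<lambda>w. if w = v then 2 else (1::'k))"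
    have b: "mon_eval b k = 2 ^ Poly_Mapping.lookup k v" for k
      unfolding mon_eval_UNIV
      by (subst prod.remove[of _ v]) (auto simp: b_def intro!: prod.neutral)
    show "c m = 0" using IH[OF m, of b] v two_power_inj by (auto simp: b)
  qed
  have "c m0 = 0"
    using insert.prems(1)[of "\<lambda>_. 1"] insert.hyps S by (simp add: mon_eval_const)
  then show ?case using S insert.prems by auto
qed

lemma mpoly_eval_inj:
  fixes f :: "('v::finite, 'k::field_char_0) mpoly"
  assumes "\<And>a. mpoly_eval a f = mpoly_eval a g"
  shows "f = g"
proof (rule poly_mapping_eqI)
  fix m
  define S where "S = insert m (Poly_Mapping.keys f \<union> Poly_Mapping.keys g)"
  have "Poly_Mapping.lookup f m - Poly_Mapping.lookup g m = 0"
  proof (rule mon_eval_independent[of S "\<lambda>m. Poly_Mapping.lookup f m - Poly_Mapping.lookup g m"])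
    fix a
    have "mpoly_eval a f = (\<Sum>m\<in>S. Poly_Mapping.lookup f m * mon_eval a m)"
         "mpoly_eval a g = (\<Sum>m\<in>S. Poly_Mapping.lookup g m * mon_eval a m)"
      by (rule mpoly_eval_superset; auto simp: S_def)+
    then show "(\<Sum>m\<in>S. (Poly_Mapping.lookup f m - Poly_Mapping.lookup g m) * mon_eval a m) = 0"
      using assms[of a] by (simp add: left_diff_distrib sum_subtractf)
  qed (auto simp: S_def)
  then show "Poly_Mapping.lookup f m = Poly_Mapping.lookup g m" by simp
qed

section \<open>Algebras of polynomial functions and restriction to lines\<close>

definition polyfun :: "(('k::field_char_0)^'n::finite \<Rightarrow> 'k) \<Rightarrow> bool" where
  "polyfun F \<longleftrightarrow> (\<exists>f. \<forall>x. F x = mpoly_eval (($) x) f)"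

text \<open>Abstracting from the class of functions gives one substitution principle for polynomials
  in one, two and several variables, and for the pairs of congruent functions in
  \<open>polyfun_hyperplane_dvd\<close>.\<close>

definition fun_algebra :: "(('x \<Rightarrow> 'k::comm_semiring_1) \<Rightarrow> bool) \<Rightarrow> bool" where
  "fun_algebra P \<longleftrightarrow> (\<forall>c. P (\<lambda>_. c)) \<and> (\<forall>f g. P f \<longrightarrow> P g \<longrightarrow> P (\<lambda>x. f x + g x)) \<and>
     (\<forall>f g. P f \<longrightarrow> P g \<longrightarrow> P (\<lambda>x. f x * g x))"

lemma fun_algebraD:
  assumes "fun_algebra P"
  shows "P (\<lambda>_. c)" "P f \<Longrightarrow> P g \<Longrightarrow> P (\<lambda>x. f x + g x)" "P f \<Longrightarrow> P g \<Longrightarrow> P (\<lambda>x. f x * g x)"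
  using assms by (auto simp: fun_algebra_def)

lemma fun_algebra_sum:
  assumes "fun_algebra P" "\<And>i. i \<in> S \<Longrightarrow> P (f i)"
  shows "P (\<lambda>x. \<Sum>i\<in>S. f i x)"
  using assms(2) by (induction S rule: infinite_finite_induct) (auto intro: fun_algebraD[OF assms(1)])

lemma fun_algebra_prod:
  assumes "fun_algebra P" "\<And>i. i \<in> S \<Longrightarrow> P (f i)"
  shows "P (\<lambda>x. \<Prod>i\<in>S. f i x)"
  using assms(2) by (induction S rule: infinite_finite_induct) (auto intro: fun_algebraD[OF assms(1)])

lemma fun_algebra_power:
  assumes "fun_algebra P" "P f"
  shows "P (\<lambda>x. f x ^ k)"
  by (induction k) (auto intro: fun_algebraD[OF assms(1)] assms(2))

lemma fun_algebra_mpoly_eval: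
  assumes "fun_algebra P" "\<And>v. P (\<lambda>x. g x v)"
  shows "P (\<lambda>x. mpoly_eval (g x) f)"
  unfolding mpoly_eval_def
  by (intro fun_algebra_sum[OF assms(1)] fun_algebraD(3)[OF assms(1)] fun_algebraD(1)[OF assms(1)]
      fun_algebra_prod[OF assms(1)] fun_algebra_power[OF assms(1)] assms(2))

lemma polyfun_compose:
  assumes "polyfun F" "fun_algebra P" "\<And>i. P (\<lambda>x. g x $ i)"
  shows "P (\<lambda>x. F (g x))"
proof -
  obtain f where f: "F x = mpoly_eval (($) x) f" for x
    using assms(1) by (auto simp: polyfun_def)
  show ?thesis unfolding f by (rule fun_algebra_mpoly_eval[OF assms(2,3)])
qed

lemma polyfun_algebra: "fun_algebra polyfun"
  unfolding fun_algebra_def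
proof (intro conjI allI impI)
  fix c :: 'a
  show "polyfun (\<lambda>_::'a^'b. c)"
    unfolding polyfun_def by (rule exI[of _ "Poly_Mapping.single 0 c"]) (simp add: mpoly_eval_single)
next
  fix f g :: "'a^'b \<Rightarrow> 'a" assume "polyfun f" "polyfun g"
  then show "polyfun (\<lambda>x. f x + g x)" "polyfun (\<lambda>x. f x * g x)"
    unfolding polyfun_def by (metis mpoly_eval_add, metis mpoly_eval_mult)
qed

lemma polyfun_mpoly_eval: "polyfun (\<lambda>x. mpoly_eval (($) x) f)"
  by (auto simp: polyfun_def)

lemma polyfun_coord: "polyfun (\<lambda>x. x $ i)"
  unfolding polyfun_def
  by (rule exI[of _ "Poly_Mapping.single (Poly_Mapping.single i 1) 1"])
     (simp add: mpoly_eval_single mon_eval_def)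

lemmas polyfun_const = fun_algebraD(1)[OF polyfun_algebra]
  and polyfun_add = fun_algebraD(2)[OF polyfun_algebra]
  and polyfun_mult = fun_algebraD(3)[OF polyfun_algebra]
  and polyfun_sum = fun_algebra_sum[OF polyfun_algebra]
  and polyfun_power = fun_algebra_power[OF polyfun_algebra]

lemma polyfun_comp: "polyfun F \<Longrightarrow> (\<And>i. polyfun (\<lambda>x. g x $ i)) \<Longrightarrow> polyfun (\<lambda>x. F (g x))"
  by (rule polyfun_compose[OF _ polyfun_algebra])

definition is_poly1 :: "('k::comm_ring_1 \<Rightarrow> 'k) \<Rightarrow> bool" where
  "is_poly1 \<phi> \<longleftrightarrow> (\<exists>p. \<forall>s. \<phi> s = poly p s)"

lemma is_poly1_algebra: "fun_algebra is_poly1"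
  unfolding fun_algebra_def is_poly1_def
  by (metis poly_add poly_mult poly_const_conv)

lemma is_poly1_id: "is_poly1 (\<lambda>s. s)"
  unfolding is_poly1_def by (rule exI[of _ "[:0,1:]"]) simp

lemma polyfun_line:
  assumes "polyfun F"
  obtains p where "\<And>s. F (a + s *s b) = poly p s"
proof -
  have "is_poly1 (\<lambda>s. F (a + s *s b))"
    by (rule polyfun_compose[OF assms is_poly1_algebra])
       (auto intro!: fun_algebraD[OF is_poly1_algebra] is_poly1_id)
  then show ?thesis using that by (auto simp: is_poly1_def)
qed

text \<open>On the line through a point where \<open>F\<close> is nonzero and one where
  \<open>G\<close> is nonzero, both become nonzero polynomials in one variable, which form an
  integral domain.\<close>

lemma polyfun_mult_eq_0:
  assumes "polyfun F" "polyfun G" "\<And>x. F x * G x = 0"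
  shows "(\<forall>x. F x = 0) \<or> (\<forall>x. G x = 0)"
proof (rule ccontr)
  assume "\<not> ?thesis"
  then obtain a b where ab: "F a \<noteq> 0" "G b \<noteq> 0" by auto
  obtain p where p: "F (a + s *s (b - a)) = poly p s" for s using polyfun_line[OF assms(1)] by blast
  obtain q where q: "G (a + s *s (b - a)) = poly q s" for s using polyfun_line[OF assms(2)] by blast
  have "poly (p * q) s = 0" for s using assms(3) by (simp add: p[symmetric] q[symmetric])
  then have "p * q = 0" using poly_all_0_iff_0 by blast
  then have "p = 0 \<or> q = 0" by simp
  then show False using p[of 0] q[of 1] ab by auto
qed

text \<open>The set where \<open>H\<close> is nonzero is Zariski dense. This serves to cancel powers
  of a linear functional from identities.\<close>

lemma polyfun_eqI:
  assumes "polyfun F" "polyfun G" "polyfun H" "\<And>x. H x \<noteq> 0 \<Longrightarrow> F x = G x" "H a \<noteq> 0"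
  shows "F x = G x"
proof -
  have "polyfun (\<lambda>x. F x + (-1) * G x)"
    by (intro polyfun_add polyfun_mult polyfun_const assms)
  then have "(\<forall>x. F x + (-1) * G x = 0) \<or> (\<forall>x. H x = 0)"
    by (rule polyfun_mult_eq_0) (use assms in auto)
  then show ?thesis using assms(5) by auto
qed

lemma polyfun_linear:
  assumes "Vector_Spaces.linear (*s) (*s) (f :: 'k::field_char_0^'n::finite \<Rightarrow> 'k^'m::finite)"
  shows "polyfun (\<lambda>x. f x $ i)"
proof -
  have "polyfun (\<lambda>x. \<Sum>k\<in>UNIV. x $ k * f (axis k 1) $ i)"
    by (intro polyfun_sum polyfun_mult polyfun_coord polyfun_const)
  then show ?thesis by (simp flip: linear_componentwise[OF assms])
qed

lemma poly_no_roots_const: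
  fixes p :: "'k::alg_closed_field poly"
  assumes "\<And>s. poly p s \<noteq> 0"
  obtains c where "c \<noteq> 0" "p = [:c:]"
proof -
  have "degree p = 0" using alg_closed_imp_poly_has_root[of p] assms by auto
  then obtain c where "p = [:c:]" by (rule degree_eq_zeroE)
  with assms[of 0] that show ?thesis by auto
qed

lemma polyfun_unit_const:
  fixes F :: "('k::{alg_closed_field,field_char_0})^'n::finite \<Rightarrow> 'k"
  assumes "polyfun F" "\<And>x. F x \<noteq> 0"
  shows "F x = F 0"
proof -
  obtain p where p: "F (0 + s *s x) = poly p s" for s using polyfun_line[OF assms(1)] by blast
  have "poly p s \<noteq> 0" for s using assms(2) p by metis
  then obtain c where "p = [:c:]" using poly_no_roots_const by metis
  then show ?thesis using p[of 0] p[of 1] by simp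
qed

text \<open>A factorization into functions lifts to polynomials by \<open>mpoly_eval_inj\<close>,
  and a unit has no zeros, so it is constant on every line through the origin.\<close>

lemma irreducible_polyfun:
  fixes f :: "('n::finite, 'k::{alg_closed_field,field_char_0}) mpoly"
  assumes "irreducible f" "polyfun G" "polyfun H" "\<And>x. mpoly_eval (($) x) f = G x * H x"
  shows "(\<forall>x. G x = G 0) \<or> (\<forall>x. H x = H 0)"
proof -
  obtain g h where gh: "\<And>x. G x = mpoly_eval (($) x) g" "\<And>x. H x = mpoly_eval (($) x) h"
    using assms(2,3) by (auto simp: polyfun_def)
  have "f = g * h"
  proof (rule mpoly_eval_inj)
    fix a :: "'n \<Rightarrow> 'k"
    have "a = ($) (\<chi> i. a i)" by auto
    then show "mpoly_eval a f = mpoly_eval a (g * h)"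
      using assms(4) gh by (metis mpoly_eval_mult)
  qed
  then have "g dvd 1 \<or> h dvd 1" using irreducibleD[OF assms(1)] by auto
  moreover have "\<forall>x. mpoly_eval (($) x) r = mpoly_eval (($) 0) r" if r: "r dvd 1" for r :: "('n,'k) mpoly"
  proof -
    from r obtain r' where "1 = r * r'" by (auto simp: dvd_def)
    then have "mpoly_eval (($) x) r * mpoly_eval (($) x) r' = 1" for x :: "'k^'n"
      by (metis mpoly_eval_mult mpoly_eval_1)
    then have "mpoly_eval (($) x) r \<noteq> 0" for x :: "'k^'n"
      by (metis mult_zero_left zero_neq_one)
    then show ?thesis
      by (intro allI polyfun_unit_const[of "\<lambda>x. mpoly_eval (($) x) r"] polyfun_mpoly_eval)
  qed
  ultimately show ?thesis using gh by auto
qed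

lemma irreducible_polyfun_nonzero:
  fixes f :: "('n::finite, 'k::field_char_0) mpoly"
  assumes "irreducible f"
  shows "\<exists>x::'k^'n. mpoly_eval (($) x) f \<noteq> 0"
proof (rule ccontr)
  assume "\<not> ?thesis"
  then have z: "mpoly_eval (($) x) f = 0" for x :: "'k^'n" by auto
  have "f = 0"
  proof (rule mpoly_eval_inj)
    fix a :: "'n \<Rightarrow> 'k"
    have "a = ($) (\<chi> i. a i)" by auto
    then show "mpoly_eval a f = mpoly_eval a 0" using z by (metis mpoly_eval_0)
  qed
  then show False using assms by (simp add: irreducible_def)
qed

text \<open>Scaling only the variables in \<open>V\<close> fits the forms of an action, which are
  homogeneous in the point but not in the group element.\<close>

lemma homogeneous_in_eval_scale:
  assumes "homogeneous_in V d (f :: ('v::finite, 'k::comm_ring_1) mpoly)"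
  shows "mpoly_eval (\<lambda>v. if v \<in> V then s * a v else a v) f = s ^ d * mpoly_eval a f"
proof -
  have "mon_eval (\<lambda>v. if v \<in> V then s * a v else a v) m = s ^ d * mon_eval a m"
    if "m \<in> Poly_Mapping.keys f" for m
  proof -
    have "mon_eval (\<lambda>v. if v \<in> V then s * a v else a v) m
        = mon_eval (\<lambda>v. (if v \<in> V then s else 1) * a v) m"
      by (rule arg_cong[of _ _ "\<lambda>b. mon_eval b m"]) auto
    also have "\<dots> = mon_eval (\<lambda>v. if v \<in> V then s else 1) m * mon_eval a m"
      by (rule mon_eval_mult)
    also have "mon_eval (\<lambda>v. if v \<in> V then s else 1) m = (\<Prod>v\<in>V. s ^ Poly_Mapping.lookup m v)"
      unfolding mon_eval_UNIV by (rule prod.mono_neutral_cong_right) auto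
    also have "\<dots> = s ^ d"
      using assms that by (simp add: homogeneous_in_def flip: power_sum)
    finally show ?thesis .
  qed
  then show ?thesis
    unfolding mpoly_eval_mon sum_distrib_left by (intro sum.cong) (auto simp: mult_ac)
qed

lemma polyfun_homogeneous_components:
  fixes F :: "('k::field_char_0)^'n::finite \<Rightarrow> 'k"
  assumes "polyfun F"
  obtains q E where "\<And>j. polyfun (q j)" "\<And>s x. F (s *s x) = (\<Sum>j\<le>E. q j x * s ^ j)"
    "\<And>j s x. q j (s *s x) = s ^ j * q j x"
proof -
  obtain f where f: "F x = mpoly_eval (($) x) f" for x
    using assms by (auto simp: polyfun_def)
  define deg where "deg m = (\<Sum>v\<in>UNIV. Poly_Mapping.lookup m (v::'n))" for m :: "'n \<Rightarrow>\<^sub>0 nat"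
  let ?K = "Poly_Mapping.keys f"
  define q where "q j x = (\<Sum>m\<in>{m\<in>?K. deg m = j}. Poly_Mapping.lookup f m * mon_eval (($) x) m)"
    for j and x :: "'k^'n"
  have scale: "mon_eval (($) (s *s x)) m = s ^ deg m * mon_eval (($) x) m" for s m and x :: "'k^'n"
  proof -
    have "mon_eval (($) (s *s x)) m = mon_eval (\<lambda>v. s * x $ v) m" by (simp add: mon_eval_def)
    then show ?thesis by (simp add: mon_eval_mult mon_eval_const deg_def)
  qed
  define E where "E = Max (insert 0 (deg ` ?K))"
  have E: "deg m \<le> E" if "m \<in> ?K" for m unfolding E_def using that by (intro Max_ge) auto
  show ?thesis
  proof (rule that[of q E])
    show "polyfun (q j)" for j
      unfolding q_def mon_eval_def
      by (intro polyfun_sum polyfun_mult polyfun_const fun_algebra_prod[OF polyfun_algebra]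
          polyfun_power polyfun_coord)
    show "q j (s *s x) = s ^ j * q j x" for j s x
      unfolding q_def sum_distrib_left by (intro sum.cong) (auto simp: scale mult_ac)
    show "F (s *s x) = (\<Sum>j\<le>E. q j x * s ^ j)" for s x
    proof -
      have "(\<Sum>j\<le>E. q j x * s ^ j) =
          (\<Sum>j\<le>E. \<Sum>m\<in>{m\<in>?K. deg m = j}. Poly_Mapping.lookup f m * mon_eval (($) (s *s x)) m)"
        unfolding q_def sum_distrib_right by (intro sum.cong) (auto simp: scale mult_ac)
      also have "\<dots> = (\<Sum>m\<in>?K. Poly_Mapping.lookup f m * mon_eval (($) (s *s x)) m)"
        by (rule sum.group) (use E in auto)
      finally show ?thesis by (simp add: f mpoly_eval_mon)
    qed
  qed
qed

text \<open>The point \<open>x - l x *s e\<close> is a projection of \<open>x\<close> to the zero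
  set of \<open>l\<close>. Its coordinates agree with those of \<open>x\<close> modulo
  \<open>l\<close>, hence so do the values of \<open>F\<close>, and the value at the projection is
  zero.\<close>

lemma polyfun_hyperplane_dvd:
  fixes F :: "('k::field_char_0)^'n::finite \<Rightarrow> 'k"
  assumes "polyfun F" "polyfun l" "\<And>x. l (x - l x *s e) = 0" "\<And>x. l x = 0 \<Longrightarrow> F x = 0"
  obtains Q where "polyfun Q" "\<And>x. F x = l x * Q x"
proof -
  \<comment> \<open>A function on the product with \<open>bool\<close> is a pair of functions;
    \<open>P\<close> says that both are polynomial and congruent modulo \<open>l\<close>.\<close>
  define P where "P \<phi> \<longleftrightarrow> polyfun (\<lambda>x. \<phi> (True, x)) \<and> polyfun (\<lambda>x. \<phi> (False, x)) \<and>
     (\<exists>Q. polyfun Q \<and> (\<forall>x. \<phi> (True, x) - \<phi> (False, x) = l x * Q x))"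
    for \<phi> :: "bool \<times> ('k^'n) \<Rightarrow> 'k"
  have alg: "fun_algebra P"
    unfolding fun_algebra_def
  proof (intro conjI allI impI)
    fix c show "P (\<lambda>_. c)" unfolding P_def
      by (auto intro!: polyfun_const exI[of _ "\<lambda>_. 0"])
  next
    fix f g assume fg: "P f" "P g"
    then obtain Q R where QR: "polyfun Q" "polyfun R" "\<And>x. f (True, x) = f (False, x) + l x * Q x"
      "\<And>x. g (True, x) = g (False, x) + l x * R x"
      unfolding P_def by (auto simp: diff_eq_eq add.commute)
    have pf: "polyfun (\<lambda>x. f (b, x))" "polyfun (\<lambda>x. g (b, x))" for b
      using fg by (cases b; simp add: P_def)+
    show "P (\<lambda>x. f x + g x)" unfolding P_def
    proof (intro conjI exI[of _ "\<lambda>x. Q x + R x"] allI)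
      show "f (True, x) + g (True, x) - (f (False, x) + g (False, x)) = l x * (Q x + R x)" for x
        unfolding QR(3,4) by (simp add: algebra_simps)
    qed (intro polyfun_add pf QR(1,2))+
    show "P (\<lambda>x. f x * g x)" unfolding P_def
    proof (intro conjI exI[of _ "\<lambda>x. Q x * g (True, x) + f (False, x) * R x"] allI)
      show "f (True, x) * g (True, x) - f (False, x) * g (False, x) =
          l x * (Q x * g (True, x) + f (False, x) * R x)" for x
        unfolding QR(3,4) by (simp add: algebra_simps)
    qed (intro polyfun_add polyfun_mult pf QR(1,2))+
  qed
  have "P (\<lambda>bx. F (snd bx - (if fst bx then 0 else l (snd bx)) *s e))"
  proof (rule polyfun_compose[OF assms(1) alg])
    fix i
    have *: "polyfun (\<lambda>x. x $ i - l x * e $ i)"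
    proof -
      have "polyfun (\<lambda>x. x $ i + (-1) * (l x * e $ i))"
        by (intro polyfun_add polyfun_mult polyfun_const polyfun_coord assms)
      then show ?thesis by simp
    qed
    show "P (\<lambda>x. (snd x - (if fst x then 0 else l (snd x)) *s e) $ i)"
      unfolding P_def
      by (intro conjI exI[of _ "\<lambda>_. e $ i"]) (auto intro!: polyfun_const polyfun_coord *)
  qed
  then obtain Q where "polyfun Q" "\<And>x. F x - F (x - l x *s e) = l x * Q x"
    unfolding P_def by auto
  with assms(3,4) that show ?thesis by fastforce
qed

subsection \<open>Common divisors of families of polynomials\<close>

text \<open>The multiplier \<open>c\<close> is what cancellation requires: once the family is
  divided by \<open>g\<close>, a common divisor of all \<open>c * F i\<close> must divide
  \<open>c\<close>. Stated by divisibility alone, the property passes along multiplicative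
  bijections.\<close>

lemma finite_family_gcd:
  fixes F :: "'i \<Rightarrow> 'r::semiring_gcd"
  assumes "finite S"
  shows "\<exists>g. (\<forall>i\<in>S. g dvd F i) \<and> (\<forall>c d. (\<forall>i\<in>S. d dvd c * F i) \<longrightarrow> d dvd c * g)"
  using assms
proof (induction S)
  case empty
  then show ?case by (intro exI[of _ 0]) auto
next
  case (insert a S)
  then obtain g where g: "\<forall>i\<in>S. g dvd F i" "\<forall>c d. (\<forall>i\<in>S. d dvd c * F i) \<longrightarrow> d dvd c * g"
    by blast
  show ?case
  proof (intro exI[of _ "gcd (F a) g"] conjI allI impI)
    show "\<forall>i\<in>insert a S. gcd (F a) g dvd F i"
      using g(1) by (auto intro: dvd_trans[OF gcd_dvd2])
    fix c d assume d: "\<forall>i\<in>insert a S. d dvd c * F i"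
    then have "d dvd gcd (c * F a) (c * g)" using g(2) by auto
    then show "d dvd c * gcd (F a) g" by (simp add: gcd_mult_left)
  qed
qed

text \<open>
  The library provides greatest common divisors of polynomials only over fields of class
  \<^class>\<open>field_gcd\<close>, so an arbitrary field is wrapped into an isomorphic one of that class.
\<close>

typedef 'a wrap = "UNIV :: 'a set" morphisms unwrap wrap by simp

setup_lifting type_definition_wrap

instantiation wrap :: (field) field
begin
lift_definition zero_wrap :: "'a wrap" is 0 .
lift_definition one_wrap :: "'a wrap" is 1 .
lift_definition plus_wrap :: "'a wrap \<Rightarrow> 'a wrap \<Rightarrow> 'a wrap" is "(+)" .
lift_definition minus_wrap :: "'a wrap \<Rightarrow> 'a wrap \<Rightarrow> 'a wrap" is "(-)" .
lift_definition uminus_wrap :: "'a wrap \<Rightarrow> 'a wrap" is "uminus" .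
lift_definition times_wrap :: "'a wrap \<Rightarrow> 'a wrap \<Rightarrow> 'a wrap" is "(*)" .
lift_definition inverse_wrap :: "'a wrap \<Rightarrow> 'a wrap" is "inverse" .
lift_definition divide_wrap :: "'a wrap \<Rightarrow> 'a wrap \<Rightarrow> 'a wrap" is "(/)" .
instance
  by standard (transfer; simp add: algebra_simps divide_inverse)+
end

instantiation wrap ::
  (field) "{unique_euclidean_ring, normalization_euclidean_semiring, normalization_semidom_multiplicative}"
begin
definition [simp]: "normalize_wrap = (normalize_field :: 'a wrap \<Rightarrow> _)"
definition [simp]: "unit_factor_wrap = (unit_factor_field :: 'a wrap \<Rightarrow> _)"
definition [simp]: "modulo_wrap = (mod_field :: 'a wrap \<Rightarrow> _)"
definition [simp]: "euclidean_size_wrap = (euclidean_size_field :: 'a wrap \<Rightarrow> _)"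
definition [simp]: "division_segment (x :: 'a wrap) = 1"
instance
  by standard (simp_all add: dvd_field_iff field_split_simps split: if_splits)
end

instantiation wrap :: (field) euclidean_ring_gcd
begin
definition gcd_wrap :: "'a wrap \<Rightarrow> 'a wrap \<Rightarrow> 'a wrap" where
  "gcd_wrap = Euclidean_Algorithm.gcd"
definition lcm_wrap :: "'a wrap \<Rightarrow> 'a wrap \<Rightarrow> 'a wrap" where
  "lcm_wrap = Euclidean_Algorithm.lcm"
definition Gcd_wrap :: "'a wrap set \<Rightarrow> 'a wrap" where
 "Gcd_wrap = Euclidean_Algorithm.Gcd"
definition Lcm_wrap :: "'a wrap set \<Rightarrow> 'a wrap" where
 "Lcm_wrap = Euclidean_Algorithm.Lcm"
instance by standard (simp_all add: gcd_wrap_def lcm_wrap_def Gcd_wrap_def Lcm_wrap_def)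
end

instance wrap :: (field) field_gcd ..

lemma map_poly_mult_hom:
  fixes f :: "'a::comm_ring_1 \<Rightarrow> 'b::comm_ring_1"
  assumes "f 0 = 0" "\<And>a b. f (a + b) = f a + f b" "\<And>a b. f (a * b) = f a * f b"
  shows "map_poly f (p * q) = map_poly f p * map_poly f q"
proof (rule poly_eqI)
  fix n
  have sum: "f (\<Sum>i\<le>k. g i) = (\<Sum>i\<le>k. f (g i))" for g and k :: nat
    by (induction k) (auto simp: assms)
  show "coeff (map_poly f (p * q)) n = coeff (map_poly f p * map_poly f q) n"
    by (simp add: coeff_map_poly assms coeff_mult sum)
qed

lemma map_poly_add_hom:
  fixes f :: "'a::comm_ring_1 \<Rightarrow> 'b::comm_ring_1"
  assumes "f 0 = 0" "\<And>a b. f (a + b) = f a + f b"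
  shows "map_poly f (p + q) = map_poly f p + map_poly f q"
  by (rule poly_eqI) (simp add: coeff_map_poly assms)

lemma family_gcd_transport:
  fixes \<phi> :: "'r::comm_semiring_1 \<Rightarrow> 's::semiring_gcd" and F :: "'i::finite \<Rightarrow> 'r"
  assumes inv: "\<And>a. \<psi> (\<phi> a) = a" "\<And>b. \<phi> (\<psi> b) = b"
    and mult: "\<And>a b. \<phi> (a * b) = \<phi> a * \<phi> b"
  shows "\<exists>g. (\<forall>i. g dvd F i) \<and> (\<forall>c d. (\<forall>i. d dvd c * F i) \<longrightarrow> d dvd c * g)"
proof -
  have dvd: "a dvd b \<longleftrightarrow> \<phi> a dvd \<phi> b" for a b
  proof
    assume "\<phi> a dvd \<phi> b"
    then obtain k where k: "\<phi> b = \<phi> a * k" by (auto simp: dvd_def)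
    have "b = a * \<psi> k" by (metis inv mult k)
    then show "a dvd b" by simp
  qed (auto simp: dvd_def mult)
  obtain g where g: "\<forall>i. g dvd \<phi> (F i)" "\<forall>c d. (\<forall>i. d dvd c * \<phi> (F i)) \<longrightarrow> d dvd c * g"
    using finite_family_gcd[of UNIV "\<lambda>i. \<phi> (F i)"] by auto
  show ?thesis
    by (rule exI[of _ "\<psi> g"]) (use g in \<open>auto simp: dvd inv mult\<close>)
qed

lemma wrap_hom: "wrap 0 = 0" "wrap (a + b) = wrap a + wrap b" "wrap (a * b) = wrap a * wrap b"
  "unwrap 0 = 0"
  by (simp_all add: zero_wrap_def plus_wrap.abs_eq times_wrap.abs_eq wrap_inverse)

lemma map_poly_inverse:
  assumes "f 0 = 0" "g 0 = 0" "\<And>x. g (f x) = x"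
  shows "map_poly g (map_poly f p) = p"
  by (rule poly_eqI) (simp add: coeff_map_poly assms)

lemma poly_family_gcd:
  fixes F :: "'i::finite \<Rightarrow> 'k::field poly"
  shows "\<exists>g. (\<forall>i. g dvd F i) \<and> (\<forall>c d. (\<forall>i. d dvd c * F i) \<longrightarrow> d dvd c * g)"
proof (rule family_gcd_transport)
  show "map_poly unwrap (map_poly wrap p) = p" for p :: "'k poly"
    by (intro map_poly_inverse wrap_hom) (simp add: wrap_inverse)
  show "map_poly wrap (map_poly unwrap p) = p" for p :: "'k wrap poly"
    by (intro map_poly_inverse wrap_hom) (simp add: unwrap_inverse)
  show "map_poly wrap (p * q) = map_poly wrap p * map_poly wrap q" for p q :: "'k poly"
    by (intro map_poly_mult_hom wrap_hom)
qed

lemma poly2_family_gcd: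
  fixes F :: "'i::finite \<Rightarrow> 'k::field poly poly"
  shows "\<exists>g. (\<forall>i. g dvd F i) \<and> (\<forall>c d. (\<forall>i. d dvd c * F i) \<longrightarrow> d dvd c * g)"
proof (rule family_gcd_transport)
  show "map_poly (map_poly unwrap) (map_poly (map_poly wrap) p) = p" for p :: "'k poly poly"
    by (intro map_poly_inverse wrap_hom map_poly_0) (simp add: wrap_inverse)
  show "map_poly (map_poly wrap) (map_poly (map_poly unwrap) p) = p" for p :: "'k wrap poly poly"
    by (intro map_poly_inverse wrap_hom map_poly_0) (simp add: unwrap_inverse)
  show "map_poly (map_poly wrap) (p * q) = map_poly (map_poly wrap) p * map_poly (map_poly wrap) q"
    for p q :: "'k poly poly"
    by (intro map_poly_mult_hom map_poly_add_hom wrap_hom map_poly_0)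
qed

text \<open>By the cross relation \<open>F i0\<close> divides \<open>G i0 * F j\<close> for every
  \<open>j\<close>, so it divides \<open>G i0 * g\<close> and hence \<open>G i0\<close>, as
  \<open>g\<close> is a unit. The quotient serves for all indices.\<close>

lemma proportional_families:
  fixes F G :: "'i \<Rightarrow> 'r::idom"
  assumes g: "\<And>c d. (\<And>i. d dvd c * F i) \<Longrightarrow> d dvd c * g" "g dvd 1"
    and cross: "\<And>i j. F i * G j = F j * G i" and nz: "F i0 \<noteq> 0"
  obtains h where "\<And>i. G i = h * F i"
proof -
  have "F i0 dvd G i0 * g"
    by (rule g(1)) (metis cross dvd_triv_left mult.commute)
  moreover obtain g' where "1 = g * g'" using g(2) by (auto simp: dvd_def)
  ultimately have "F i0 dvd G i0" by (metis dvd_mult2 mult.assoc mult.right_neutral)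
  then obtain h where h: "G i0 = F i0 * h" by (auto simp: dvd_def)
  have "G i = h * F i" for i
  proof -
    have "F i0 * G i = F i0 * (h * F i)" using cross[of i0 i] h by (simp add: mult_ac)
    then show ?thesis using nz by simp
  qed
  then show ?thesis by (rule that)
qed

text \<open>Both tuples describe the same projective curve. The common divisor of \<open>P\<close>
  has no roots and is a unit; a root of the proportionality factor would be a common root of
  \<open>Q\<close>, so the factor is constant.\<close>

lemma nowhere_zero_proportional:
  fixes P Q :: "'i::finite \<Rightarrow> 'k::{alg_closed_field, field_char_0} poly"
  assumes P: "\<And>s. \<exists>i. poly (P i) s \<noteq> 0" and Q: "\<And>s. \<exists>i. poly (Q i) s \<noteq> 0"
    and cross: "\<And>i j s. poly (P i) s * poly (Q j) s = poly (P j) s * poly (Q i) s"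
  obtains c where "c \<noteq> 0" "\<And>i. Q i = smult c (P i)"
proof -
  obtain g where g: "\<forall>i. g dvd P i" "\<forall>c d. (\<forall>i. d dvd c * P i) \<longrightarrow> d dvd c * g"
    using poly_family_gcd[of P] by blast
  have "poly g s \<noteq> 0" for s
    using P[of s] g(1) by (metis dvdE mult_zero_left poly_mult)
  then obtain a where "a \<noteq> 0" "g = [:a:]" using poly_no_roots_const by metis
  then have g1: "g dvd 1" by (metis is_unit_triv)
  have "poly (P i * Q j) s = poly (P j * Q i) s" for i j s using cross by simp
  then have cross': "P i * Q j = P j * Q i" for i j using poly_ext by blast
  obtain i0 where "P i0 \<noteq> 0" using P[of 0] by force
  then obtain h where h: "\<And>i. Q i = h * P i"
    using proportional_families[of P g Q] g(2) g1 cross' by metis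
  have "poly h s \<noteq> 0" for s
    using Q[of s] h by (metis mult_zero_left poly_mult)
  then obtain c where "c \<noteq> 0" "h = [:c:]" using poly_no_roots_const by metis
  then show ?thesis using h that by simp
qed

section \<open>Polynomials in two variables and reflected polynomials\<close>

definition eval2 :: "'k::comm_ring_1 poly poly \<Rightarrow> 'k \<Rightarrow> 'k \<Rightarrow> 'k" where
  "eval2 g s u = poly (poly g [:u:]) s"

lemma eval2_simps [simp]:
  "eval2 (f + g) s u = eval2 f s u + eval2 g s u" "eval2 (f * g) s u = eval2 f s u * eval2 g s u"
  "eval2 [:[:c:]:] s u = c" "eval2 0 s u = 0" "eval2 [:0, 1:] s u = u" "eval2 [:[:0, 1:]:] s u = s"
  "eval2 [:p:] s u = poly p s"
  by (simp_all add: eval2_def)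

text \<open>Specializing the inner variable first is the form needed when \<open>s\<close> is fixed
  and the degree in \<open>u\<close> matters.\<close>

lemma eval2_map_poly: "eval2 g s u = poly (map_poly (\<lambda>a. poly a s) g) u"
  unfolding eval2_def by (induction g) (auto simp: map_poly_pCons)

lemma eval2_eqI:
  fixes f g :: "'k::field_char_0 poly poly"
  assumes "\<And>s u. eval2 f s u = eval2 g s u"
  shows "f = g"
proof (rule poly_eqI)
  fix n
  have "poly (coeff f n) s = poly (coeff g n) s" for s
  proof -
    have "map_poly (\<lambda>a. poly a s) f = map_poly (\<lambda>a. poly a s) g"
      using assms by (intro poly_ext) (simp add: eval2_map_poly)
    then show ?thesis by (metis coeff_map_poly poly_0)
  qed
  then show "coeff f n = coeff g n" by (rule poly_ext)
qed

definition is_poly2 :: "('k::comm_ring_1 \<times> 'k \<Rightarrow> 'k) \<Rightarrow> bool" where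
  "is_poly2 \<phi> \<longleftrightarrow> (\<exists>g. \<forall>s u. \<phi> (s, u) = eval2 g s u)"

lemma is_poly2_algebra: "fun_algebra is_poly2"
  unfolding fun_algebra_def is_poly2_def by (metis eval2_simps(1,2,3))

lemma is_poly2_fst: "is_poly2 fst" and is_poly2_snd: "is_poly2 snd"
  unfolding is_poly2_def by (metis eval2_simps(6) fst_conv, metis eval2_simps(5) snd_conv)

lemma poly_altdef_le: "degree (p :: 'a::comm_ring_1 poly) \<le> n \<Longrightarrow> poly p x = (\<Sum>i\<le>n. coeff p i * x ^ i)"
  by (subst poly_altdef, rule sum.mono_neutral_left) (auto simp: coeff_eq_0)

text \<open>Multiplication by \<open>u ^ degree B\<close> turns the right-hand side into
  \<open>u ^ n\<close> times the reflected polynomial of \<open>B\<close>. This compares the two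
  charts of a projective line.\<close>

lemma poly_reflection:
  fixes A B :: "'k::field_char_0 poly"
  assumes "\<And>u. u \<noteq> 0 \<Longrightarrow> poly A u = u ^ n * poly B (1 / u)"
  shows "degree A \<le> n" "coeff A n = poly B 0"
proof -
  define d where "d = degree B"
  have "poly (monom 1 d * A) u = poly (monom 1 n * reflect_poly B) u" if "u \<noteq> 0" for u
    using that assms[OF that] by (simp add: poly_monom poly_reflect_poly_nz d_def inverse_eq_divide)
  \<comment> \<open>The extra factor \<open>u\<close> makes the values agree at zero as well, so
    that the polynomials are equal.\<close>
  then have "poly (monom 1 1 * (monom 1 d * A)) u = poly (monom 1 1 * (monom 1 n * reflect_poly B)) u" for u
    by (cases "u = 0") (auto simp: poly_monom)
  then have "monom 1 1 * (monom 1 d * A) = monom 1 1 * (monom 1 n * reflect_poly B)"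
    by (rule poly_ext)
  then have *: "monom 1 d * A = monom 1 n * reflect_poly B"
    by (simp add: monom_eq_0_iff)
  show "degree A \<le> n"
  proof (cases "A = 0")
    case False
    then have "d + degree A = degree (monom 1 n * reflect_poly B)"
      by (subst *[symmetric], subst degree_mult_eq) (simp_all add: monom_eq_0_iff degree_monom_eq)
    also have "\<dots> \<le> n + d"
      using degree_mult_le[of "monom 1 n" "reflect_poly B"] degree_reflect_poly_le[of B]
      by (simp add: degree_monom_eq d_def)
    finally show ?thesis by simp
  qed simp
  have "coeff A n = coeff (monom 1 d * A) (d + n)" by (simp add: coeff_monom_mult)
  also have "\<dots> = coeff (reflect_poly B) d" by (simp add: * coeff_monom_mult)
  also have "\<dots> = poly B 0" by (simp add: coeff_reflect_poly d_def poly_0_coeff_0)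
  finally show "coeff A n = poly B 0" .
qed

subsection \<open>Actions on projective space are linear\<close>

definition proj_point :: "'k::field ^ 'n::finite \<Rightarrow> ('k, 'n) proj" where
  "proj_point x = Abs_proj (vec.span {x})"

lemma hom_coords_proj_point: "x \<noteq> 0 \<Longrightarrow> hom_coords (proj_point x) x"
  unfolding hom_coords_def proj_point_def by (subst Abs_proj_inverse) auto

lemma hom_coords_eqI: "hom_coords p x \<Longrightarrow> hom_coords q x \<Longrightarrow> p = q"
  unfolding hom_coords_def by (metis Rep_proj_inject)

lemma proj_point_eqI: "hom_coords p x \<Longrightarrow> proj_point x = p"
  by (metis hom_coords_def hom_coords_eqI hom_coords_proj_point)

lemma hom_coords_exists: obtains x where "hom_coords p x"
  using Rep_proj[of p] unfolding hom_coords_def by blast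

lemma hom_coords_scale:
  assumes "hom_coords p x" "c \<noteq> 0"
  shows "hom_coords p (c *s x)"
proof -
  have "vec.span {c *s x} = vec.span {x}"
    using assms(2) vec.span_image_scale[of "{x}" "\<lambda>_. c"] by simp
  then show ?thesis using assms unfolding hom_coords_def by simp
qed

lemma hom_coords_proportional:
  assumes "hom_coords p x" "hom_coords p y"
  obtains c where "c \<noteq> 0" "y = c *s x"
proof -
  have "y \<in> vec.span {x}" using assms vec.span_base[of y "{y}"] unfolding hom_coords_def by simp
  then obtain c where "y = c *s x" by (auto simp: vec.span_singleton)
  moreover have "c \<noteq> 0"
  proof
    assume "c = 0"
    then show False using assms(2) \<open>y = c *s x\<close> by (simp add: hom_coords_def)
  qed
  ultimately show ?thesis by (intro that)
qed

lemma hom_coords_cross: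
  assumes "hom_coords p x" "hom_coords p y"
  shows "x $ i * y $ j = x $ j * y $ i"
proof -
  obtain c where "y = c *s x" using hom_coords_proportional[OF assms] .
  then show ?thesis by (simp add: mult_ac)
qed

text \<open>Lifts of one projective curve differ by a constant, and the value at zero shows that it
  is one. This rigidity governs the lifted action.\<close>

lemma curve_eqI:
  fixes P Q :: "'n::finite \<Rightarrow> 'k::{alg_closed_field, field_char_0} poly"
  assumes P: "\<And>s. hom_coords (q s) (\<chi> i. poly (P i) s)" and Q: "\<And>s. hom_coords (q s) (\<chi> i. poly (Q i) s)"
    and eq: "\<And>i. poly (P i) 0 = poly (Q i) 0"
  shows "P = Q"
proof -
  have nz: "\<exists>i. poly (R i) s \<noteq> 0" if "\<And>s. hom_coords (q s) (\<chi> i. poly (R i) s)"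
    for R :: "'n \<Rightarrow> 'k poly" and s
    using that[of s] unfolding hom_coords_def by (auto simp: vec_eq_iff)
  have cross: "poly (P i) s * poly (Q j) s = poly (P j) s * poly (Q i) s" for i j s
    using hom_coords_cross[OF P Q] by simp
  obtain c where c: "c \<noteq> 0" "\<And>i. Q i = smult c (P i)"
    using nowhere_zero_proportional[of P Q, OF nz[OF P] nz[OF Q] cross] by blast
  obtain i where "poly (P i) 0 \<noteq> 0" using nz[OF P] by blast
  moreover have "poly (P i) 0 = c * poly (P i) 0" by (subst eq) (simp add: c(2))
  ultimately have "c = 1" by simp
  then show ?thesis using c by auto
qed

section \<open>Lifting an action on projective space to vectors\<close>

locale projective_action =
  fixes \<beta> :: "('k::{alg_closed_field, field_char_0})^'m::finite \<Rightarrow> ('k, 'n::finite) proj \<Rightarrow> ('k, 'n) proj"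
  assumes action: "regular_action UNIV \<beta>"
begin

lemma \<beta>_zero: "\<beta> 0 p = p" and \<beta>_add: "\<beta> (s + t) p = \<beta> s (\<beta> t p)"
  using action unfolding regular_action_def by auto

lemma local_representation:
  assumes nz: "\<And>u. x + u *s y \<noteq> 0"
  obtains G where "\<exists>i. eval2 (G i) s0 u0 \<noteq> 0"
    "\<And>s u. \<exists>i. eval2 (G i) s u \<noteq> 0 \<Longrightarrow>
      hom_coords (\<beta> (s *s \<tau>) (proj_point (x + u *s y))) (\<chi> i. eval2 (G i) s u)"
proof -
  let ?p = "proj_point (x + u0 *s y)"
  have "\<exists>d (F :: 'n \<Rightarrow> ('m + 'n, 'k) mpoly).
      (\<forall>i. homogeneous_in (range Inr) d (F i)) \<and>
      (\<exists>x i. hom_coords ?p x \<and> mpoly_eval (case_sum (($) (s0 *s \<tau>)) (($) x)) (F i) \<noteq> 0) \<and>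
      (\<forall>s. \<forall>q\<in>UNIV. \<forall>y. hom_coords q y \<and>
          (\<exists>i. mpoly_eval (case_sum (($) s) (($) y)) (F i) \<noteq> 0) \<longrightarrow>
        hom_coords (\<beta> s q) (\<chi> i. mpoly_eval (case_sum (($) s) (($) y)) (F i)))"
    using action unfolding regular_action_def regular_on_def by blast
  then obtain d F x' i where F: "\<And>i. homogeneous_in (range Inr) d (F i)" "hom_coords ?p x'"
    "mpoly_eval (case_sum (($) (s0 *s \<tau>)) (($) x')) (F i) \<noteq> 0"
    "\<And>s q y. hom_coords q y \<Longrightarrow> \<exists>i. mpoly_eval (case_sum (($) s) (($) y)) (F i) \<noteq> 0 \<Longrightarrow>
        hom_coords (\<beta> s q) (\<chi> i. mpoly_eval (case_sum (($) s) (($) y)) (F i))"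
    by blast
  obtain c where c: "c \<noteq> 0" "x + u0 *s y = c *s x'"
    using hom_coords_proportional[OF F(2) hom_coords_proj_point[OF nz]] .
  have "case_sum (($) (s0 *s \<tau>)) (($) (c *s x')) =
      (\<lambda>v. if v \<in> range Inr then c * case_sum (($) (s0 *s \<tau>)) (($) x') v
        else case_sum (($) (s0 *s \<tau>)) (($) x') v)"
    by (rule ext) (auto split: sum.splits)
  then have nz': "mpoly_eval (case_sum (($) (s0 *s \<tau>)) (($) (x + u0 *s y))) (F i) \<noteq> 0"
    using homogeneous_in_eval_scale[OF F(1)[of i]] c F(3) by simp
  have "is_poly2 (\<lambda>su. mpoly_eval (case_sum (($) (fst su *s \<tau>)) (($) (x + snd su *s y))) (F i))" for i
  proof (rule fun_algebra_mpoly_eval[OF is_poly2_algebra])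
    fix v :: "'m + 'n"
    show "is_poly2 (\<lambda>su. case_sum (($) (fst su *s \<tau>)) (($) (x + snd su *s y)) v)"
      by (cases v) (auto intro!: fun_algebraD[OF is_poly2_algebra] is_poly2_fst is_poly2_snd)
  qed
  then have "\<forall>i. \<exists>g. \<forall>s u. mpoly_eval (case_sum (($) (s *s \<tau>)) (($) (x + u *s y))) (F i) = eval2 g s u"
    unfolding is_poly2_def by simp
  then obtain G where G: "\<And>i s u. mpoly_eval (case_sum (($) (s *s \<tau>)) (($) (x + u *s y))) (F i) = eval2 (G i) s u"
    by metis
  show ?thesis
  proof (rule that[of G])
    show "\<exists>i. eval2 (G i) s0 u0 \<noteq> 0" using nz' by (auto simp: G)
    fix s u
    assume "\<exists>i. eval2 (G i) s u \<noteq> 0"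
    then show "hom_coords (\<beta> (s *s \<tau>) (proj_point (x + u *s y))) (\<chi> i. eval2 (G i) s u)"
      using F(4)[OF hom_coords_proj_point[OF nz], of "s *s \<tau>" u] by (simp add: G)
  qed
qed

text \<open>
  Cancelling the common divisor of one local representation yields a representation that is valid
  everywhere, since every other local representation is a multiple of it.
\<close>

lemma global_representation:
  assumes nz: "\<And>u. x + u *s y \<noteq> 0"
  obtains F where "\<And>s u. hom_coords (\<beta> (s *s \<tau>) (proj_point (x + u *s y))) (\<chi> i. eval2 (F i) s u)"
proof -
  let ?q = "\<lambda>s u. \<beta> (s *s \<tau>) (proj_point (x + u *s y))"
  obtain G0 where G0: "\<exists>i. eval2 (G0 i) 0 0 \<noteq> 0"
    "\<And>s u. \<exists>i. eval2 (G0 i) s u \<noteq> 0 \<Longrightarrow> hom_coords (?q s u) (\<chi> i. eval2 (G0 i) s u)"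
    using local_representation[OF nz, of 0 0 \<tau>] by blast
  obtain g where g: "\<forall>i. g dvd G0 i" "\<forall>c d. (\<forall>i. d dvd c * G0 i) \<longrightarrow> d dvd c * g"
    using poly2_family_gcd[of G0] by blast
  then obtain F where F: "\<And>i. G0 i = g * F i" unfolding dvd_def by metis
  obtain i0 where i0: "eval2 (G0 i0) 0 0 \<noteq> 0" using G0(1) by blast
  then have g0: "g \<noteq> 0" and F0: "F i0 \<noteq> 0" using F[of i0] by auto
  \<comment> \<open>Cancelling \<open>g\<close> leaves a family whose greatest common divisor is 1,
    in the form that \<open>proportional_families\<close> asks for.\<close>
  have coprime: "d dvd c * 1" if "\<And>i. d dvd c * F i" for c d
  proof -
    have "\<forall>i. g * d dvd c * G0 i"
      using that unfolding F by (metis mult.assoc mult.commute mult_dvd_mono dvd_refl)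
    then have "g * d dvd c * g" using g(2) by blast
    then show ?thesis using g0 by (simp add: mult.commute)
  qed
  have "hom_coords (?q s0 u0) (\<chi> i. eval2 (F i) s0 u0)" for s0 u0
  proof -
    obtain G where G: "\<exists>i. eval2 (G i) s0 u0 \<noteq> 0"
      "\<And>s u. \<exists>i. eval2 (G i) s u \<noteq> 0 \<Longrightarrow> hom_coords (?q s u) (\<chi> i. eval2 (G i) s u)"
      using local_representation[OF nz, of s0 u0 \<tau>] by blast
    have cross: "F i * G j = F j * G i" for i j
    proof -
      have "eval2 (G0 i * G j) s u = eval2 (G0 j * G i) s u" for s u
      proof (cases "(\<exists>i. eval2 (G0 i) s u \<noteq> 0) \<and> (\<exists>i. eval2 (G i) s u \<noteq> 0)")
        case True
        then show ?thesis using hom_coords_cross[OF G0(2) G(2), of s u i j] by simp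
      qed auto
      then have "G0 i * G j = G0 j * G i" by (rule eval2_eqI)
      then have "g * (F i * G j) = g * (F j * G i)" by (simp add: F mult.assoc)
      then show ?thesis using g0 by simp
    qed
    obtain h where h: "\<And>i. G i = h * F i"
      using proportional_families[of F 1 G, OF coprime dvd_refl cross F0] by blast
    have h0: "eval2 h s0 u0 \<noteq> 0" using G(1) h by auto
    have "hom_coords (?q s0 u0) (inverse (eval2 h s0 u0) *s (\<chi> i. eval2 (G i) s0 u0))"
      using h0 by (intro hom_coords_scale G) auto
    also have "inverse (eval2 h s0 u0) *s (\<chi> i. eval2 (G i) s0 u0) = (\<chi> i. eval2 (F i) s0 u0)"
      using h0 by (simp add: vec_eq_iff h)
    finally show ?thesis .
  qed
  then show ?thesis by (rule that)
qed

lemma curve_exists: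
  assumes "x \<noteq> 0"
  shows "\<exists>P. (\<forall>i. poly (P i) 0 = x $ i) \<and> (\<forall>s. hom_coords (\<beta> (s *s \<tau>) (proj_point x)) (\<chi> i. poly (P i) s))"
proof -
  obtain F where F: "\<And>s u. hom_coords (\<beta> (s *s \<tau>) (proj_point (x + u *s 0))) (\<chi> i. eval2 (F i) s u)"
    using global_representation[of x 0 \<tau>] assms by auto
  define P where "P i = poly (F i) [:0:]" for i
  have P: "hom_coords (\<beta> (s *s \<tau>) (proj_point x)) (\<chi> i. poly (P i) s)" for s
    using F[of s 0] by (simp add: eval2_def P_def)
  have "hom_coords (proj_point x) (\<chi> i. poly (P i) 0)" using P[of 0] by (simp add: \<beta>_zero)
  then obtain c where c: "c \<noteq> 0" "x = c *s (\<chi> i. poly (P i) 0)"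
    using hom_coords_proportional hom_coords_proj_point[OF assms] by metis
  have "hom_coords (\<beta> (s *s \<tau>) (proj_point x)) (\<chi> i. poly (smult c (P i)) s)" for s
  proof -
    have "(\<chi> i. poly (smult c (P i)) s) = c *s (\<chi> i. poly (P i) s)" by (simp add: vec_eq_iff)
    then show ?thesis using hom_coords_scale[OF P c(1)] by metis
  qed
  moreover have "poly (smult c (P i)) 0 = x $ i" for i by (subst c(2)) simp
  ultimately show ?thesis by (intro exI[of _ "\<lambda>i. smult c (P i)"]) blast
qed

text \<open>The lift of the orbit curve that starts at \<open>x\<close>, unique by
  \<open>curve_unique\<close>; the value for \<open>x = 0\<close> keeps it linear in
  \<open>x\<close>.\<close>

definition curve :: "'k^'m \<Rightarrow> 'k^'n \<Rightarrow> 'n \<Rightarrow> 'k poly" where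
  "curve \<tau> x = (if x = 0 then \<lambda>_. 0 else SOME P. (\<forall>i. poly (P i) 0 = x $ i) \<and>
     (\<forall>s. hom_coords (\<beta> (s *s \<tau>) (proj_point x)) (\<chi> i. poly (P i) s)))"

lemma curve_0: "poly (curve \<tau> x i) 0 = x $ i"
  and curve_hom_coords: "x \<noteq> 0 \<Longrightarrow> hom_coords (\<beta> (s *s \<tau>) (proj_point x)) (\<chi> i. poly (curve \<tau> x i) s)"
  using someI_ex[OF curve_exists[of x \<tau>]] by (auto simp: curve_def)

lemma curve_unique:
  assumes "x \<noteq> 0" "\<And>s. hom_coords (\<beta> (s *s \<tau>) (proj_point x)) (\<chi> i. poly (P i) s)" "\<And>i. poly (P i) 0 = x $ i"
  shows "curve \<tau> x = P"
  by (rule curve_eqI[OF curve_hom_coords[OF assms(1)] assms(2)]) (simp add: curve_0 assms(3))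

lemma curve_scale: "curve \<tau> (c *s x) i = smult c (curve \<tau> x i)"
proof (cases "c = 0 \<or> x = 0")
  case True
  then show ?thesis by (auto simp: curve_def)
next
  case False
  have pt: "proj_point (c *s x) = proj_point x"
    using False by (intro proj_point_eqI hom_coords_scale hom_coords_proj_point) auto
  have "curve \<tau> (c *s x) = (\<lambda>i. smult c (curve \<tau> x i))"
  proof (rule curve_unique)
    fix s
    have "(\<chi> i. poly (smult c (curve \<tau> x i)) s) = c *s (\<chi> i. poly (curve \<tau> x i) s)"
      by (simp add: vec_eq_iff)
    then show "hom_coords (\<beta> (s *s \<tau>) (proj_point (c *s x))) (\<chi> i. poly (smult c (curve \<tau> x i)) s)"
      unfolding pt using hom_coords_scale[OF curve_hom_coords] False by metis
  qed (use False in \<open>auto simp: curve_0\<close>)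
  then show ?thesis by simp
qed

text \<open>At time zero the common representation and \<open>x + u *s y\<close> are nowhere zero
  lifts of the same line, so they differ by a constant \<open>c\<close> independent of
  \<open>u\<close>. Division by \<open>c\<close> normalizes all curves at once, which makes them
  polynomial in \<open>u\<close>.\<close>

lemma curve_plane:
  assumes "\<And>u. x + u *s y \<noteq> 0"
  obtains A where "\<And>i s u. poly (curve \<tau> (x + u *s y) i) s = poly (A i s) u"
proof -
  obtain F where F: "\<And>s u. hom_coords (\<beta> (s *s \<tau>) (proj_point (x + u *s y))) (\<chi> i. eval2 (F i) s u)"
    using global_representation[OF assms] by blast
  define A where "A i s = map_poly (\<lambda>a. poly a s) (F i)" for i s
  have A: "poly (A i s) u = eval2 (F i) s u" for i s u by (simp add: A_def eval2_map_poly)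
  have AF: "hom_coords (proj_point (x + u *s y)) (\<chi> i. poly (A i 0) u)" for u
    using F[of 0 u] by (simp add: \<beta>_zero A)
  have xy: "hom_coords (proj_point (x + u *s y)) (\<chi> i. poly [:x $ i, y $ i:] u)" for u
  proof -
    have "(\<chi> i. poly [:x $ i, y $ i:] u) = x + u *s y" by (simp add: vec_eq_iff)
    then show ?thesis using hom_coords_proj_point[OF assms] by metis
  qed
  have nz: "\<exists>i. poly [:x $ i, y $ i:] u \<noteq> 0" "\<exists>i. poly (A i 0) u \<noteq> 0" for u
    using xy[of u] AF[of u] unfolding hom_coords_def by (auto simp: vec_eq_iff)
  have cross: "poly [:x $ i, y $ i:] u * poly (A j 0) u = poly [:x $ j, y $ j:] u * poly (A i 0) u" for i j u
    using hom_coords_cross[OF xy AF, of u i j] by simp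
  obtain c where c: "c \<noteq> 0" "\<And>i. A i 0 = smult c [:x $ i, y $ i:]"
    using nowhere_zero_proportional[of "\<lambda>i. [:x $ i, y $ i:]" "\<lambda>i. A i 0", OF nz cross] by blast
  have "poly (curve \<tau> (x + u *s y) i) s = poly (smult (inverse c) (A i s)) u" for i s u
  proof -
    have "curve \<tau> (x + u *s y) = (\<lambda>i. smult (inverse c) (poly (F i) [:u:]))"
    proof (rule curve_unique[OF assms])
      fix s
      have "(\<chi> i. poly (smult (inverse c) (poly (F i) [:u:])) s) = inverse c *s (\<chi> i. eval2 (F i) s u)"
        by (simp add: vec_eq_iff eval2_def)
      then show "hom_coords (\<beta> (s *s \<tau>) (proj_point (x + u *s y)))
          (\<chi> i. poly (smult (inverse c) (poly (F i) [:u:])) s)"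
        using hom_coords_scale[OF F] c(1) by (metis inverse_nonzero_iff_nonzero)
      fix i
      have "poly (A i 0) u = c * (x + u *s y) $ i" by (simp add: c(2) algebra_simps)
      then show "poly (smult (inverse c) (poly (F i) [:u:])) 0 = (x + u *s y) $ i"
        using c(1) by (simp add: A eval2_def)
    qed
    then show ?thesis by (simp add: A eval2_def)
  qed
  then show ?thesis by (rule that)
qed

text \<open>
  The charts \<open>x + u y\<close> and \<open>u\<^sup>-\<^sup>1 x + y\<close> of the line through \<open>x\<close> and \<open>y\<close> together bound the degree
  in \<open>u\<close> by one: the degree of the image of a line is constant along the action.
\<close>

lemma curve_add: "curve \<tau> (x + y) i = curve \<tau> x i + curve \<tau> y i"
proof (cases "\<exists>c. x = c *s y \<or> y = c *s x")
  \<comment> \<open>For dependent vectors the line may pass through the origin, where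
    \<open>curve_plane\<close> does not apply; scaling suffices.\<close>
  case True
  then obtain c where "x = c *s y \<or> y = c *s x" by blast
  then show ?thesis
  proof
    assume x: "x = c *s y"
    then have "x + y = (c + 1) *s y" by (simp add: vec_eq_iff algebra_simps)
    then have "curve \<tau> (x + y) i = smult (c + 1) (curve \<tau> y i)" by (simp only: curve_scale)
    then show ?thesis by (simp add: x curve_scale smult_add_left)
  next
    assume y: "y = c *s x"
    then have "x + y = (1 + c) *s x" by (simp add: vec_eq_iff algebra_simps)
    then have "curve \<tau> (x + y) i = smult (1 + c) (curve \<tau> x i)" by (simp only: curve_scale)
    then show ?thesis by (simp add: y curve_scale smult_add_left)
  qed
next
  case False
  have "a = (- u) *s b" if "a + u *s b = 0" for a b :: "'k^'n" and u
    using that by (simp add: eq_neg_iff_add_eq_0)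
  with False have nz: "x + u *s y \<noteq> 0" "y + u *s x \<noteq> 0" for u
    by blast+
  obtain A where A: "\<And>i s u. poly (curve \<tau> (x + u *s y) i) s = poly (A i s) u"
    using curve_plane[OF nz(1)] by blast
  obtain B where B: "\<And>i s u. poly (curve \<tau> (y + u *s x) i) s = poly (B i s) u"
    using curve_plane[OF nz(2)] by blast
  have "poly (curve \<tau> (x + y) i) s = poly (curve \<tau> x i + curve \<tau> y i) s" for s
  proof -
    have "poly (A i s) u = u ^ 1 * poly (B i s) (1 / u)" if "u \<noteq> 0" for u
    proof -
      have "x + u *s y = u *s (y + (1 / u) *s x)"
        using that by (simp add: vec_eq_iff algebra_simps)
      then have "curve \<tau> (x + u *s y) i = smult u (curve \<tau> (y + (1 / u) *s x) i)"
        by (simp only: curve_scale)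
      then show ?thesis by (simp flip: A B)
    qed
    note d = poly_reflection[of "A i s" 1, OF this]
    \<comment> \<open>With degree at most one, the value at 1 is the sum of the coefficients; that
      of \<open>u\<close> is the value of the other chart at zero, which belongs to
      \<open>y\<close>.\<close>
    have "poly (A i s) 1 = (\<Sum>k\<le>1. coeff (A i s) k)"
      using d(1) by (subst poly_altdef_le) auto
    also have "\<dots> = poly (A i s) 0 + poly (B i s) 0"
      using d(2) by (simp add: poly_0_coeff_0)
    finally show ?thesis using A[of 1] A[of 0 i s] B[of 0 i s] by simp
  qed
  then show ?thesis by (rule poly_ext)
qed

definition lin :: "'k^'m \<Rightarrow> 'k^'n \<Rightarrow> 'k^'n" where
  "lin t x = (\<chi> i. poly (curve t x i) 1)"

lemma lin_linear: "Vector_Spaces.linear (*s) (*s) (lin t)"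
  by unfold_locales (auto simp: lin_def vec_eq_iff curve_add curve_scale)

text \<open>Running the curve of \<open>t\<close> at speed \<open>s\<close> gives a lift for
  \<open>s *s t\<close> with the same start, so \<open>lin\<close> recovers the whole curve although
  it records only the value at 1.\<close>

lemma lin_scale: "lin (s *s t) x $ i = poly (curve t x i) s"
proof (cases "x = 0")
  case False
  have "curve (s *s t) x = (\<lambda>i. pcompose (curve t x i) [:0, s:])"
  proof (rule curve_unique[OF False])
    fix r
    show "hom_coords (\<beta> (r *s (s *s t)) (proj_point x)) (\<chi> i. poly (pcompose (curve t x i) [:0, s:]) r)"
      using curve_hom_coords[OF False, of "r * s" t] by (simp add: poly_pcompose)
  qed (simp add: poly_pcompose curve_0)
  then show ?thesis by (simp add: lin_def poly_pcompose)
qed (simp add: lin_def curve_def)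

lemma lin_hom_coords:
  assumes "hom_coords p x"
  shows "hom_coords (\<beta> t p) (lin t x)"
  using curve_hom_coords[of x 1 t] assms proj_point_eqI[OF assms]
  by (auto simp: lin_def hom_coords_def)

lemma lin_zero: "lin 0 x = x"
  using lin_scale[of 0 0 x] by (simp add: vec_eq_iff curve_0)

text \<open>On projective points the two sides agree, hence up to a scalar. Along
  \<open>r *s (s + t)\<close> both are polynomial lifts of the same curve from the same start, so
  the scalar is one.\<close>

lemma lin_add: "lin (s + t) x = lin s (lin t x)"
proof (cases "x = 0")
  case True
  interpret Vector_Spaces.linear "(*s)" "(*s)" "lin r" for r by (rule lin_linear)
  show ?thesis using True by simp
next
  case False
  define Q where "Q i = (\<Sum>j\<in>UNIV. curve t x j * curve s (axis j 1) i)" for i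
  have Q: "(\<chi> i. poly (Q i) r) = lin (r *s s) (lin (r *s t) x)" for r
    by (subst vec_eq_iff, subst linear_componentwise[OF lin_linear]) (simp add: lin_scale Q_def poly_sum)
  have "curve (s + t) x = Q"
  proof (rule curve_unique[OF False])
    fix r
    have "hom_coords (\<beta> (r *s s) (\<beta> (r *s t) (proj_point x))) (lin (r *s s) (lin (r *s t) x))"
      by (intro lin_hom_coords hom_coords_proj_point False)
    then show "hom_coords (\<beta> (r *s (s + t)) (proj_point x)) (\<chi> i. poly (Q i) r)"
      by (simp add: Q \<beta>_add vec.scale_right_distrib)
    fix i
    show "poly (Q i) 0 = x $ i"
      using arg_cong[OF Q[of 0], of "\<lambda>v. v $ i"] by (simp add: lin_zero)
  qed
  then have "lin (s + t) x = (\<chi> i. poly (Q i) 1)" by (simp add: lin_def)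
  then show ?thesis using Q[of 1] by simp
qed

end

subsection \<open>Polynomials in a linear operator\<close>

abbreviation lin_op :: "('k::field^'n::finite \<Rightarrow> 'k^'l::finite) \<Rightarrow> bool" where
  "lin_op \<equiv> Vector_Spaces.linear (*s) (*s)"

lemma lin_op_add: "lin_op a \<Longrightarrow> a (x + y) = a x + a y"
  and lin_op_scale: "lin_op a \<Longrightarrow> a (c *s x) = c *s a x"
  and lin_op_0: "lin_op a \<Longrightarrow> a 0 = 0"
  and lin_op_diff: "lin_op a \<Longrightarrow> a (x - y) = a x - a y"
  and lin_op_sum: "lin_op a \<Longrightarrow> a (sum f S) = (\<Sum>i\<in>S. a (f i))"
proof -
  assume "lin_op a"
  then interpret Vector_Spaces.linear "(*s)" "(*s)" a .
  show "a (x + y) = a x + a y" "a (c *s x) = c *s a x" "a 0 = 0" "a (x - y) = a x - a y"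
    "a (sum f S) = (\<Sum>i\<in>S. a (f i))"
    by (rule add scale zero diff sum)+
qed

lemma lin_opI:
  assumes "\<And>x y. a (x + y) = a x + a y" "\<And>c x. a (c *s x) = c *s a x"
  shows "lin_op a"
  by unfold_locales (use assms in auto)

lemma lin_op_funpow:
  fixes a :: "'k::field^'n::finite \<Rightarrow> 'k^'n"
  shows "lin_op a \<Longrightarrow> lin_op (a ^^ k)"
  by (induction k) (auto intro!: lin_opI simp: lin_op_add lin_op_scale)

lemma lin_op_comp: "lin_op a \<Longrightarrow> lin_op b \<Longrightarrow> lin_op (\<lambda>x. a (b x))"
  by (auto intro!: lin_opI simp: lin_op_add lin_op_scale)

definition poly_op :: "('k::field^'n::finite \<Rightarrow> 'k^'n) \<Rightarrow> 'k poly \<Rightarrow> 'k^'n \<Rightarrow> 'k^'n" where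
  "poly_op a p w = (\<Sum>i\<le>degree p. coeff p i *s (a ^^ i) w)"

lemma poly_op_le: "degree p \<le> n \<Longrightarrow> poly_op a p w = (\<Sum>i\<le>n. coeff p i *s (a ^^ i) w)"
  unfolding poly_op_def by (rule sum.mono_neutral_left) (auto simp: coeff_eq_0)

lemma poly_op_0 [simp]: "poly_op a 0 w = 0"
  by (simp add: poly_op_def)

lemma poly_op_add: "poly_op a (p + q) w = poly_op a p w + poly_op a q w"
proof -
  define n where "n = max (degree p) (degree q)"
  have "degree p \<le> n" "degree q \<le> n" "degree (p + q) \<le> n"
    by (auto simp: n_def degree_add_le)
  then show ?thesis
    by (simp add: poly_op_le[of _ n] sum.distrib vec.scale_left_distrib)
qed

lemma poly_op_smult: "poly_op a (smult c p) w = c *s poly_op a p w"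
  using poly_op_le[OF degree_smult_le, of a c p w]
  by (simp add: poly_op_def vec.scale_sum_right)

lemma poly_op_sum: "poly_op a (sum f S) w = (\<Sum>i\<in>S. poly_op a (f i) w)"
  by (induction S rule: infinite_finite_induct) (auto simp: poly_op_add)

lemma poly_op_pCons:
  assumes "lin_op a"
  shows "poly_op a (pCons c p) w = c *s w + a (poly_op a p w)"
proof -
  have "poly_op a (pCons c p) w = (\<Sum>i\<le>Suc (degree p). coeff (pCons c p) i *s (a ^^ i) w)"
    by (rule poly_op_le) (rule degree_pCons_le)
  also have "\<dots> = c *s w + (\<Sum>i\<le>degree p. coeff p i *s a ((a ^^ i) w))"
    by (simp only: sum.atMost_Suc_shift coeff_pCons_0 coeff_pCons_Suc funpow.simps o_apply id_apply)
  finally show ?thesis using assms by (simp add: poly_op_def lin_op_sum lin_op_scale)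
qed

lemma poly_op_const: "poly_op a [:c:] w = c *s w"
  by (simp add: poly_op_def)

lemma poly_op_1: "poly_op a 1 w = w"
  by (simp add: poly_op_def)

lemma poly_op_linear:
  assumes "lin_op a"
  shows "lin_op (poly_op a p)"
proof (induction p)
  case (pCons c p)
  then show ?case using assms
    by (intro lin_opI) (auto simp: poly_op_pCons lin_op_add lin_op_scale algebra_simps)
qed (auto intro!: lin_opI)

lemma poly_op_mult:
  assumes "lin_op a"
  shows "poly_op a (p * q) w = poly_op a p (poly_op a q w)"
  by (induction p)
    (use assms in \<open>auto simp: poly_op_pCons poly_op_add poly_op_smult\<close>)

lemma poly_op_pcompose:
  assumes "lin_op a"
  shows "poly_op a (pcompose p q) w = poly_op (poly_op a q) p w"
  by (induction p)
    (use assms in \<open>auto simp: poly_op_pCons poly_op_linear pcompose_pCons poly_op_add poly_op_mult poly_op_const\<close>)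

lemma poly_op_power: "lin_op a \<Longrightarrow> poly_op a (p ^ k) w = (poly_op a p ^^ k) w"
  by (induction k) (auto simp: poly_op_mult poly_op_1)

lemma poly_op_monom: "poly_op a (monom c k) w = c *s (a ^^ k) w"
proof -
  have "poly_op a (monom c k) w = (\<Sum>i\<le>k. (if i = k then c *s (a ^^ i) w else 0))"
    by (subst poly_op_le[OF degree_monom_le]) (intro sum.cong, auto)
  then show ?thesis by simp
qed

lemma poly_op_dvd_0:
  assumes "lin_op a" "\<And>w. (a ^^ N) w = 0" "monom 1 N dvd p"
  shows "poly_op a p w = 0"
  using assms(3) by (auto simp: dvd_def poly_op_mult assms(1,2) poly_op_monom)

lemma poly_op_cong:
  assumes "lin_op a" "\<And>w. (a ^^ N) w = 0" "monom 1 N dvd p - q"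
  shows "poly_op a p w = poly_op a q w"
proof -
  have "poly_op a p w = poly_op a ((p - q) + q) w" by simp
  then show ?thesis unfolding poly_op_add poly_op_dvd_0[OF assms] by simp
qed

text \<open>Applying \<open>a ^^ (p - j)\<close> kills the terms of index above \<open>j\<close>,
  and those below vanish by induction, so only \<open>c j *s (a ^^ p) w\<close> remains.\<close>

lemma nilpotent_chain:
  fixes a :: "'k::field^'n::finite \<Rightarrow> 'k^'n"
  assumes a: "lin_op a" and p: "(a ^^ p) w \<noteq> 0" "(a ^^ Suc p) w = 0"
    and sum: "(\<Sum>i\<le>p. c i *s (a ^^ i) w) = 0" and j: "j \<le> p"
  shows "c j = 0"
  using j
proof (induction j rule: less_induct)
  case (less j)
  have zero: "(a ^^ i) w = 0" if "i > p" for i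
  proof -
    have "(a ^^ i) w = (a ^^ (i - Suc p)) ((a ^^ Suc p) w)"
      using that by (metis Suc_leI comp_apply funpow_add le_add_diff_inverse2)
    also have "\<dots> = 0" unfolding p(2) by (rule lin_op_0[OF lin_op_funpow[OF a]])
    finally show ?thesis .
  qed
  have "0 = (a ^^ (p - j)) (\<Sum>i\<le>p. c i *s (a ^^ i) w)"
    by (simp add: sum lin_op_0[OF lin_op_funpow[OF a]])
  also have "\<dots> = (\<Sum>i\<le>p. c i *s (a ^^ (p - j + i)) w)"
    by (simp add: lin_op_sum[OF lin_op_funpow[OF a]] lin_op_scale[OF lin_op_funpow[OF a]] funpow_add)
  also have "\<dots> = (\<Sum>i\<le>p. if i = j then c j *s (a ^^ p) w else 0)"
  proof (rule sum.cong[OF refl])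
    fix i assume "i \<in> {..p}"
    consider "i < j" | "i = j" | "i > j" by linarith
    then show "c i *s (a ^^ (p - j + i)) w = (if i = j then c j *s (a ^^ p) w else 0)"
    proof cases
      case 1 then show ?thesis using less by simp
    next
      case 2 then show ?thesis using less.prems by simp
    next
      case 3 then show ?thesis using less.prems zero by simp
    qed
  qed
  also have "\<dots> = c j *s (a ^^ p) w" using less.prems by simp
  finally show ?case using p(1) by auto
qed

lemma independent_familyI:
  fixes b :: "nat \<Rightarrow> 'k::field^'n::finite"
  assumes "\<And>c j. (\<Sum>i\<le>p. c i *s b i) = 0 \<Longrightarrow> j \<le> p \<Longrightarrow> c j = 0"
  shows "inj_on b {..p}" "vec.independent (b ` {..p})"
proof -
  show inj: "inj_on b {..p}"
  proof (rule inj_onI, rule ccontr)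
    fix i j assume ij: "i \<in> {..p}" "j \<in> {..p}" "b i = b j" "i \<noteq> j"
    define c where "c k = (if k = i then 1 else if k = j then - 1 else (0::'k))" for k
    have "(\<Sum>k\<le>p. c k *s b k) = (\<Sum>k\<in>{i, j}. c k *s b k)"
      by (rule sum.mono_neutral_right) (use ij in \<open>auto simp: c_def\<close>)
    also have "\<dots> = 0" using ij by (simp add: c_def)
    finally have "c i = 0" by (rule assms) (use ij in auto)
    then show False by (simp add: c_def)
  qed
  show "vec.independent (b ` {..p})"
  proof (rule vec.independent_if_scalars_zero)
    fix f x assume f: "(\<Sum>x\<in>b ` {..p}. f x *s x) = 0" and "x \<in> b ` {..p}"
    then obtain j where "j \<le> p" "x = b j" by auto
    moreover have "(\<Sum>i\<le>p. f (b i) *s b i) = 0"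
      using f by (simp add: sum.reindex[OF inj])
    ultimately show "f x = 0" using assms[of "\<lambda>i. f (b i)" j] by simp
  qed simp
qed

lemma nilpotent_chain_basis:
  fixes a :: "'k::field^'n::finite \<Rightarrow> 'k^'n"
  assumes "lin_op a" "(a ^^ p) w \<noteq> 0" "(a ^^ Suc p) w = 0"
  shows "inj_on (\<lambda>i. (a ^^ i) w) {..p}" "vec.independent ((\<lambda>i. (a ^^ i) w) ` {..p})" "p < CARD('n)"
proof -
  show *: "inj_on (\<lambda>i. (a ^^ i) w) {..p}" "vec.independent ((\<lambda>i. (a ^^ i) w) ` {..p})"
    by (rule independent_familyI, rule nilpotent_chain[OF assms], assumption+)+
  have "card ((\<lambda>i. (a ^^ i) w) ` {..p}) \<le> CARD('n)"
    using vec.independent_card_le_dim[OF subset_UNIV *(2)] by (simp add: card_cart_basis)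
  then show "p < CARD('n)" by (simp add: card_image[OF *(1)])
qed

lemma nilpotent_index:
  fixes a :: "'k::field^'n::finite \<Rightarrow> 'k^'n"
  assumes "lin_op a" "(a ^^ K) w = 0"
  shows "(a ^^ CARD('n)) w = 0"
proof (cases "w = 0")
  case True
  then show ?thesis using lin_op_0[OF lin_op_funpow[OF assms(1)]] by simp
next
  case False
  define L where "L = (LEAST k. (a ^^ k) w = 0)"
  have L: "(a ^^ L) w = 0" unfolding L_def by (rule LeastI[of _ K]) (rule assms)
  then have "L \<noteq> 0" using False by (metis funpow_0)
  then obtain p where p: "L = Suc p" by (cases L) auto
  have "(a ^^ p) w \<noteq> 0" using not_less_Least[of p "\<lambda>k. (a ^^ k) w = 0"] p by (simp add: L_def)
  then have "p < CARD('n)" using nilpotent_chain_basis(3)[OF assms(1)] L p by metis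
  then have "CARD('n) = (CARD('n) - L) + L" using p by simp
  then have "(a ^^ CARD('n)) w = (a ^^ (CARD('n) - L)) ((a ^^ L) w)"
    by (metis comp_apply funpow_add)
  then show ?thesis unfolding L by (simp add: lin_op_0[OF lin_op_funpow[OF assms(1)]])
qed

section \<open>Truncated exponential and logarithm\<close>

definition exp_poly :: "nat \<Rightarrow> 'k::field_char_0 poly" where
  "exp_poly N = (\<Sum>k<N. monom (1 / fact k) k)"

definition log_poly :: "nat \<Rightarrow> 'k::field_char_0 poly" where
  "log_poly N = (\<Sum>k\<in>{1..<N}. monom ((- 1) ^ (k - 1) / of_nat k) k)"

lemma coeff_exp_poly: "coeff (exp_poly N) k = (if k < N then 1 / fact k else 0)"
proof -
  have "coeff (exp_poly N :: 'a poly) k = (\<Sum>i<N. if i = k then 1 / fact k else 0)"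
    unfolding exp_poly_def coeff_sum by (intro sum.cong) auto
  then show ?thesis by (simp add: sum.delta)
qed

lemma coeff_log_poly: "coeff (log_poly N) k = (if k < N then fps_nth (fps_ln 1) k else 0)"
proof -
  have "coeff (log_poly N :: 'a poly) k = (\<Sum>i\<in>{1..<N}. if i = k then (- 1) ^ (k - 1) / of_nat k else 0)"
    unfolding log_poly_def coeff_sum by (intro sum.cong) auto
  then show ?thesis by (auto simp: fps_ln_nth)
qed

lemma fps_nth_power_cong:
  assumes "\<And>k. k \<le> j \<Longrightarrow> fps_nth F k = fps_nth G k" "k \<le> j"
  shows "fps_nth (F ^ i) k = fps_nth (G ^ i :: 'k::comm_ring_1 fps) k"
  using assms(2)
proof (induction i arbitrary: k)
  case (Suc i)
  then show ?case by (simp add: fps_mult_nth assms(1))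
qed simp

text \<open>Since the logarithm has no constant term, a coefficient below \<open>N\<close> of the
  composition involves only coefficients below \<open>N\<close> of both series, so the identity of
  formal power series survives truncation.\<close>

lemma exp_log_poly:
  "monom 1 N dvd pcompose (exp_poly N) (log_poly N) - ([:1, 1:] :: 'k::field_char_0 poly)"
proof (subst monom_1_dvd_iff', intro allI impI)
  fix j assume j: "j < N"
  have "(fps_exp 1 - 1 :: 'k fps) oo fps_ln 1 = fps_X"
    by (subst fps_ln_fps_exp_inv) (auto intro!: fps_inv_right)
  then have e: "(fps_exp 1 :: 'k fps) oo fps_ln 1 = 1 + fps_X"
    by (simp add: fps_compose_sub_distrib algebra_simps)
  have "coeff (pcompose (exp_poly N) (log_poly N) :: 'k poly) j =
      fps_nth (fps_of_poly (exp_poly N) oo fps_of_poly (log_poly N :: 'k poly)) j"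
    using j by (subst fps_of_poly_pcompose[symmetric]) (auto simp: coeff_log_poly)
  also have "\<dots> = fps_nth (fps_exp 1 oo fps_ln (1::'k)) j"
    unfolding fps_compose_nth
  proof (rule sum.cong[OF refl])
    fix i assume "i \<in> {0..j}"
    moreover have "fps_nth (fps_of_poly (log_poly N :: 'k poly) ^ i) j = fps_nth (fps_ln 1 ^ i) j"
      by (rule fps_nth_power_cong[of j]) (use j in \<open>auto simp: coeff_log_poly\<close>)
    ultimately show "fps_nth (fps_of_poly (exp_poly N)) i * fps_nth (fps_of_poly (log_poly N :: 'k poly) ^ i) j
        = fps_nth (fps_exp 1) i * fps_nth (fps_ln 1 ^ i) j"
      using j by (simp add: coeff_exp_poly)
  qed
  also have "\<dots> = coeff [:1, 1:] j"
    unfolding e by (auto simp: coeff_pCons split: nat.splits)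
  finally show "coeff (pcompose (exp_poly N) (log_poly N) - [:1, 1:] :: 'k poly) j = 0" by simp
qed

subsection \<open>Rational representations of vector groups\<close>

text \<open>Polynomial dependence is known along lines through the origin of the group; linearity of
  the derivative \<open>D\<close> in the group element is then derived from the group law.\<close>

locale vector_group_rep =
  fixes M :: "('k::field_char_0)^'m::finite \<Rightarrow> 'k^'n::finite \<Rightarrow> 'k^'n"
  assumes M_linear: "lin_op (M t)" and M_zero: "M 0 x = x" and M_add: "M (s + t) x = M s (M t x)"
    and M_poly: "\<exists>p. \<forall>s. M (s *s t) x $ i = poly p s"
begin

definition mp :: "'k^'m \<Rightarrow> 'k^'n \<Rightarrow> 'n \<Rightarrow> 'k poly" where
  "mp t x i = (SOME p. \<forall>s. M (s *s t) x $ i = poly p s)"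

lemma poly_mp: "poly (mp t x i) s = M (s *s t) x $ i"
proof -
  have "\<forall>s. M (s *s t) x $ i = poly (mp t x i) s"
    unfolding mp_def by (rule someI_ex[OF M_poly])
  then show ?thesis by simp
qed

definition D :: "'k^'m \<Rightarrow> 'k^'n \<Rightarrow> 'k^'n" where
  "D t x = (\<chi> i. coeff (mp t x i) 1)"

lemma coeff_1_pderiv: "coeff p (Suc 0) = poly (pderiv p) (0::'k)"
  by (simp add: poly_0_coeff_0 coeff_pderiv)

lemma coeff_1_mult: "coeff (p * q) (Suc 0) = poly p 0 * coeff q (Suc 0) + poly q 0 * coeff p (Suc (0::nat))"
  for p q :: "'k poly"
  by (simp add: coeff_1_pderiv pderiv_mult)

lemma mp_zero: "poly (mp t x i) 0 = x $ i"
  by (simp add: poly_mp M_zero)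

lemma D_linear: "lin_op (D t)"
proof (rule lin_opI)
  fix x y c
  have "mp t (x + y) i = mp t x i + mp t y i" for i
    by (rule poly_ext) (simp add: poly_mp lin_op_add[OF M_linear])
  then show "D t (x + y) = D t x + D t y" by (simp add: D_def vec_eq_iff)
  have "mp t (c *s x) i = smult c (mp t x i)" for i
    by (rule poly_ext) (simp add: poly_mp lin_op_scale[OF M_linear])
  then show "D t (c *s x) = c *s D t x" by (simp add: D_def vec_eq_iff)
qed

lemma D_scale: "D (c *s t) x = c *s D t x"
proof -
  have "mp (c *s t) x i = pcompose (mp t x i) [:0, c:]" for i
    by (rule poly_ext) (simp add: poly_mp poly_pcompose mult.commute)
  then show ?thesis
    by (simp add: D_def vec_eq_iff coeff_1_pderiv pderiv_pcompose poly_pcompose pderiv_pCons mult.commute)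
qed

text \<open>The Leibniz rule at \<open>r = 0\<close> for \<open>M (r *s s) (M (r *s t) x)\<close>,
  where both factors are the identity at \<open>r = 0\<close>.\<close>

lemma D_add: "D (s + t) x = D s x + D t x"
proof -
  have mp: "mp (s + t) x i = (\<Sum>j\<in>UNIV. mp t x j * mp s (axis j 1) i)" for i
  proof (rule poly_ext)
    fix r
    have "poly (mp (s + t) x i) r = M (r *s s) (M (r *s t) x) $ i"
      by (simp add: poly_mp vec.scale_right_distrib M_add)
    also have "\<dots> = (\<Sum>j\<in>UNIV. M (r *s t) x $ j * M (r *s s) (axis j 1) $ i)"
      by (rule linear_componentwise[OF M_linear])
    finally show "poly (mp (s + t) x i) r = poly (\<Sum>j\<in>UNIV. mp t x j * mp s (axis j 1) i) r"
      by (simp add: poly_sum poly_mp)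
  qed
  have "D (s + t) x $ i = D s x $ i + D t x $ i" for i
  proof -
    have "D (s + t) x $ i = (\<Sum>j\<in>UNIV. x $ j * D s (axis j 1) $ i) + (\<Sum>j\<in>UNIV. D t x $ j * axis j 1 $ i)"
      by (simp add: D_def coeff_1_mult mp coeff_sum mp_zero sum.distrib mult.commute)
    also have "(\<Sum>j\<in>UNIV. x $ j * D s (axis j 1) $ i) = D s x $ i"
      by (rule linear_componentwise[OF D_linear, symmetric])
    also have "(\<Sum>j\<in>UNIV. D t x $ j * axis j 1 $ i) = (\<Sum>j\<in>UNIV. if j = i then D t x $ j else 0)"
      by (rule sum.cong) (auto simp: axis_def)
    finally show ?thesis by simp
  qed
  then show ?thesis by (simp add: vec_eq_iff)
qed

lemma D_M_commute: "D s (M t x) = M t (D s x)"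
proof -
  have mp: "mp s (M t x) i = (\<Sum>j\<in>UNIV. smult (M t (axis j 1) $ i) (mp s x j))" for i
  proof (rule poly_ext)
    fix r
    have "poly (mp s (M t x) i) r = M t (M (r *s s) x) $ i"
      by (simp add: poly_mp add.commute flip: M_add)
    also have "\<dots> = (\<Sum>j\<in>UNIV. M (r *s s) x $ j * M t (axis j 1) $ i)"
      by (rule linear_componentwise[OF M_linear])
    finally show "poly (mp s (M t x) i) r = poly (\<Sum>j\<in>UNIV. smult (M t (axis j 1) $ i) (mp s x j)) r"
      by (simp add: poly_sum poly_mp mult.commute)
  qed
  have "D s (M t x) $ i = M t (D s x) $ i" for i
  proof -
    have "D s (M t x) $ i = (\<Sum>j\<in>UNIV. D s x $ j * M t (axis j 1) $ i)"
      by (simp add: D_def mp coeff_sum mult.commute)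
    also have "\<dots> = M t (D s x) $ i"
      by (rule linear_componentwise[OF M_linear, symmetric])
    finally show ?thesis .
  qed
  then show ?thesis by (simp add: vec_eq_iff)
qed

lemma D_commute: "D s (D t x) = D t (D s x)"
proof -
  have mp: "mp t (D s x) i = (\<Sum>j\<in>UNIV. smult (D s (axis j 1) $ i) (mp t x j))" for i
  proof (rule poly_ext)
    fix r
    have "poly (mp t (D s x) i) r = D s (M (r *s t) x) $ i"
      by (simp add: poly_mp D_M_commute)
    also have "\<dots> = (\<Sum>j\<in>UNIV. M (r *s t) x $ j * D s (axis j 1) $ i)"
      by (rule linear_componentwise[OF D_linear])
    finally show "poly (mp t (D s x) i) r = poly (\<Sum>j\<in>UNIV. smult (D s (axis j 1) $ i) (mp t x j)) r"
      by (simp add: poly_sum poly_mp mult.commute)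
  qed
  have "D t (D s x) $ i = D s (D t x) $ i" for i
  proof -
    have "D t (D s x) $ i = (\<Sum>j\<in>UNIV. D t x $ j * D s (axis j 1) $ i)"
      by (simp add: D_def[of t] mp coeff_sum mult.commute)
    also have "\<dots> = D s (D t x) $ i"
      by (rule linear_componentwise[OF D_linear, symmetric])
    finally show ?thesis .
  qed
  then show ?thesis by (simp add: vec_eq_iff)
qed

text \<open>Translating the parameter by \<open>b\<close> gives the differential equation of a
  one-parameter group, which determines all Taylor coefficients from \<open>D t\<close>.\<close>

lemma pderiv_mp: "pderiv (mp t x i) = (\<Sum>j\<in>UNIV. smult (D t (axis j 1) $ i) (mp t x j))"
proof (rule poly_ext)
  fix b
  have "mp t (M (b *s t) x) i = pcompose (mp t x i) [:b, 1:]"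
    by (rule poly_ext) (simp add: poly_mp poly_pcompose algebra_simps vec.scale_left_distrib flip: M_add)
  then have "D t (M (b *s t) x) $ i = poly (pderiv (mp t x i)) b"
    by (simp add: D_def coeff_1_pderiv pderiv_pcompose poly_pcompose pderiv_pCons)
  moreover have "D t (M (b *s t) x) $ i = (\<Sum>j\<in>UNIV. M (b *s t) x $ j * D t (axis j 1) $ i)"
    by (rule linear_componentwise[OF D_linear])
  ultimately show "poly (pderiv (mp t x i)) b = poly (\<Sum>j\<in>UNIV. smult (D t (axis j 1) $ i) (mp t x j)) b"
    by (simp add: poly_sum poly_mp mult.commute)
qed

lemma coeff_mp: "coeff (mp t x i) k = (1 / fact k) * (D t ^^ k) x $ i"
proof (induction k arbitrary: i)
  case 0
  then show ?case by (simp add: poly_0_coeff_0[symmetric] mp_zero)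
next
  case (Suc k)
  have "of_nat (Suc k) * coeff (mp t x i) (Suc k) = coeff (pderiv (mp t x i)) k"
    by (simp add: coeff_pderiv)
  also have "\<dots> = (\<Sum>j\<in>UNIV. D t (axis j 1) $ i * ((1 / fact k) * (D t ^^ k) x $ j))"
    by (simp add: pderiv_mp coeff_sum Suc)
  also have "\<dots> = (1 / fact k) * (\<Sum>j\<in>UNIV. (D t ^^ k) x $ j * D t (axis j 1) $ i)"
    by (simp add: sum_distrib_left mult_ac)
  also have "(\<Sum>j\<in>UNIV. (D t ^^ k) x $ j * D t (axis j 1) $ i) = D t ((D t ^^ k) x) $ i"
    by (rule linear_componentwise[OF D_linear, symmetric])
  finally have "of_nat (Suc k) * coeff (mp t x i) (Suc k) = (1 / fact k) * (D t ^^ Suc k) x $ i"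
    by simp
  moreover have "of_nat (Suc k) \<noteq> (0::'k)" by (simp del: of_nat_Suc)
  ultimately show ?case by (simp add: field_simps del: of_nat_Suc)
qed

text \<open>The orbit curve is polynomial, so its high Taylor coefficients, which are multiples of
  \<open>(D t ^^ k) x\<close>, vanish.\<close>

lemma D_nilpotent: "(D t ^^ CARD('n)) x = 0"
proof (rule nilpotent_index[OF D_linear])
  define K where "K = Suc (Max (range (\<lambda>i. degree (mp t x i))))"
  have "coeff (mp t x i) K = 0" for i
    by (rule coeff_eq_0) (simp add: K_def less_Suc_eq_le)
  then show "(D t ^^ K) x = 0" by (simp add: coeff_mp vec_eq_iff)
qed

lemma M_exp: "M t x = poly_op (D t) (exp_poly CARD('n)) x"
proof -
  let ?N = "CARD('n)"
  have D0: "(D t ^^ k) x = 0" if "k \<ge> ?N" for k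
  proof -
    have "(D t ^^ k) x = (D t ^^ (k - ?N)) ((D t ^^ ?N) x)"
      using that by (metis comp_apply funpow_add le_add_diff_inverse2)
    then show ?thesis by (simp add: D_nilpotent lin_op_0[OF lin_op_funpow[OF D_linear]])
  qed
  have "M t x $ i = poly_op (D t) (exp_poly ?N) x $ i" for i
  proof -
    have deg: "degree (mp t x i) \<le> ?N"
      by (rule degree_le) (auto simp: coeff_mp D0)
    have "M t x $ i = poly (mp t x i) 1" by (simp add: poly_mp)
    also have "\<dots> = (\<Sum>k\<le>?N. (1 / fact k) * (D t ^^ k) x $ i)"
      by (simp add: poly_altdef_le[OF deg] coeff_mp)
    also have "\<dots> = (\<Sum>k\<le>?N. coeff (exp_poly ?N) k * (D t ^^ k) x $ i)"
      by (rule sum.cong) (auto simp: coeff_exp_poly D_nilpotent)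
    also have "\<dots> = poly_op (D t) (exp_poly ?N) x $ i"
    proof -
      have "degree (exp_poly ?N :: 'k poly) \<le> ?N"
        by (rule degree_le) (auto simp: coeff_exp_poly)
      then show ?thesis by (subst poly_op_le) (auto simp: sum_component)
    qed
    finally show ?thesis .
  qed
  then show ?thesis by (simp add: vec_eq_iff)
qed

end

subsection \<open>Linear functionals\<close>

definition lin_fun :: "('k::field^'n::finite \<Rightarrow> 'k) \<Rightarrow> bool" where
  "lin_fun l \<longleftrightarrow> (\<forall>x y. l (x + y) = l x + l y) \<and> (\<forall>c x. l (c *s x) = c * l x)"

lemma lin_fun_simps:
  assumes "lin_fun l"
  shows "l (x + y) = l x + l y" "l (c *s x) = c * l x" "l 0 = 0" "l (x - y) = l x - l y"
    "l (\<Sum>i\<in>S. f i) = (\<Sum>i\<in>S. l (f i))"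
proof -
  show add: "l (x + y) = l x + l y" and scale: "l (c *s x) = c * l x" for x y c
    using assms by (auto simp: lin_fun_def)
  show zero: "l 0 = 0" using scale[of 0 0] by simp
  show "l (x - y) = l x - l y" using add[of x "(-1) *s y"] scale[of "-1" y] by simp
  show "l (\<Sum>i\<in>S. f i) = (\<Sum>i\<in>S. l (f i))"
    by (induction S rule: infinite_finite_induct) (auto simp: add zero)
qed

lemma polyfun_lin_fun:
  fixes l :: "'k::field_char_0^'n::finite \<Rightarrow> 'k"
  assumes "lin_fun l"
  shows "polyfun l"
proof -
  have "lin_op (\<lambda>x. (\<chi> i. l x) :: 'k^1)"
    by (rule lin_opI) (auto simp: vec_eq_iff lin_fun_simps[OF assms])
  from polyfun_linear[OF this, of 1] show ?thesis by simp
qed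

lemma separating_functional:
  fixes x :: "'k::field^'n::finite"
  assumes "vec.subspace S" "x \<notin> S"
  obtains l where "lin_fun l" "\<And>y. y \<in> S \<Longrightarrow> l y = 0" "l x = 1"
proof -
  obtain B where B: "B \<subseteq> S" "vec.independent B" "vec.span B = S"
    using vec.basis_subspace_exists[OF assms(1)] by metis
  then have "vec.independent (insert x B)" using assms(2) by (simp add: vec.independent_insert)
  from vec.linear_independent_extend[OF this, of "\<lambda>b. if b = x then 1 else 0"]
  obtain g :: "'k^'n \<Rightarrow> 'k^'n" where g: "lin_op g" "\<forall>b\<in>insert x B. g b = (if b = x then 1 else 0)"
    by blast
  show ?thesis
  proof (rule that[of "\<lambda>y. g y $ undefined"])
    show "lin_fun (\<lambda>y. g y $ undefined)"
      by (simp add: lin_fun_def lin_op_add[OF g(1)] lin_op_scale[OF g(1)])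
    show "g x $ undefined = 1" using g(2) by simp
    fix y assume "y \<in> S"
    then have "y \<in> vec.span B" by (simp add: B(3))
    then have "g y = 0"
      by (rule vec.linear_eq_0_on_span[OF g(1), rotated])
        (use g(2) B(1) assms(2) in auto)
    then show "g y $ undefined = 0" by simp
  qed
qed

subsection \<open>Irreducible forms as functions\<close>

text \<open>A Nullstellensatz in one variable: up to a scalar, \<open>p\<close> is a product of
  \<open>degree p\<close> linear factors, each of which divides \<open>q\<close>.\<close>

lemma dvd_power_if_roots:
  fixes p q :: "'k::alg_closed_field poly"
  assumes "p \<noteq> 0" "\<And>x. poly p x = 0 \<Longrightarrow> poly q x = 0"
  shows "p dvd q ^ degree p"
proof -
  obtain A where A: "size A = degree p" "p = smult (lead_coeff p) (\<Prod>x\<in>#A. [:-x, 1:])"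
    using alg_closed_imp_factorization[OF assms(1)] by blast
  have "poly p x = 0" if "x \<in># A" for x
  proof -
    have "[:-x, 1:] dvd (\<Prod>x\<in>#A. [:-x, 1:])"
      using that by (metis dvd_prod_mset image_mset_is_empty_iff in_image_mset imageI)
    then have "[:-x, 1:] dvd p" by (subst A(2)) (rule dvd_smult)
    then show ?thesis by (simp add: poly_eq_0_iff_dvd)
  qed
  then have dvd: "[:-x, 1:] dvd q" if "x \<in># A" for x
    using that assms(2) by (simp flip: poly_eq_0_iff_dvd)
  have "(\<Prod>x\<in>#B. [:-x, 1:]) dvd q ^ size B" if "B \<subseteq># A" for B
    using that
  proof (induction B)
    case (add x B)
    have "B \<subseteq># A" "x \<in># A" using add.prems
      by (auto dest: mset_subset_eq_insertD subset_mset.less_imp_le)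
    then show ?case
      unfolding image_mset_add_mset prod_mset.add_mset size_add_mset power_Suc
      by (intro mult_dvd_mono dvd add.IH)
  qed simp
  then have "(\<Prod>x\<in>#A. [:-x, 1:]) dvd q ^ degree p" using A(1) by (metis subset_mset.order_refl)
  moreover have "lead_coeff p \<noteq> 0" using assms(1) by simp
  ultimately show ?thesis by (subst A(2)) (subst smult_dvd_iff, simp)
qed

locale irreducible_form =
  fixes F :: "'k::{alg_closed_field, field_char_0}^'n::finite \<Rightarrow> 'k" and n :: nat
  assumes F_poly: "polyfun F" and F_hom: "F (s *s x) = s ^ n * F x" and F_nz: "\<exists>x. F x \<noteq> 0"
    and F_irr: "polyfun G \<Longrightarrow> polyfun H \<Longrightarrow> (\<And>x. F x = G x * H x) \<Longrightarrow>
      (\<forall>x. G x = G 0) \<or> (\<forall>x. H x = H 0)"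
    and n_ge_2: "n \<ge> 2"
begin

text \<open>Otherwise \<open>l\<close> divides \<open>F\<close> with constant cofactor by
  irreducibility, and doubling the argument would multiply \<open>F\<close> by 2 instead of
  \<open>2 ^ n\<close>.\<close>

lemma nonzero_on_hyperplane:
  assumes "lin_fun l" "l e = 1"
  shows "\<exists>y. l y = 0 \<and> F y \<noteq> 0"
proof (rule ccontr)
  assume "\<not> ?thesis"
  then have z: "\<And>x. l x = 0 \<Longrightarrow> F x = 0" by blast
  note l = lin_fun_simps[OF assms(1)]
  obtain Q where Q: "polyfun Q" "\<And>x. F x = l x * Q x"
    using polyfun_hyperplane_dvd[OF F_poly polyfun_lin_fun[OF assms(1)], of e] z assms(2)
    by (auto simp: l)
  have "l 0 \<noteq> l e" using assms(2) by (simp add: l)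
  then have q: "Q x = Q 0" for x using F_irr[OF polyfun_lin_fun[OF assms(1)] Q] by metis
  obtain x where x: "F x \<noteq> 0" using F_nz by blast
  have "2 ^ n * F x = 2 * F x"
  unfolding F_hom[symmetric] unfolding Q(2) q[of "2 *s x"] q[of x] by (simp add: l)
  then have "(2::'k) ^ n = 2 ^ 1" using x by simp
  then show False using two_power_inj n_ge_2 by fastforce
qed

text \<open>Homogeneity exchanges \<open>x + w *s y\<close> with \<open>y + (1 / w) *s x\<close>, so
  reflection applies; the leading coefficient \<open>F y\<close> does not depend on
  \<open>x\<close>.\<close>

lemma line_polynomial:
  assumes "F y \<noteq> 0" "\<And>w. poly A w = F (x + w *s y)"
  shows "degree A \<le> n" "coeff A n = F y"
proof -
  obtain B where B: "F (y + z *s x) = poly B z" for z using polyfun_line[OF F_poly] by blast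
  have *: "poly A w = w ^ n * poly B (1 / w)" if "w \<noteq> 0" for w
  proof -
    have "x + w *s y = w *s (y + (1 / w) *s x)" using that by (simp add: vec_eq_iff algebra_simps)
    then show ?thesis by (simp only: assms(2) F_hom B)
  qed
  show "degree A \<le> n" using poly_reflection(1)[OF *] by simp
  show "coeff A n = F y" using poly_reflection(2)[OF *] B[of 0] by simp
qed

text \<open>
  Restricted to a plane through \<open>v\<close> and a suitable \<open>y\<close> in the hyperplane, \<open>F\<close> becomes a polynomial
  that is monic in one variable and divides a power of \<open>h\<close>.
\<close>

lemma not_locally_in_hyperplane:
  assumes l: "lin_fun l" "l e = 1" and h: "polyfun h" "h v \<noteq> 0" and v: "F v = 0"
    and local: "\<And>x. F x = 0 \<Longrightarrow> h x \<noteq> 0 \<Longrightarrow> l x = 0"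
  shows False
proof -
  obtain y where y: "l y = 0" "F y \<noteq> 0" using nonzero_on_hyperplane[OF l] by blast
  \<comment> \<open>As \<open>l e = 1\<close>, \<open>l y = 0\<close>, and \<open>l v = 0\<close> by
    \<open>local\<close>, the parameter \<open>u\<close> is the value of \<open>l\<close> at
    \<open>X u w\<close>.\<close>
  define X where "X u w = v + u *s e + w *s y" for u w
  have "is_poly2 (\<lambda>uw. H (X (fst uw) (snd uw)))" if "polyfun H" for H
    by (rule polyfun_compose[OF that is_poly2_algebra])
       (auto simp: X_def intro!: fun_algebraD[OF is_poly2_algebra] is_poly2_fst is_poly2_snd)
  then have "\<exists>g. \<forall>u w. H (X u w) = eval2 g u w" if "polyfun H" for H
    using that unfolding is_poly2_def by fastforce
  then obtain f g where f: "\<And>u w. eval2 f u w = F (X u w)" and g: "\<And>u w. eval2 g u w = h (X u w)"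
    using F_poly h(1) by metis
  let ?at = "\<lambda>u. map_poly (\<lambda>a. poly a u)"
  have f_at: "poly (?at u f) w = F ((v + u *s e) + w *s y)" for u w
    by (simp add: f X_def flip: eval2_map_poly)
  have coeff: "coeff (?at u p) k = poly (coeff p k) u" for u p k
    by (simp add: coeff_map_poly)
  have deg: "degree f \<le> n"
  proof (rule degree_le, intro allI impI)
    fix k assume "n < k"
    then have "poly (coeff f k) u = 0" for u
      using line_polynomial(1)[OF y(2) f_at] by (metis coeff coeff_eq_0 le_less_trans)
    then show "coeff f k = 0" using poly_all_0_iff_0 by blast
  qed
  have cn: "coeff f n = [:F y:]"
    by (rule poly_ext) (simp add: line_polynomial(2)[OF y(2) f_at] flip: coeff)
  then have "coeff f n \<noteq> 0" using y(2) by simp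
  then have deg_f: "degree f = n" using deg le_degree by (metis antisym)
  then have f0: "f \<noteq> 0" using n_ge_2 by auto
  \<comment> \<open>The coefficients are polynomials in \<open>u\<close>, so pseudo-division is
    used; the leading coefficient \<open>[:F y:]\<close> contributes only a nonzero
    constant.\<close>
  obtain q r where qr: "pseudo_divmod (g ^ n) f = (q, r)" by (metis surj_pair)
  define k where "k = Suc (degree (g ^ n)) - degree f"
  have div: "smult ([:F y:] ^ k) (g ^ n) = f * q + r" and r: "r = 0 \<or> degree r < n"
    using pseudo_divmod[OF f0 qr] deg_f cn by (auto simp: k_def)
  have "r = 0"
  proof (rule ccontr)
    assume r0: "r \<noteq> 0"
    \<comment> \<open>The factor \<open>[:0, 1:]\<close> disposes of \<open>u = 0\<close>, where
      \<open>X u w\<close> lies in the hyperplane and \<open>local\<close> gives nothing. For other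
      \<open>u\<close>, every root of \<open>f\<close> is a root of \<open>g\<close>.\<close>
    have "poly (coeff r j * [:0, 1:]) u = 0" for j u
    proof (cases "u = 0")
      case False
      have "?at u f dvd ?at u g ^ degree (?at u f)"
      proof (rule dvd_power_if_roots)
        show "?at u f \<noteq> 0" using coeff[of u f n] cn y(2) by auto
        fix w assume "poly (?at u f) w = 0"
        then have "F (X u w) = 0" by (simp add: f flip: eval2_map_poly)
        moreover have "l v = 0" using local[OF v h(2)] .
        then have "l (X u w) \<noteq> 0" using False by (simp add: X_def lin_fun_simps[OF l(1)] l(2) y(1))
        ultimately have "h (X u w) = 0" using local by blast
        then show "poly (?at u g) w = 0" by (simp add: g flip: eval2_map_poly)
      qed
      moreover have deg_at: "degree (?at u f) = n"
      proof (rule antisym)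
        show "degree (?at u f) \<le> n" by (rule line_polynomial(1)[OF y(2) f_at])
        show "n \<le> degree (?at u f)" by (rule le_degree) (use coeff[of u f n] cn y(2) in auto)
      qed
      ultimately have dvd: "?at u f dvd ?at u g ^ n" by simp
      have hom: "?at u (a * b) = ?at u a * ?at u b" "?at u (a + b) = ?at u a + ?at u b" for a b
        by (auto intro!: map_poly_mult_hom map_poly_add_hom)
      have "?at u 1 = 1" by (simp add: map_poly_1)
      then have "?at u (g ^ m) = ?at u g ^ m" for m
        by (induction m) (auto simp: hom)
      moreover have "?at u (smult c p) = smult (poly c u) (?at u p)" for c p
        by (rule poly_eqI) (simp add: coeff_map_poly)
      ultimately have "?at u (smult ([:F y:] ^ k) (g ^ n)) = smult (F y ^ k) (?at u g ^ n)"
        by (simp add: poly_power)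
      then have "?at u r = smult (F y ^ k) (?at u g ^ n) - ?at u f * ?at u q"
        by (simp add: div hom eq_diff_eq add.commute)
      with dvd have "?at u f dvd ?at u r" by (metis dvd_diff dvd_smult dvd_triv_left)
      moreover have "degree (?at u r) \<le> degree r"
        by (rule degree_le) (simp add: coeff_map_poly coeff_eq_0)
      then have "degree (?at u r) < n" using r r0 by auto
      ultimately have "?at u r = 0"
        using deg_at by (metis dvd_imp_degree_le linorder_not_le)
      then show ?thesis using coeff[of u r j] by simp
    qed simp
    then have "coeff r j * [:0, 1:] = 0" for j using poly_all_0_iff_0 by blast
    then have "coeff r j = 0" for j by (metis mult_eq_0_iff pCons_eq_0_iff zero_neq_one)
    then show False using r0 by (simp add: poly_eq_iff)
  qed
  have smult: "eval2 (smult c p) s u = poly c s * eval2 p s u" for c p and s u :: 'k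
    by (simp add: eval2_def)
  have pow: "eval2 (p ^ m) s u = eval2 p s u ^ m" for p m and s u :: 'k
    by (simp add: eval2_def poly_power)
  \<comment> \<open>At \<open>X 0 0 = v\<close> the right side is zero, but the left side is
    not.\<close>
  have "F y ^ k * h (X 0 0) ^ n = F (X 0 0) * eval2 q 0 0"
    using arg_cong[OF div, of "\<lambda>p. eval2 p 0 0"] \<open>r = 0\<close> by (simp add: smult pow f g poly_power)
  then show False using v h(2) y(2) by (simp add: X_def)
qed

end

section \<open>Homogenizing a factorization given on an affine chart\<close>

lemma polyfun_linear_combination:
  assumes "\<And>k. polyfun (g k)" "lin_fun l"
  shows "polyfun (\<lambda>w. \<Sum>k\<le>d. g k w * l w ^ (d - k))"
  by (intro polyfun_sum polyfun_mult polyfun_power assms polyfun_lin_fun)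

lemma scaled_component_sum:
  fixes l s :: "'k::field"
  assumes "\<And>k. k \<le> d \<Longrightarrow> h k = s ^ k * g k" "l * s = 1"
  shows "l ^ d * (\<Sum>k\<le>d. h k) = (\<Sum>k\<le>d. g k * l ^ (d - k))"
  unfolding sum_distrib_left
proof (rule sum.cong[OF refl])
  fix k assume "k \<in> {..d}"
  then have k: "k \<le> d" by simp
  then have "l ^ d * s ^ k = l ^ (d - k) * (l * s) ^ k"
    by (simp add: power_mult_distrib flip: power_add mult.assoc)
  then have "l ^ d * s ^ k = l ^ (d - k)" by (simp add: assms(2))
  then show "l ^ d * h k = g k * l ^ (d - k)"
    using assms(1)[OF k] by (metis mult.assoc mult.commute)
qed

lemma last_nonzero_component:
  fixes g :: "nat \<Rightarrow> 'x \<Rightarrow> 'k::zero"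
  assumes "k \<le> K" "g k w \<noteq> 0"
  obtains d where "d \<le> K" "\<exists>w. g d w \<noteq> 0" "\<And>k w. d < k \<Longrightarrow> k \<le> K \<Longrightarrow> g k w = 0"
proof -
  let ?S = "{k. k \<le> K \<and> (\<exists>w. g k w \<noteq> 0)}"
  have fin: "finite ?S" by simp
  have "k \<in> ?S" using assms by auto
  then have in_S: "Max ?S \<in> ?S" using Max_in[OF fin] by blast
  define m where "m = Max ?S"
  have "m \<le> K" "\<exists>w. g m w \<noteq> 0" using in_S unfolding m_def[symmetric] by auto
  moreover have "g k w = 0" if "m < k" "k \<le> K" for k w
  proof (rule ccontr)
    assume "g k w \<noteq> 0"
    then have "k \<in> ?S" using that(2) by auto
    then have "k \<le> m" unfolding m_def by (rule Max_ge[OF fin])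
    then show False using that(1) by simp
  qed
  ultimately show ?thesis by (rule that)
qed

text \<open>Homogenizing both factors gives
  \<open>l w ^ (d + e) * F w = l w ^ n * (gt w * qt w)\<close> with top degrees \<open>d\<close> and
  \<open>e\<close>. Setting \<open>l w = 0\<close> excludes \<open>n < d + e\<close>. Otherwise
  \<open>gt\<close> divides \<open>F\<close> and is not constant because \<open>g 0\<close> is zero,
  so its cofactor is constant.\<close>

lemma (in irreducible_form) homogenized_factorization:
  assumes l: "lin_fun l" "l v = 1"
    and g: "\<And>k. polyfun (g k)" "\<And>k s w. g k (s *s w) = s ^ k * g k w"
      "\<And>k w. g k (w - l w *s v) = g k w" "\<And>w. g 0 w = 0"
    and q: "\<And>k. polyfun (q k)" "\<And>k s w. q k (s *s w) = s ^ k * q k w"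
      "\<And>k w. q k (w - l w *s v) = q k w"
    and prod: "\<And>w. l w = 1 \<Longrightarrow> F w = (\<Sum>k\<le>K. g k w) * (\<Sum>j\<le>E. q j w)"
  obtains c where "c \<noteq> 0" "\<exists>w. g n w \<noteq> 0" "\<And>w. F w = c * (\<Sum>k\<le>n. g k w * l w ^ (n - k))"
proof -
  note lin = lin_fun_simps[OF l(1)]
  have l_poly: "polyfun l" by (rule polyfun_lin_fun[OF l(1)])
  obtain w1 where w1: "l w1 = 1" "F w1 \<noteq> 0"
  proof -
    obtain w where "F w * l w \<noteq> 0"
      using polyfun_mult_eq_0[OF F_poly l_poly] F_nz l(2) by (metis zero_neq_one)
    then show ?thesis
      by (intro that[of "inverse (l w) *s w"]) (auto simp: lin F_hom)
  qed
  then have "(\<Sum>k\<le>K. g k w1) \<noteq> 0" "(\<Sum>j\<le>E. q j w1) \<noteq> 0" using prod by auto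
  then obtain k1 j1 where "k1 \<le> K" "g k1 w1 \<noteq> 0" "j1 \<le> E" "q j1 w1 \<noteq> 0"
    by (metis atMost_iff sum.neutral)
  then obtain d e where d: "d \<le> K" "\<exists>w. g d w \<noteq> 0" "\<And>k w. d < k \<Longrightarrow> k \<le> K \<Longrightarrow> g k w = 0"
    and e: "e \<le> E" "\<exists>w. q e w \<noteq> 0" "\<And>k w. e < k \<Longrightarrow> k \<le> E \<Longrightarrow> q k w = 0"
    using last_nonzero_component[of k1 K g w1] last_nonzero_component[of j1 E q w1] by metis
  define gt where "gt w = (\<Sum>k\<le>d. g k w * l w ^ (d - k))" for w
  define qt where "qt w = (\<Sum>j\<le>e. q j w * l w ^ (e - j))" for w
  have gt_poly: "polyfun gt" and qt_poly: "polyfun qt"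
    unfolding gt_def qt_def by (rule polyfun_linear_combination, rule g(1) q(1), rule l(1))+
  have key: "l w ^ (d + e) * F w = l w ^ n * (gt w * qt w)" if "l w \<noteq> 0" for w
  proof -
    define s where "s = inverse (l w)"
    have ls: "l w * s = 1" "l (s *s w) = 1" using that by (simp_all add: s_def lin)
    have "l w ^ d * (\<Sum>k\<le>K. g k (s *s w)) = l w ^ d * (\<Sum>k\<le>d. g k (s *s w))"
      by (intro arg_cong[of _ _ "\<lambda>x. l w ^ d * x"] sum.mono_neutral_right) (use d in \<open>auto simp: not_le\<close>)
    also have "\<dots> = gt w" unfolding gt_def by (rule scaled_component_sum[OF g(2) ls(1)])
    finally have G: "l w ^ d * (\<Sum>k\<le>K. g k (s *s w)) = gt w" .
    have "l w ^ e * (\<Sum>k\<le>E. q k (s *s w)) = l w ^ e * (\<Sum>k\<le>e. q k (s *s w))"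
      by (intro arg_cong[of _ _ "\<lambda>x. l w ^ e * x"] sum.mono_neutral_right) (use e in \<open>auto simp: not_le\<close>)
    also have "\<dots> = qt w" unfolding qt_def by (rule scaled_component_sum[OF q(2) ls(1)])
    finally have Q: "l w ^ e * (\<Sum>k\<le>E. q k (s *s w)) = qt w" .
    have "F w = l w ^ n * F (s *s w)" using ls(1) by (simp add: F_hom flip: power_mult_distrib mult.assoc)
    then show ?thesis
      unfolding prod[OF ls(2)] by (simp add: power_add mult_ac flip: G Q)
  qed
  show ?thesis
  proof (cases "d + e \<le> n")
    case True
    define R where "R w = l w ^ (n - d - e) * qt w" for w
    have R_poly: "polyfun R" unfolding R_def by (intro polyfun_mult polyfun_power l_poly qt_poly)
    have F: "F w = gt w * R w" for w
    proof (rule polyfun_eqI[OF F_poly polyfun_mult[OF gt_poly R_poly] l_poly])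
      show "l v \<noteq> 0" using l(2) by simp
      fix w assume w: "l w \<noteq> 0"
      have "l w ^ (d + e) * F w = l w ^ (d + e) * (l w ^ (n - d - e) * (gt w * qt w))"
        using key[OF w] True by (simp flip: mult.assoc power_add)
      then show "F w = gt w * R w" using w by (simp add: R_def mult_ac)
    qed
    have g0: "g k 0 = 0" for k
      using g(2)[of k 0 0] g(4)[of 0] by (cases k) auto
    then have "gt 0 = 0" by (simp add: gt_def)
    then have "\<not> (\<forall>w. gt w = gt 0)" using F w1(2) by (metis mult_zero_left)
    then have R0: "R w = R 0" for w using F_irr[OF gt_poly R_poly F] by blast
    have gt_hom: "gt (s *s w) = s ^ d * gt w" for s w
      unfolding gt_def sum_distrib_left
      by (rule sum.cong) (auto simp: g(2) lin power_mult_distrib mult_ac simp flip: power_add)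
    \<comment> \<open>Comparing how both sides scale identifies \<open>d\<close> with
      \<open>n\<close>, so the component of degree \<open>n\<close> is nonzero.\<close>
    have "F (2 *s w1) = 2 ^ d * F w1"
      by (simp add: F gt_hom R0[of "2 *s w1"] R0[of w1])
    then have "2 ^ n * F w1 = 2 ^ d * F w1" by (simp only: F_hom)
    then have "n = d" using w1(2) two_power_inj[where ?'k='k] by auto
    moreover have "R 0 \<noteq> 0" using F[of w1] w1(2) R0 by (metis mult_zero_right)
    moreover have "F w = R 0 * gt w" for w using F[of w] R0[of w] by (simp add: mult.commute)
    ultimately show ?thesis using that[of "R 0"] d(2) unfolding gt_def by blast
  next
    case False
    have F: "l w ^ (d + e - n) * F w = gt w * qt w" for w
    proof (rule polyfun_eqI[OF _ _ l_poly])
      show "polyfun (\<lambda>w. l w ^ (d + e - n) * F w)" "polyfun (\<lambda>w. gt w * qt w)"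
        by (intro polyfun_mult polyfun_power l_poly F_poly gt_poly qt_poly)+
      show "l v \<noteq> 0" using l(2) by simp
      fix w assume w: "l w \<noteq> 0"
      have "l w ^ n * (l w ^ (d + e - n) * F w) = l w ^ n * (gt w * qt w)"
        using key[OF w] False by (simp flip: mult.assoc power_add)
      then show "l w ^ (d + e - n) * F w = gt w * qt w" using w by simp
    qed
    have "g d w * q e w = 0" for w
    proof -
      \<comment> \<open>Projecting to \<open>l w = 0\<close> leaves the components unchanged, and
        there both homogenized sums reduce to their top terms.\<close>
      let ?w = "w - l w *s v"
      have lw: "l ?w = 0" by (simp add: lin l(2))
      have top: "(\<Sum>k\<le>m. f k * (0::'k) ^ (m - k)) = f m" for m f
      proof -
        have "(\<Sum>k\<le>m. f k * (0::'k) ^ (m - k)) = (\<Sum>k\<in>{m}. f k * 0 ^ (m - k))"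
          by (rule sum.mono_neutral_right) (auto simp: zero_power)
        then show ?thesis by simp
      qed
      have "gt ?w = g d ?w" "qt ?w = q e ?w" unfolding gt_def qt_def lw by (rule top)+
      then have "g d ?w * q e ?w = 0" using F[of ?w] lw False by (simp add: zero_power)
      then show ?thesis by (simp add: g(3) q(3))
    qed
    then show ?thesis using polyfun_mult_eq_0[OF g(1) q(1), of d e] d(2) e(2) by blast
  qed
qed

subsection \<open>The commutative algebra generated by the infinitesimal action\<close>

lemma funpow_commuting:
  assumes "\<And>w. a (b w) = b (a w)"
  shows "(a ^^ k) (b w) = b ((a ^^ k) w)"
  by (induction k) (auto simp: assms)

lemma funpow_comp_commuting:
  assumes "\<And>w. a (b w) = b (a w)"
  shows "((\<lambda>w. a (b w)) ^^ k) w = (a ^^ k) ((b ^^ k) w)"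
  by (induction k) (auto simp: funpow_commuting[where a=a and b=b, OF assms])

text \<open>By induction the \<open>q\<close>-th power of \<open>a + b\<close> is
  \<open>b ^^ q\<close> plus \<open>a\<close> applied after some \<open>S\<close> commuting with
  \<open>a\<close>. For \<open>q = L\<close> only the second part remains, and its
  \<open>K\<close>-th power contains \<open>a ^^ K\<close>.\<close>

lemma nilpotent_add:
  fixes a b :: "'k::field^'n::finite \<Rightarrow> 'k^'n"
  assumes a: "lin_op a" and b: "lin_op b" and ab: "\<And>w. a (b w) = b (a w)"
    and nil: "\<And>w. (a ^^ K) w = 0" "\<And>w. (b ^^ L) w = 0"
  shows "((\<lambda>w. a w + b w) ^^ (L * K)) w = 0"
proof -
  let ?c = "\<lambda>w. a w + b w"
  have c: "lin_op ?c" using a b by (auto intro!: lin_opI simp: lin_op_add lin_op_scale vec.scale_right_distrib)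
  have "\<exists>S. (\<forall>w. a (S w) = S (a w)) \<and> (\<forall>w. (?c ^^ q) w = (b ^^ q) w + a (S w))" for q
  proof (induction q)
    case 0
    show ?case by (rule exI[of _ "\<lambda>_. 0"]) (simp add: lin_op_0[OF a])
  next
    case (Suc q)
    then obtain S where S: "\<And>w. a (S w) = S (a w)" "\<And>w. (?c ^^ q) w = (b ^^ q) w + a (S w)" by blast
    have comm: "a ((b ^^ q) w) = (b ^^ q) (a w)" for w by (rule funpow_commuting[symmetric]) (simp add: ab)
    have bS: "a (?c (S w)) = ?c (S (a w))" for w
      by (simp add: lin_op_add[OF a] ab S(1))
    show ?case
    proof (intro exI[of _ "\<lambda>w. (b ^^ q) w + ?c (S w)"] conjI allI)
      fix w
      show "a ((b ^^ q) w + ?c (S w)) = (b ^^ q) (a w) + ?c (S (a w))"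
        by (simp only: lin_op_add[OF a] comm bS[unfolded lin_op_add[OF a]])
      show "(?c ^^ Suc q) w = (b ^^ Suc q) w + a ((b ^^ q) w + ?c (S w))"
        by (simp add: S(2) lin_op_add[OF a] lin_op_add[OF b] ab algebra_simps)
    qed
  qed
  from this[of L] obtain S where S: "\<And>w. a (S w) = S (a w)"
    "\<And>w. (?c ^^ L) w = (b ^^ L) w + a (S w)" by blast
  have "?c ^^ L = (\<lambda>w. a (S w))" by (rule ext) (simp add: S(2) nil(2))
  then have "(?c ^^ (L * K)) w = ((\<lambda>w. a (S w)) ^^ K) w"
    by (simp add: funpow_mult[symmetric])
  also have "\<dots> = (a ^^ K) ((S ^^ K) w)" by (rule funpow_comp_commuting) (rule S(1))
  finally show ?thesis by (simp add: nil(1))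
qed

locale nilpotent_family =
  fixes D :: "('k::field_char_0)^'m::finite \<Rightarrow> 'k^'n::finite \<Rightarrow> 'k^'n" and v :: "'k^'n"
  assumes D_linear: "lin_op (D t)" and D_add: "D (s + t) x = D s x + D t x"
    and D_scale: "D (c *s t) x = c *s D t x" and D_commute: "D s (D t x) = D t (D s x)"
    and D_nilpotent: "(D t ^^ CARD('n)) x = 0"
    and v_nonzero: "v \<noteq> 0"
begin

text \<open>The identity is left out: these operators form the maximal ideal of the local algebra,
  and all of them are nilpotent.\<close>

inductive mop :: "('k^'n \<Rightarrow> 'k^'n) \<Rightarrow> bool" where
  mop_D: "mop (D t)"
| mop_add: "mop a \<Longrightarrow> mop b \<Longrightarrow> mop (\<lambda>w. a w + b w)"
| mop_scale: "mop a \<Longrightarrow> mop (\<lambda>w. c *s a w)"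
| mop_comp: "mop a \<Longrightarrow> mop b \<Longrightarrow> mop (\<lambda>w. a (b w))"

lemma mop_linear: "mop a \<Longrightarrow> lin_op a"
  by (induction rule: mop.induct)
    (auto intro!: lin_opI simp: lin_op_add lin_op_scale D_linear algebra_simps)

lemma mop_commute:
  assumes "mop a" "mop b"
  shows "a (b w) = b (a w)"
proof -
  have D: "a (D t w) = D t (a w)" for t w
    using assms(1)
  proof (induction arbitrary: w rule: mop.induct)
    case (mop_comp a b)
    then show ?case by simp
  qed (auto simp: D_commute lin_op_add[OF D_linear] lin_op_scale[OF D_linear])
  show ?thesis using assms(2)
  proof (induction arbitrary: w rule: mop.induct)
    case (mop_comp b c)
    then show ?case by simp
  qed (auto simp: D lin_op_add[OF mop_linear[OF assms(1)]] lin_op_scale[OF mop_linear[OF assms(1)]])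
qed

lemma mop_nilpotent:
  assumes "mop a"
  shows "(a ^^ CARD('n)) w = 0"
proof -
  from assms have "\<exists>K. \<forall>w. (a ^^ K) w = 0"
  proof (induction rule: mop.induct)
    case (mop_D t)
    then show ?case using D_nilpotent by blast
  next
    case (mop_add a b)
    then obtain K L where "\<And>w. (a ^^ K) w = 0" "\<And>w. (b ^^ L) w = 0" by blast
    then have "((\<lambda>w. a w + b w) ^^ (L * K)) w = 0" for w
      by (rule nilpotent_add[OF mop_linear[OF mop_add(1)] mop_linear[OF mop_add(2)]
            mop_commute[OF mop_add(1,2)]])
    then show ?case by blast
  next
    case (mop_scale a c)
    then obtain K where K: "\<And>w. (a ^^ K) w = 0" by blast
    have "((\<lambda>w. c *s a w) ^^ K) w = ((\<lambda>w. c *s w) ^^ K) ((a ^^ K) w)" for w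
      by (rule funpow_comp_commuting) (simp add: lin_op_scale[OF mop_linear[OF mop_scale(1)]])
    moreover have "((\<lambda>w. c *s w) ^^ K) 0 = (0 :: 'k^'n)" by (induction K) auto
    ultimately show ?case using K by auto
  next
    case (mop_comp a b)
    then obtain K where K: "\<And>w. (a ^^ K) w = 0" by blast
    have "((\<lambda>w. a (b w)) ^^ K) w = (a ^^ K) ((b ^^ K) w)" for w
      by (rule funpow_comp_commuting) (rule mop_commute[OF mop_comp(1,2)])
    then show ?case using K by auto
  qed
  then show ?thesis using nilpotent_index[OF mop_linear[OF assms]] by blast
qed

lemma mop_zero: "mop (\<lambda>w. 0)"
proof -
  have "D 0 = (\<lambda>w. 0)" using D_scale[of 0 0] by auto
  then show ?thesis using mop_D[of 0] by simp
qed

lemma mop_poly_op: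
  assumes "mop a" "coeff p 0 = 0"
  shows "mop (poly_op a p)"
proof -
  note lin = mop_linear[OF assms(1)]
  have *: "mop (\<lambda>w. a (poly_op a q w))" for q
  proof (induction q)
    case 0
    then show ?case by (simp add: lin_op_0[OF lin] mop_zero)
  next
    case (pCons c q)
    have "mop (\<lambda>w. c *s a w + a (a (poly_op a q w)))"
      by (rule mop_add[OF mop_scale[OF assms(1)] mop_comp[OF assms(1) pCons.IH]])
    then show ?case by (simp add: poly_op_pCons[OF lin] lin_op_add[OF lin] lin_op_scale[OF lin])
  qed
  obtain c q where p: "p = pCons c q" by (rule pCons_cases)
  then have "poly_op a p = (\<lambda>w. a (poly_op a q w))"
    using assms(2) by (intro ext) (simp add: poly_op_pCons[OF lin])
  then show ?thesis using *[of q] by simp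
qed

lemma mop_cyclic_subspace: "vec.subspace {a v | a. mop a}"
proof (rule vec.subspaceI)
  show "0 \<in> {a v | a. mop a}" using mop_zero by force
next
  fix x y assume "x \<in> {a v | a. mop a}" "y \<in> {a v | a. mop a}"
  then obtain a b where "mop a" "mop b" "x = a v" "y = b v" by blast
  then show "x + y \<in> {a v | a. mop a}"
    by (intro CollectI exI[of _ "\<lambda>w. a w + b w"]) (simp add: mop_add)
next
  fix c x assume "x \<in> {a v | a. mop a}"
  then obtain a where "mop a" "x = a v" by blast
  then show "c *s x \<in> {a v | a. mop a}"
    by (intro CollectI exI[of _ "\<lambda>w. c *s a w"]) (simp add: mop_scale)
qed

lemma exp_orbit_point:
  obtains a where "mop a" "poly_op (D t) (exp_poly CARD('n)) v = v + a v"
proof -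
  let ?p = "exp_poly CARD('n) :: 'k poly"
  have "coeff (?p - [:1:]) 0 = 0" by (simp add: coeff_exp_poly)
  then have "mop (poly_op (D t) (?p - [:1:]))" by (rule mop_poly_op[OF mop_D])
  moreover have "poly_op (D t) ?p v = poly_op (D t) ([:1:] + (?p - [:1:])) v" by simp
  then have "poly_op (D t) ?p v = v + poly_op (D t) (?p - [:1:]) v"
    by (simp only: poly_op_add poly_op_const vec.scale_one)
  ultimately show ?thesis by (rule that)
qed

text \<open>Nilpotency excludes nonzero fixed vectors; thus \<open>v\<close> can be separated from
  the subspace of all \<open>a v\<close>.\<close>

lemma not_mop_fixed: "mop a \<Longrightarrow> a v \<noteq> v"
proof
  assume a: "mop a" "a v = v"
  have "(a ^^ k) v = v" for k by (induction k) (auto simp: a(2))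
  then show False using mop_nilpotent[OF a(1)] v_nonzero by metis
qed

end

section \<open>The cyclic module of the hypersurface and its equation\<close>

locale additive_hypersurface =
  nilpotent_family D v + irreducible_form F n
  for D :: "('k::{alg_closed_field, field_char_0})^'m::finite \<Rightarrow> 'k^'n::finite \<Rightarrow> 'k^'n" and v F n +
  assumes card_n: "CARD('n) = n + 1" and card_m: "CARD('m) = n - 1"
    and orbit: "F (poly_op (D t) (exp_poly CARD('n)) v) = 0"
    and effective: "(\<And>x. D t x = 0) \<Longrightarrow> t = 0"
    and spanning: "lin_fun l \<Longrightarrow> (\<And>a. mop a \<Longrightarrow> l (a v) = 0) \<Longrightarrow> l v = 0 \<Longrightarrow> l w = 0"
begin

text \<open>The coordinate along \<open>v\<close> in the splitting into multiples of
  \<open>v\<close> and the vectors \<open>a v\<close>; it becomes the homogenizing variable.\<close>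

definition height :: "'k^'n \<Rightarrow> 'k" where
  "height = (SOME l. lin_fun l \<and> (\<forall>a. mop a \<longrightarrow> l (a v) = 0) \<and> l v = 1)"

lemma height: "lin_fun height" "mop a \<Longrightarrow> height (a v) = 0" "height v = 1"
proof -
  have "v \<notin> {a v | a. mop a}" using not_mop_fixed by force
  from separating_functional[OF mop_cyclic_subspace this]
  have "\<exists>l. lin_fun l \<and> (\<forall>a. mop a \<longrightarrow> l (a v) = 0) \<and> l v = 1" by (metis (mono_tags, lifting) mem_Collect_eq)
  from someI_ex[OF this] show "lin_fun height" "mop a \<Longrightarrow> height (a v) = 0" "height v = 1"
    unfolding height_def by auto
qed

lemmas height_simps = lin_fun_simps[OF height(1)]

lemma cyclic: "\<exists>a. mop a \<and> a v = w - height w *s v"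
proof (rule ccontr)
  assume neg: "\<not> ?thesis"
  then have "w - height w *s v \<notin> {a v | a. mop a}" by force
  from separating_functional[OF mop_cyclic_subspace this]
  obtain l where l: "lin_fun l" "\<And>a. mop a \<Longrightarrow> l (a v) = 0" "l (w - height w *s v) = 1"
    by (metis (mono_tags, lifting) mem_Collect_eq)
  note lin = lin_fun_simps[OF l(1)]
  \<comment> \<open>Correcting \<open>l\<close> by a multiple of \<open>height\<close> makes it
    vanish at \<open>v\<close> too, so that \<open>spanning\<close> applies.\<close>
  define l' where "l' x = l x - height x * l v" for x
  have "lin_fun l'" by (simp add: lin_fun_def l'_def lin height_simps algebra_simps)
  then have "l' (w - height w *s v) = 0"
    by (rule spanning) (auto simp: l'_def l(2) height)
  then show False by (simp add: l'_def l(3) height_simps height(3))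
qed

text \<open>Every vector is a multiple of \<open>v\<close> plus some \<open>c v\<close> with
  \<open>mop c\<close>, and commutativity gives \<open>a (c v) = c (a v)\<close>.\<close>

lemma mop_determined:
  assumes "mop a" "mop b" "a v = b v"
  shows "a w = b w"
proof -
  obtain c where c: "mop c" "c v = w - height w *s v" using cyclic by blast
  then have w: "w = height w *s v + c v" by simp
  have "a w = height w *s a v + c (a v)" if "mop a" for a
  proof -
    note lin = mop_linear[OF that]
    have "a w = a (height w *s v + c v)" using w by (rule arg_cong)
    also have "\<dots> = height w *s a v + c (a v)"
      by (simp only: lin_op_add[OF lin] lin_op_scale[OF lin] mop_commute[OF that c(1)])
    finally show ?thesis .
  qed
  from this[OF assms(1)] this[OF assms(2)] show ?thesis by (simp add: assms(3))
qed

text \<open>The inverse of \<open>a \<mapsto> a v\<close>, extended by zero on \<open>v\<close>; it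
  makes expressions in the algebra polynomial functions of a vector.\<close>

definition T :: "'k^'n \<Rightarrow> 'k^'n \<Rightarrow> 'k^'n" where
  "T w = (SOME a. mop a \<and> a v = w - height w *s v)"

lemma T_mop: "mop (T w)" and T_v: "T w v = w - height w *s v"
proof -
  have "mop (T w) \<and> T w v = w - height w *s v"
    unfolding T_def by (rule someI_ex[OF cyclic])
  then show "mop (T w)" "T w v = w - height w *s v" by blast+
qed

lemma T_eqI: "mop a \<Longrightarrow> a v = w - height w *s v \<Longrightarrow> T w = a"
  by (rule ext, rule mop_determined[OF T_mop]) (simp_all add: T_v)

lemma T_add: "T (x + y) z = T x z + T y z"
proof -
  have "T (x + y) = (\<lambda>w. T x w + T y w)"
    by (rule T_eqI[OF mop_add[OF T_mop T_mop]]) (simp add: T_v height_simps algebra_simps)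
  then show ?thesis by simp
qed

lemma T_scale: "T (c *s x) z = c *s T x z"
proof -
  have "T (c *s x) = (\<lambda>w. c *s T x w)"
    by (rule T_eqI[OF mop_scale[OF T_mop]]) (simp add: T_v height_simps algebra_simps)
  then show ?thesis by simp
qed

lemma T_linear: "lin_op (\<lambda>w. T w z)"
  by (rule lin_opI) (simp_all add: T_add T_scale)

lemma T_of_mop: "mop a \<Longrightarrow> T (a v) = a"
  by (rule T_eqI) (simp_all add: height(2))

lemma T_reduce: "T (w - height w *s v) = T w"
  by (metis T_of_mop T_mop T_v)

lemma T_power_scale: "(T (s *s w) ^^ k) z = s ^ k *s (T w ^^ k) z"
  by (induction k arbitrary: z)
    (auto simp: T_scale lin_op_scale[OF mop_linear[OF T_mop]] mult_ac)

lemma polyfun_T_power: "polyfun (\<lambda>w. (T w ^^ k) v $ i)"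
proof (induction k arbitrary: i)
  case 0
  then show ?case by (simp add: polyfun_const)
next
  case (Suc k)
  have "polyfun (\<lambda>w. \<Sum>j\<in>UNIV. (T w ^^ k) v $ j * T w (axis j 1) $ i)"
    by (intro polyfun_sum polyfun_mult Suc polyfun_linear T_linear)
  moreover have "(T w ^^ Suc k) v $ i = (\<Sum>j\<in>UNIV. (T w ^^ k) v $ j * T w (axis j 1) $ i)" for w
    using linear_componentwise[OF mop_linear[OF T_mop], of w "(T w ^^ k) v" i] by simp
  ultimately show ?case by simp
qed

lemma polyfun_poly_op_T: "polyfun (\<lambda>w. poly_op (T w) p v $ i)"
proof -
  have "polyfun (\<lambda>w. \<Sum>k\<le>degree p. coeff p k * (T w ^^ k) v $ i)"
    by (intro polyfun_sum polyfun_mult polyfun_const polyfun_T_power)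
  then show ?thesis by (simp add: poly_op_def sum_component)
qed

text \<open>Effectiveness makes \<open>t \<mapsto> D t v\<close> injective, so its image has
  dimension \<open>n - 1\<close>; \<open>v\<close> lies outside of it. Together they span dimension
  \<open>n\<close> in a space of dimension \<open>n + 1\<close>, hence a hyperplane.\<close>

lemma tangent_hyperplane:
  obtains l e where "lin_fun l" "l e = 1" "l v = 0" "\<And>t. l (D t v) = 0"
    "\<And>w. l w = 0 \<Longrightarrow> \<exists>c t. w = c *s v + D t v"
proof -
  have lin: "lin_op (\<lambda>t. D t v)" by (rule lin_opI) (simp_all add: D_add D_scale)
  have inj: "inj (\<lambda>t. D t v)"
  proof (rule injI)
    fix s t assume "D s v = D t v"
    then have "D (s + (- 1) *s t) v = 0" unfolding D_add D_scale by simp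
    then have "D (s + (- 1) *s t) x = 0" for x
      using mop_determined[OF mop_D mop_zero] by blast
    then have "s + (- 1) *s t = 0" by (rule effective)
    then show "s = t" by simp
  qed
  define S where "S = vec.span (insert v (range (\<lambda>t. D t v)))"
  have range: "vec.span (range (\<lambda>t. D t v)) = range (\<lambda>t. D t v)"
    using vec.linear_subspace_image[OF lin vec.subspace_UNIV] by (simp add: vec.span_eq_iff)
  have S: "w \<in> S \<Longrightarrow> \<exists>c t. w = c *s v + D t v" for w
    unfolding S_def vec.span_insert range by (auto simp: diff_eq_eq add.commute) (metis add.commute)
  have "vec.dim (range (\<lambda>t. D t v)) = vec.dim (UNIV :: ('k^'m) set)"
    by (rule vec.dim_image_eq[OF lin]) (simp add: inj)
  then have dim_range: "vec.dim (range (\<lambda>t. D t v)) = n - 1" by (simp only: vec_dim_card card_m)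
  have v_range: "v \<notin> range (\<lambda>t. D t v)"
  proof
    assume "v \<in> range (\<lambda>t. D t v)"
    then obtain t where "v = D t v" by (rule rangeE)
    then show False using not_mop_fixed[OF mop_D, of t] by simp
  qed
  have dim_S: "vec.dim S = n"
    unfolding S_def vec.dim_span vec.dim_insert range dim_range if_not_P[OF v_range] using n_ge_2 by simp
  have "S \<noteq> UNIV"
  proof
    assume "S = UNIV"
    then have "vec.dim S = CARD('n)" by (simp only: vec_dim_card)
    then show False using dim_S card_n by linarith
  qed
  then obtain e where e: "e \<notin> S" by blast
  have sub: "vec.subspace S" unfolding S_def by (rule vec.subspace_span)
  obtain l where l: "lin_fun l" "\<And>y. y \<in> S \<Longrightarrow> l y = 0" "l e = 1"
    using separating_functional[OF sub e] by blast
  have "w \<in> S" if w: "l w = 0" for w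
  proof -
    have span: "vec.span S = S" using sub by (simp add: vec.span_eq_iff)
    have "vec.dim (insert e S) = n + 1" by (simp add: vec.dim_insert span e dim_S)
    then have "vec.span (insert e S) = UNIV"
      by (simp only: vec.dim_eq_full[symmetric] vec.dimension_def card_cart_basis card_n)
    then have "w \<in> vec.span (insert e S)" by simp
    then obtain k where k: "w - k *s e \<in> S" by (auto simp: vec.span_insert span)
    then have "k = 0" using l(2)[OF k] w l(3) by (simp add: lin_fun_simps[OF l(1)])
    then show ?thesis using k by simp
  qed
  then show ?thesis
  proof (intro that[of l e] l)
    show "v \<in> S" "D t v \<in> S" for t unfolding S_def by (auto intro: vec.span_base)
  qed (auto intro: S)
qed

text \<open>
  The function \<open>F\<close> vanishes at \<open>exp(a) v\<close> for \<open>a\<close> in the tangent hyperplane; dividing by the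
  equation of the latter and substituting the logarithm gives the equation of \<open>F\<close> on the chart
  of height one.
\<close>

lemma logarithmic_equation:
  assumes l: "lin_fun l" "l e = 1" and ker: "\<And>w. l w = 0 \<Longrightarrow> \<exists>c t. w = c *s v + D t v"
  obtains Q where "polyfun Q"
    "\<And>w. F (v + T w v) = l (poly_op (T w) (log_poly CARD('n)) v) * Q w" "\<And>w. Q (w - height w *s v) = Q w"
proof -
  let ?N = "CARD('n)"
  define H where "H w = F (poly_op (T w) (exp_poly ?N) v)" for w
  have H_poly: "polyfun H" unfolding H_def by (rule polyfun_comp[OF F_poly polyfun_poly_op_T])
  have "H w = 0" if w: "l w = 0" for w
  proof -
    obtain c t where "w = c *s v + D t v" using ker[OF w] by blast
    then have "D t v = w - height w *s v" by (simp add: height_simps height mop_D)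
    then have "T w = D t" by (rule T_eqI[OF mop_D])
    then show ?thesis by (simp add: H_def orbit)
  qed
  then obtain R where R: "polyfun R" "\<And>w. H w = l w * R w"
    using polyfun_hyperplane_dvd[OF H_poly polyfun_lin_fun[OF l(1)], of e] l(2)
    by (auto simp: lin_fun_simps[OF l(1)])
  \<comment> \<open>The operator belonging to the vector \<open>L w\<close> is log(1 +
    \<open>T w\<close>), so that \<open>H (L w)\<close> equals \<open>F (v + T w v)\<close>.\<close>
  define L where "L w = poly_op (T w) (log_poly ?N) v" for w
  have TL: "T (L w) = poly_op (T w) (log_poly ?N)" for w
    unfolding L_def by (rule T_of_mop[OF mop_poly_op[OF T_mop]]) (simp add: coeff_log_poly)
  have "F (v + T w v) = l (L w) * R (L w)" for w
  proof -
    note lin = mop_linear[OF T_mop[of w]]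
    have "poly_op (T (L w)) (exp_poly ?N) v = poly_op (T w) (pcompose (exp_poly ?N) (log_poly ?N)) v"
      unfolding TL by (rule poly_op_pcompose[OF lin, symmetric])
    also have "\<dots> = poly_op (T w) [:1, 1:] v"
      by (rule poly_op_cong[OF lin mop_nilpotent[OF T_mop] exp_log_poly])
    also have "\<dots> = v + T w v" by (simp add: poly_op_pCons[OF lin] lin_op_0[OF lin])
    finally have "H (L w) = F (v + T w v)" by (simp add: H_def)
    then show ?thesis by (simp add: R(2))
  qed
  moreover have "polyfun (\<lambda>w. R (L w))"
    unfolding L_def by (rule polyfun_comp[OF R(1) polyfun_poly_op_T])
  moreover have "R (L (w - height w *s v)) = R (L w)" for w by (simp add: L_def T_reduce)
  ultimately show ?thesis using that[of "\<lambda>w. R (L w)"] unfolding L_def by blast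
qed

text \<open>The logarithmic factor splits into components of degree \<open>k\<close> in
  \<open>T w\<close>, and its cofactor is constant by \<open>homogenized_factorization\<close>. As
  \<open>F\<close> has degree \<open>n\<close>, the last possible component is nonzero.\<close>

lemma explicit_equation:
  obtains l c where "lin_fun l" "l v = 0" "c \<noteq> 0" "\<exists>w. l ((T w ^^ n) v) \<noteq> 0"
    "\<And>w. F w = c * (\<Sum>k\<le>n. coeff (log_poly CARD('n)) k * l ((T w ^^ k) v) * height w ^ (n - k))"
proof -
  obtain l e where l: "lin_fun l" "l e = 1" "l v = 0"
    and ker: "\<And>w. l w = 0 \<Longrightarrow> \<exists>c t. w = c *s v + D t v"
    using tangent_hyperplane by metis
  note lin = lin_fun_simps[OF l(1)]
  obtain Q where Q: "polyfun Q"
    "\<And>w. F (v + T w v) = l (poly_op (T w) (log_poly CARD('n)) v) * Q w" "\<And>w. Q (w - height w *s v) = Q w"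
    using logarithmic_equation[OF l(1,2) ker] by blast
  obtain q E where q: "\<And>j. polyfun (q j)" "\<And>s x. Q (s *s x) = (\<Sum>j\<le>E. q j x * s ^ j)"
    "\<And>j s x. q j (s *s x) = s ^ j * q j x"
    using polyfun_homogeneous_components[OF Q(1)] by metis
  \<comment> \<open>Composition with the projection along \<open>v\<close> makes each component
    invariant in that direction; the sum is still \<open>Q w\<close> because \<open>Q\<close> is
    invariant.\<close>
  define q' where "q' j w = q j (w - height w *s v)" for j w
  define g where "g k w = coeff (log_poly CARD('n)) k * l ((T w ^^ k) v)" for k w
  have red: "(w - height w *s v) - height (w - height w *s v) *s v = w - height w *s v" for w
    by (simp add: height_simps height(3))
  have g_poly: "polyfun (g k)" for k
    unfolding g_def
    by (intro polyfun_mult polyfun_const polyfun_comp[OF polyfun_lin_fun[OF l(1)]] polyfun_T_power)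
  have q'_poly: "polyfun (q' k)" for k
    unfolding q'_def
  proof (rule polyfun_comp[OF q(1)])
    fix i
    have "lin_op (\<lambda>w. w - height w *s v)"
      by (rule lin_opI) (simp_all add: height_simps algebra_simps)
    then show "polyfun (\<lambda>w. (w - height w *s v) $ i)" by (rule polyfun_linear)
  qed
  have prod: "F w = (\<Sum>k\<le>n. g k w) * (\<Sum>j\<le>E. q' j w)" if "height w = 1" for w
  proof -
    have "degree (log_poly CARD('n) :: 'k poly) \<le> n"
      by (rule degree_le) (simp add: coeff_log_poly card_n)
    then have "l (poly_op (T w) (log_poly CARD('n)) v) = (\<Sum>k\<le>n. g k w)"
      by (simp add: poly_op_le[of _ n] lin g_def)
    moreover have "Q w = (\<Sum>j\<le>E. q' j w)"
      using q(2)[of 1 "w - height w *s v"] by (simp add: Q(3) q'_def)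
    moreover have "w = v + T w v" using that by (simp add: T_v)
    ultimately show ?thesis using Q(2)[of w] by simp
  qed
  have q'_hom: "q' k (s *s w) = s ^ k * q' k w" for k s w
  proof -
    have "s *s w - height (s *s w) *s v = s *s (w - height w *s v)"
      by (simp add: height_simps algebra_simps)
    then show ?thesis unfolding q'_def by (simp only: q(3))
  qed
  have q'_red: "q' k (w - height w *s v) = q' k w" for k w by (simp only: q'_def red)
  have g_hom: "g k (s *s w) = s ^ k * g k w" for k s w by (simp add: g_def T_power_scale lin)
  have g_red: "g k (w - height w *s v) = g k w" for k w by (simp only: g_def T_reduce)
  have g_0: "g 0 w = 0" for w by (simp add: g_def coeff_log_poly)
  obtain c where c: "c \<noteq> 0" "\<exists>w. g n w \<noteq> 0"
    "\<And>w. F w = c * (\<Sum>k\<le>n. g k w * height w ^ (n - k))"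
    using homogenized_factorization[OF height(1,3) g_poly g_hom g_red g_0 q'_poly q'_hom q'_red prod]
    by blast
  show ?thesis
    by (rule that[OF l(1,3) c(1)]) (use c(2,3) in \<open>auto simp: g_def\<close>)
qed

end

subsection \<open>The normal form\<close>

text \<open>After factoring out \<open>z ^ i\<close>, the expansion of \<open>(1 + Y) ^ i\<close>
  with \<open>Y = c z ^ r\<close> is linear in \<open>Y\<close> up to multiples of
  \<open>z ^ (2 * r)\<close>.\<close>

lemma perturbed_generator_power:
  fixes c :: "'k::comm_ring_1"
  shows "monom 1 (i + 2 * r) dvd
    (monom 1 1 + monom c (Suc r)) ^ i - (monom 1 i + monom (of_nat i * c) (i + r))"
proof -
  let ?Y = "monom c r"
  have "\<exists>k. (1 + ?Y) ^ i = 1 + of_nat i * ?Y + monom 1 (2 * r) * k"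
  proof (induction i)
    case 0
    show ?case by (rule exI[of _ 0]) simp
  next
    case (Suc i)
    then obtain k where k: "(1 + ?Y) ^ i = 1 + of_nat i * ?Y + monom 1 (2 * r) * k" by blast
    have YY: "?Y * ?Y = monom 1 (2 * r) * [:c * c:]"
      by (simp add: mult_monom mult_2 smult_monom)
    have "(1 + ?Y) ^ Suc i = (1 + ?Y) * (1 + of_nat i * ?Y + monom 1 (2 * r) * k)"
      by (simp add: k)
    also have "\<dots> = 1 + of_nat (Suc i) * ?Y + (of_nat i * (?Y * ?Y) + monom 1 (2 * r) * (k + ?Y * k))"
      by (simp add: algebra_simps)
    also have "\<dots> = 1 + of_nat (Suc i) * ?Y + monom 1 (2 * r) * (of_nat i * [:c * c:] + (k + ?Y * k))"
      unfolding YY by (simp only: distrib_left mult.left_commute)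
    finally show ?case by blast
  qed
  then obtain k where k: "(1 + ?Y) ^ i = 1 + of_nat i * ?Y + monom 1 (2 * r) * k" by blast
  have "monom 1 1 + monom c (Suc r) = monom 1 1 * (1 + ?Y)"
    by (simp add: distrib_left mult_monom)
  then have "(monom 1 1 + monom c (Suc r)) ^ i = monom 1 i * (1 + ?Y) ^ i"
    by (simp only: power_mult_distrib monom_power power_one mult_1)
  also have "\<dots> = monom 1 i + monom 1 i * (of_nat i * ?Y) + monom 1 i * (monom 1 (2 * r) * k)"
    by (simp add: k distrib_left)
  also have "monom 1 i * (of_nat i * ?Y) = monom (of_nat i * c) (i + r)"
    by (simp add: of_nat_poly smult_monom mult_monom)
  also have "monom 1 i * (monom 1 (2 * r) * k) = monom 1 (i + 2 * r) * k"
    by (simp add: mult_monom flip: mult.assoc)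
  finally show ?thesis by simp
qed

text \<open>The coefficient of \<open>z ^ n\<close> in log(1 + x_1 z + ... + x_n z^n), made
  homogeneous of degree \<open>n\<close> by powers of \<open>x 0\<close>.\<close>

definition standard_form :: "nat \<Rightarrow> (nat \<Rightarrow> 'k::field_char_0) \<Rightarrow> 'k" where
  "standard_form n x = (\<Sum>k\<le>n. coeff (log_poly (n + 1)) k *
     coeff ((\<Sum>i\<in>{1..n}. monom (x i) i) ^ k) n * x 0 ^ (n - k))"

context additive_hypersurface
begin

lemma mop_power_0: "mop a \<Longrightarrow> n < k \<Longrightarrow> (a ^^ k) w = 0"
proof -
  assume a: "mop a" and k: "n < k"
  have "(a ^^ k) w = (a ^^ (k - (n + 1))) ((a ^^ (n + 1)) w)"
    using k by (metis Suc_eq_plus1 Suc_leI comp_apply funpow_add le_add_diff_inverse2)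
  then show ?thesis
    using mop_nilpotent[OF a] lin_op_0[OF lin_op_funpow[OF mop_linear[OF a]]] by (simp add: card_n)
qed

text \<open>
  Replacing \<open>z\<close> by \<open>z + c z\<^sup>j\<^sup>+\<^sup>2\<close> changes \<open>l (z\<^sup>i v)\<close> for \<open>i = n - 1 - j\<close> by \<open>i c l (z\<^sup>n v)\<close> and leaves
  the values for larger \<open>i\<close> unchanged.
\<close>

lemma normalized_generator_step:
  assumes l: "lin_fun l" and z0: "mop z0" "l ((z0 ^^ n) v) \<noteq> 0" and "j \<le> n - 1"
  shows "\<exists>z. mop z \<and> l ((z ^^ n) v) \<noteq> 0 \<and> (\<forall>i. n - j \<le> i \<and> i < n \<longrightarrow> l ((z ^^ i) v) = 0)"
  using assms(4)
proof (induction j)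
  case 0
  then show ?case using z0 by (intro exI[of _ z0]) auto
next
  case (Suc j)
  then obtain z where z: "mop z" "l ((z ^^ n) v) \<noteq> 0" "\<And>i. n - j \<le> i \<Longrightarrow> i < n \<Longrightarrow> l ((z ^^ i) v) = 0"
    by auto
  note lin = lin_fun_simps[OF l]
  define i0 where "i0 = n - 1 - j"
  have i0: "i0 \<ge> 1" "i0 + Suc j = n" using Suc.prems by (auto simp: i0_def)
  \<comment> \<open>The solution of
    \<open>l ((z ^^ i0) v) + of_nat i0 * c * l ((z ^^ n) v) = 0\<close>; dividing by
    \<open>i0\<close> uses characteristic zero.\<close>
  define c where "c = - l ((z ^^ i0) v) / (of_nat i0 * l ((z ^^ n) v))"
  define p where "p = monom 1 1 + monom c (Suc (Suc j))"
  have power: "(poly_op z p ^^ i) v = (z ^^ i) v + (of_nat i * c) *s (z ^^ (i + Suc j)) v" if "i0 \<le> i" for i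
  proof -
    \<comment> \<open>From \<open>i0 \<le> i\<close> and \<open>i0 + Suc j = n\<close> follows
      \<open>n + 1 \<le> i + 2 * Suc j\<close>, so the error term acts as zero.\<close>
    have "monom (1::'k) CARD('n) dvd monom 1 (i + 2 * Suc j)"
      using that i0 by (intro dvdI[of _ _ "monom 1 (i + 2 * Suc j - CARD('n))"])
        (simp add: mult_monom card_n)
    then have "monom 1 CARD('n) dvd p ^ i - (monom 1 i + monom (of_nat i * c) (i + Suc j))"
      unfolding p_def by (rule dvd_trans) (rule perturbed_generator_power)
    then have "poly_op z (p ^ i) v = poly_op z (monom 1 i + monom (of_nat i * c) (i + Suc j)) v"
      by (rule poly_op_cong[OF mop_linear[OF z(1)] mop_nilpotent[OF z(1)]])
    then show ?thesis
      by (simp add: poly_op_power[OF mop_linear[OF z(1)]] poly_op_add poly_op_monom)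
  qed
  show ?case
  proof (intro exI[of _ "poly_op z p"] conjI allI impI)
    show "mop (poly_op z p)" by (rule mop_poly_op[OF z(1)]) (simp add: p_def)
    have "(z ^^ (n + Suc j)) v = 0" by (rule mop_power_0[OF z(1)]) simp
    then show "l ((poly_op z p ^^ n) v) \<noteq> 0" using power[of n] i0 z(2) by simp
    fix i assume i: "n - Suc j \<le> i \<and> i < n"
    show "l ((poly_op z p ^^ i) v) = 0"
    proof (cases "i = i0")
      case True
      have "l ((poly_op z p ^^ i) v) = l ((z ^^ i0) v) + (of_nat i0 * c) * l ((z ^^ n) v)"
        unfolding True power[OF order.refl] i0(2) by (simp only: lin)
      then show ?thesis using i0(1) z(2) by (simp add: c_def)
    next
      \<comment> \<open>Here \<open>i\<close> exceeds \<open>i0\<close>, and the correction has an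
        exponent above \<open>n\<close>, where the powers of \<open>z\<close> vanish.\<close>
      case False
      then have "i0 \<le> i" "n - j \<le> i" "n < i + Suc j" using i i0 by auto
      then show ?thesis
        using power[of i] z(3)[of i] i mop_power_0[OF z(1), of "i + Suc j" v] by simp
    qed
  qed
qed

text \<open>In the basis \<open>(z ^^ i) v\<close> the operator \<open>T w\<close> is a polynomial
  in \<open>z\<close>, and \<open>l\<close> reads off the coefficient of \<open>z ^ n\<close> up to
  a scalar, so only a constant in the equation depends on the hypersurface.\<close>

lemma normal_form:
  shows "\<exists>b c. c \<noteq> 0 \<and> (\<forall>x. (\<Sum>i\<le>n. x i *s b i) = 0 \<longrightarrow> (\<forall>j\<le>n. x j = 0)) \<and>
    (\<forall>x. F (\<Sum>i\<le>n. x i *s b i) = c * standard_form n x)"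
proof -
  obtain l c where l: "lin_fun l" "l v = 0" and c: "c \<noteq> 0" and top: "\<exists>w. l ((T w ^^ n) v) \<noteq> 0"
    and F: "\<And>w. F w = c * (\<Sum>k\<le>n. coeff (log_poly CARD('n)) k * l ((T w ^^ k) v) * height w ^ (n - k))"
    using explicit_equation by blast
  note lin = lin_fun_simps[OF l(1)]
  obtain w0 where "l ((T w0 ^^ n) v) \<noteq> 0" using top by blast
  from normalized_generator_step[OF l(1) T_mop this order.refl]
  obtain z where z: "mop z" "l ((z ^^ n) v) \<noteq> 0" and z': "\<forall>i. n - (n - 1) \<le> i \<and> i < n \<longrightarrow> l ((z ^^ i) v) = 0"
    by blast
  \<comment> \<open>The normalization covers the exponents from 1 on; exponent zero is
    \<open>l v = 0\<close>.\<close>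
  have low: "l ((z ^^ i) v) = 0" if "i < n" for i
    using that z' l(2) by (cases i) auto
  note z_lin = mop_linear[OF z(1)]
  define b where "b i = (z ^^ i) v" for i
  have l_poly_op: "l (poly_op z p v) = coeff p n * l ((z ^^ n) v)" for p
  proof -
    have "l (poly_op z p v) = (\<Sum>i\<le>max n (degree p). coeff p i * l ((z ^^ i) v))"
      by (subst poly_op_le[of p "max n (degree p)"]) (simp_all add: lin)
    also have "\<dots> = (\<Sum>i\<in>{n}. coeff p i * l ((z ^^ i) v))"
    proof (rule sum.mono_neutral_right)
      show "\<forall>i\<in>{..max n (degree p)} - {n}. coeff p i * l ((z ^^ i) v) = 0"
      proof
        fix i assume "i \<in> {..max n (degree p)} - {n}"
        then consider "i < n" | "n < i" by force
        then show "coeff p i * l ((z ^^ i) v) = 0"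
          by cases (auto simp: low mop_power_0[OF z(1)] lin)
      qed
    qed auto
    finally show ?thesis by simp
  qed
  have F_b: "F (\<Sum>i\<le>n. x i *s b i) = (c * l ((z ^^ n) v)) * standard_form n x" for x
  proof -
    define w where "w = (\<Sum>i\<le>n. x i *s b i)"
    define P where "P = (\<Sum>i\<in>{1..n}. monom (x i) i)"
    have P0: "coeff P 0 = 0" unfolding P_def coeff_sum by (rule sum.neutral) auto
    have P_mop: "mop (poly_op z P)" by (rule mop_poly_op[OF z(1) P0])
    have "{..n} = insert 0 {1..n}" by auto
    then have w: "w = x 0 *s v + poly_op z P v"
      by (simp add: w_def P_def b_def poly_op_sum poly_op_monom)
    have h: "height w = x 0" by (simp add: w height_simps height(2)[OF P_mop] height(3))
    have T: "T w = poly_op z P" by (rule T_eqI[OF P_mop]) (simp add: h, simp add: w)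
    have "l ((T w ^^ k) v) = coeff (P ^ k) n * l ((z ^^ n) v)" for k
      unfolding T by (simp add: l_poly_op flip: poly_op_power[OF z_lin])
    then have "F w = c * (\<Sum>k\<le>n. coeff (log_poly (n + 1)) k * (coeff (P ^ k) n * l ((z ^^ n) v)) * x 0 ^ (n - k))"
      by (simp add: F h card_n)
    also have "\<dots> = (c * l ((z ^^ n) v)) * standard_form n x"
      by (simp add: standard_form_def P_def sum_distrib_left mult_ac)
    finally show ?thesis by (simp add: w_def)
  qed
  have zn: "(z ^^ n) v \<noteq> 0" using z(2) lin(3) by auto
  show ?thesis
  proof (intro exI[of _ b] exI[of _ "c * l ((z ^^ n) v)"] conjI allI impI)
    show "c * l ((z ^^ n) v) \<noteq> 0" using c z(2) by simp
    show "x j = 0" if "(\<Sum>i\<le>n. x i *s b i) = 0" "j \<le> n" for x j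
      by (rule nilpotent_chain[OF z_lin zn _ that(1)[unfolded b_def] that(2)])
        (rule mop_power_0[OF z(1)], simp)
  qed (rule F_b)
qed

text \<open>The coordinates \<open>{0..n}\<close> of the standard form are matched with the type \<open>'n\<close> by \<open>e\<close>.\<close>

lemma normal_form_coordinates:
  assumes e: "bij_betw e {..n} (UNIV :: 'n set)"
  obtains B c where "lin_op B" "bij B" "c \<noteq> 0"
    "\<And>x :: 'k^'n. F (B x) = c * standard_form n (\<lambda>i. x $ e i)"
proof -
  obtain b c where b: "c \<noteq> 0" "\<forall>x. (\<Sum>i\<le>n. x i *s b i) = 0 \<longrightarrow> (\<forall>j\<le>n. x j = 0)"
    "\<forall>x. F (\<Sum>i\<le>n. x i *s b i) = c * standard_form n x"
    using normal_form by (elim exE conjE) (rule that)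
  define B where "B x = (\<Sum>i\<le>n. x $ e i *s b i)" for x :: "'k^'n"
  have B: "lin_op B"
    by (rule lin_opI)
      (simp_all add: B_def vec.scale_left_distrib sum.distrib vec.scale_sum_right)
  have "x = 0" if "B x = 0" for x
  proof -
    have "x $ k = 0" for k
    proof -
      obtain j where "j \<le> n" "k = e j" using e by (metis UNIV_I atMost_iff bij_betw_def imageE)
      then show ?thesis using spec[OF b(2), of "\<lambda>i. x $ e i"] that by (simp add: B_def)
    qed
    then show ?thesis by (simp add: vec_eq_iff)
  qed
  then have inj: "inj B" by (intro injI) (metis B eq_iff_diff_eq_0 lin_op_diff)
  then have "bij B" using vec.linear_injective_imp_surjective[OF B inj] by (simp add: bij_def)
  then show ?thesis using that[OF B _ b(1)] spec[OF b(3)] by (simp add: B_def)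
qed

end

subsection \<open>Projective transformations\<close>

lemma regular_proj_map_linear:
  fixes A :: "'k::field^'n::finite \<Rightarrow> 'k^'n"
  assumes A: "lin_op A" and \<phi>: "\<And>p x. hom_coords p x \<Longrightarrow> hom_coords (\<phi> p) (A x)"
  shows "regular_proj_map \<phi>"
proof -
  define G :: "'n \<Rightarrow> ('n, 'k) mpoly" where
    "G i = (\<Sum>j\<in>UNIV. Poly_Mapping.single (Poly_Mapping.single j 1) (A (axis j 1) $ i))" for i
  have eval: "mpoly_eval (($) y) (G i) = A y $ i" for y i
  proof -
    have "mpoly_eval (($) y) (G i) = (\<Sum>j\<in>UNIV. A (axis j 1) $ i * y $ j)"
      by (simp add: G_def mpoly_eval_sum mpoly_eval_single mon_eval_def)
    then show ?thesis using linear_componentwise[OF A, of y i] by (simp add: mult.commute)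
  qed
  show ?thesis
    unfolding regular_proj_map_def
  proof (rule allI, rule exI[of _ 1], rule exI[of _ G], intro conjI allI impI)
    fix i
    show "homogeneous 1 (G i)"
      unfolding homogeneous_in_def
    proof
      fix m assume "m \<in> Poly_Mapping.keys (G i)"
      then have "(\<Sum>j\<in>UNIV. Poly_Mapping.lookup
          (Poly_Mapping.single (Poly_Mapping.single j 1) (A (axis j 1) $ i)) m) \<noteq> 0"
        by (simp add: G_def lookup_sum in_keys_iff)
      then obtain j where
        "Poly_Mapping.lookup (Poly_Mapping.single (Poly_Mapping.single j 1) (A (axis j 1) $ i)) m \<noteq> 0"
        by (meson sum.neutral)
      then have "m = Poly_Mapping.single j 1"
        by (auto simp: lookup_single when_def split: if_splits)
      then show "(\<Sum>v\<in>UNIV. Poly_Mapping.lookup m v) = 1"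
        by (simp add: lookup_single when_def)
    qed
  next
    fix p :: "('k, 'n) proj"
    obtain x where x: "hom_coords p x" using hom_coords_exists .
    have "A x \<noteq> 0" using \<phi>[OF x] by (simp add: hom_coords_def)
    then obtain i where "mpoly_eval (($) x) (G i) \<noteq> 0" by (auto simp: eval vec_eq_iff)
    then show "\<exists>x i. hom_coords p x \<and> mpoly_eval (($) x) (G i) \<noteq> 0" using x by blast
  next
    fix q :: "('k, 'n) proj" and y
    assume "hom_coords q y \<and> (\<exists>i. mpoly_eval (($) y) (G i) \<noteq> 0)"
    then show "hom_coords (\<phi> q) (\<chi> i. mpoly_eval (($) y) (G i))" by (simp add: eval \<phi>)
  qed
qed

lemma projectivization:
  fixes A :: "'k::field^'n::finite \<Rightarrow> 'k^'n"
  assumes A: "lin_op A" "bij A"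
  obtains \<psi> where "proj_automorphism \<psi>" "\<And>p x. hom_coords p x \<Longrightarrow> hom_coords (\<psi> p) (A x)"
proof -
  have ex: "\<exists>\<psi>. \<forall>p x. hom_coords p x \<longrightarrow> hom_coords (\<psi> p) (A x)"
    if A: "lin_op A" "inj A" for A :: "'k^'n \<Rightarrow> 'k^'n"
  proof -
    have "\<exists>q. \<forall>x. hom_coords p x \<longrightarrow> hom_coords q (A x)" for p
    proof -
      obtain x where x: "hom_coords p x" using hom_coords_exists .
      then have "x \<noteq> 0" by (simp add: hom_coords_def)
      then have "A x \<noteq> 0" using A(2) lin_op_0[OF A(1)] by (metis injD)
      then have q: "hom_coords (proj_point (A x)) (A x)" by (rule hom_coords_proj_point)
      have "hom_coords (proj_point (A x)) (A y)" if y: "hom_coords p y" for y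
      proof -
        obtain c where "c \<noteq> 0" "y = c *s x" using hom_coords_proportional[OF x y] .
        then show ?thesis using hom_coords_scale[OF q] by (simp add: lin_op_scale[OF A(1)])
      qed
      then show ?thesis by blast
    qed
    then show ?thesis by metis
  qed
  obtain A' where A': "lin_op A'" "\<And>x. A' (A x) = x" "\<And>x. A (A' x) = x"
    using vec.linear_surjective_isomorphism[OF A(1) bij_is_surj[OF A(2)]] by auto
  then have "inj A'" by (metis injI)
  obtain \<psi> where \<psi>: "\<And>p x. hom_coords p x \<Longrightarrow> hom_coords (\<psi> p) (A x)"
    using ex[OF A(1) bij_is_inj[OF A(2)]] by blast
  obtain \<psi>' where \<psi>': "\<And>p x. hom_coords p x \<Longrightarrow> hom_coords (\<psi>' p) (A' x)"
    using ex[OF A'(1) \<open>inj A'\<close>] by blast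
  have "\<psi>' (\<psi> p) = p" "\<psi> (\<psi>' p) = p" for p
  proof -
    obtain x where x: "hom_coords p x" using hom_coords_exists .
    show "\<psi>' (\<psi> p) = p" using \<psi>'[OF \<psi>[OF x]] x by (simp add: A'(2) hom_coords_eqI)
    show "\<psi> (\<psi>' p) = p" using \<psi>[OF \<psi>'[OF x]] x by (simp add: A'(3) hom_coords_eqI)
  qed
  then have "bij \<psi>" "inv \<psi> = \<psi>'"
    by (auto intro!: o_bij[of \<psi>' \<psi>] inv_unique_comp)
  then have "proj_automorphism \<psi>"
    unfolding proj_automorphism_def
    using regular_proj_map_linear[OF A(1) \<psi>] regular_proj_map_linear[OF A'(1) \<psi>'] by simp
  then show ?thesis using \<psi> that by blast
qed

subsection \<open>Hypersurfaces with an induced additive action\<close>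

lemma hypersurface_equation:
  fixes X :: "('k::{alg_closed_field, field_char_0}, 'n::finite) proj set"
  assumes "hypersurface n X" "n \<ge> 2"
  obtains F where "irreducible_form F n" "\<And>p x. hom_coords p x \<Longrightarrow> p \<in> X \<longleftrightarrow> F x = 0"
proof -
  obtain f :: "('n, 'k) mpoly" where f: "irreducible f" "homogeneous n f" "X = {p. vanishes_at f p}"
    using assms(1) unfolding hypersurface_def by blast
  define F where "F x = mpoly_eval (($) x) f" for x :: "'k^'n"
  have hom: "F (s *s x) = s ^ n * F x" for s x
    unfolding F_def using homogeneous_in_eval_scale[OF f(2), of s "($) x"]
    by (simp add: vector_smult_component[abs_def])
  have "irreducible_form F n"
  proof
    show "polyfun F" unfolding F_def by (rule polyfun_mpoly_eval)
    show "\<exists>x. F x \<noteq> 0" unfolding F_def by (rule irreducible_polyfun_nonzero[OF f(1)])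
    show "(\<forall>x. G x = G 0) \<or> (\<forall>x. H x = H 0)"
      if "polyfun G" "polyfun H" "\<And>x. F x = G x * H x" for G H
      by (rule irreducible_polyfun[OF f(1) that(1,2)]) (use that(3) in \<open>simp add: F_def\<close>)
  qed (use hom assms(2) in auto)
  moreover have "p \<in> X \<longleftrightarrow> F x = 0" if x: "hom_coords p x" for p x
  proof
    assume "p \<in> X"
    then show "F x = 0" using x unfolding f(3) vanishes_at_def F_def by blast
  next
    assume F0: "F x = 0"
    have "F y = 0" if y: "hom_coords p y" for y
    proof -
      obtain c where "y = c *s x" using hom_coords_proportional[OF x y] .
      then show ?thesis by (simp add: hom F0)
    qed
    then show "p \<in> X" unfolding f(3) vanishes_at_def F_def by blast
  qed
  ultimately show ?thesis by (rule that)
qed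

text \<open>The geometric conditions become algebraic: effectiveness says that
  \<open>D t = 0\<close> only for \<open>t = 0\<close>, and openness of the orbit gives the spanning
  property of \<open>v\<close>.\<close>

lemma induced_action_normal_form:
  fixes X :: "('k::{alg_closed_field, field_char_0}, 'n::finite) proj set"
    and \<alpha> :: "'k^'m::finite \<Rightarrow> ('k, 'n) proj \<Rightarrow> ('k, 'n) proj"
  assumes n: "n \<ge> 2" and card_n: "CARD('n) = n + 1" and card_m: "CARD('m) = n - 1"
    and X: "hypersurface n X" and \<alpha>: "induced_additive_action X \<alpha>"
    and e: "bij_betw e {..n} (UNIV :: 'n set)"
  obtains B where "lin_op B" "bij B"
    "\<And>p x. hom_coords p (B x) \<Longrightarrow> p \<in> X \<longleftrightarrow> standard_form n (\<lambda>i. x $ e i) = 0"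
proof -
  obtain F where "irreducible_form F n" and F: "\<And>p x. hom_coords p x \<Longrightarrow> p \<in> X \<longleftrightarrow> F x = 0"
    using hypersurface_equation[OF X n] by blast
  then interpret irreducible_form F n by simp
  obtain \<beta> where \<beta>: "regular_action UNIV \<beta>" "\<And>t p. p \<in> X \<Longrightarrow> \<beta> t p = \<alpha> t p"
    using \<alpha> unfolding induced_additive_action_def by blast
  have add: "additive_action X \<alpha>"
    using \<alpha> unfolding induced_additive_action_def by blast
  then obtain p0 where p0: "p0 \<in> X" "zariski_open_in X (range (\<lambda>t. \<alpha> t p0))"
    unfolding additive_action_def by blast
  have eff: "t = 0" if "\<And>p. p \<in> X \<Longrightarrow> \<alpha> t p = p" for t
    using add that unfolding additive_action_def by blast
  have act: "\<alpha> t p \<in> X" "\<alpha> 0 p = p" if "p \<in> X" for t p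
    using add that unfolding additive_action_def regular_action_def by blast+
  interpret projective_action \<beta> by unfold_locales (rule \<beta>(1))
  interpret vector_group_rep lin
    by (intro vector_group_rep.intro lin_linear lin_zero lin_add) (auto simp: lin_scale)
  obtain v where v: "hom_coords p0 v" using hom_coords_exists .
  have orbit_coords: "hom_coords (\<alpha> t p0) (lin t v)" for t
    using lin_hom_coords[OF v] by (simp add: \<beta>(2)[OF p0(1)])
  interpret nilpotent_family D v
    by (intro nilpotent_family.intro D_linear D_add D_scale D_commute D_nilpotent)
      (use v in \<open>simp add: hom_coords_def\<close>)
  obtain Z where Z: "zariski_closed Z" "range (\<lambda>t. \<alpha> t p0) = X - Z"
    using p0(2) unfolding zariski_open_in_def by blast
  obtain S where S: "\<forall>f\<in>S. \<exists>d. homogeneous d f" "Z = {p. \<forall>f\<in>S. vanishes_at f p}"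
    using Z(1) unfolding zariski_closed_def by blast
  have "p0 \<in> range (\<lambda>t. \<alpha> t p0)" using act(2)[OF p0(1)] by (metis rangeI)
  then have "p0 \<notin> Z" using Z(2) by blast
  \<comment> \<open>This form vanishes on the excluded closed set but not at \<open>p0\<close>;
    where it is nonzero, the hypersurface consists of orbit points.\<close>
  then obtain f v' where f: "f \<in> S" and v': "hom_coords p0 v'" "mpoly_eval (($) v') f \<noteq> 0"
    unfolding S(2) vanishes_at_def by blast
  define h where "h x = mpoly_eval (($) x) f" for x :: "'k^'n"
  obtain d where d: "homogeneous d f" using S(1) f by blast
  obtain c where c: "v' = c *s v" using hom_coords_proportional[OF v v'(1)] .
  have hv: "h v \<noteq> 0" using v'(2) homogeneous_in_eval_scale[OF d, of c "($) v"]
    by (auto simp: c h_def vector_smult_component[abs_def])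
  have local: "\<exists>c t. x = c *s lin t v" if Fx: "F x = 0" and hx: "h x \<noteq> 0" for x
  proof (cases "x = 0")
    case True
    then show ?thesis by (intro exI[of _ 0]) simp
  next
    case False
    then have x: "hom_coords (proj_point x) x" by (rule hom_coords_proj_point)
    have "proj_point x \<in> X" using F[OF x] Fx by simp
    moreover have "proj_point x \<notin> Z" using f x hx unfolding S(2) vanishes_at_def h_def by blast
    ultimately obtain t where t: "proj_point x = \<alpha> t p0" using Z(2) by blast
    obtain c where "x = c *s lin t v" using hom_coords_proportional[OF orbit_coords x[unfolded t]] .
    then show ?thesis by blast
  qed
  interpret additive_hypersurface D v F n
  proof unfold_locales
    show "CARD('n) = n + 1" by (rule card_n)
    show "CARD('m) = n - 1" by (rule card_m)
    show "F (poly_op (D t) (exp_poly CARD('n)) v) = 0" for t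
      using F[OF orbit_coords[of t]] act(1)[OF p0(1)] by (simp add: M_exp)
    \<comment> \<open>For \<open>D t = 0\<close> the exponential reduces to its constant term 1, so
      \<open>t\<close> acts trivially.\<close>
    show "t = 0" if D0: "\<And>x. D t x = 0" for t
    proof (rule eff)
      fix p assume p: "p \<in> X"
      obtain x where x: "hom_coords p x" using hom_coords_exists .
      obtain a q where aq: "exp_poly CARD('n) = pCons a (q :: 'k poly)" by (rule pCons_cases)
      have a: "a = 1" using arg_cong[OF aq, of "\<lambda>p. coeff p 0"] by (simp add: coeff_exp_poly)
      have "lin t x = poly_op (D t) (pCons a q) x" unfolding aq[symmetric] by (rule M_exp)
      also have "\<dots> = a *s x + D t (poly_op (D t) q x)" by (rule poly_op_pCons[OF D_linear])
      also have "\<dots> = x" unfolding D0 a by simp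
      finally have "hom_coords (\<beta> t p) x" using lin_hom_coords[OF x, of t] by simp
      then show "\<alpha> t p = p" using x unfolding \<beta>(2)[OF p] by (rule hom_coords_eqI)
    qed
    \<comment> \<open>A functional that kills \<open>v\<close> and all \<open>a v\<close> kills the
      lifted orbit, which would put the hypersurface near \<open>v\<close> into a
      hyperplane.\<close>
    show "l w = 0" if l: "lin_fun l" "\<And>a. mop a \<Longrightarrow> l (a v) = 0" "l v = 0" for l w
    proof (rule ccontr)
      assume lw: "l w \<noteq> 0"
      note ls = lin_fun_simps[OF l(1)]
      have "l (inverse (l w) *s w) = 1" using lw by (simp add: ls)
      then show False
      proof (rule not_locally_in_hyperplane[OF l(1)])
        show "polyfun h" unfolding h_def by (rule polyfun_mpoly_eval)
        show "F v = 0" using F[OF v] p0(1) by simp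
        fix x assume "F x = 0" "h x \<noteq> 0"
        then obtain c t where x: "x = c *s lin t v" using local by blast
        obtain a where "mop a" "poly_op (D t) (exp_poly CARD('n)) v = v + a v"
          using exp_orbit_point .
        then have "mop a" "lin t v = v + a v" unfolding M_exp[symmetric] by simp_all
        then show "l x = 0" by (simp add: x ls l(2,3))
      qed (rule hv)
    qed
  qed
  obtain B c where B: "lin_op B" "bij B" "c \<noteq> 0"
    "\<And>x :: 'k^'n. F (B x) = c * standard_form n (\<lambda>i. x $ e i)"
    using normal_form_coordinates[OF e] by blast
  show ?thesis
    by (rule that[OF B(1,2)]) (simp add: F B(3,4))
qed

theorem proposition8:
  fixes n :: nat
    and X1 X2 :: "('k::{alg_closed_field, field_char_0}, 'n::finite) proj set"
  assumes "n \<ge> 2"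
    and "CARD('n) = n + 1"
    and "CARD('m::finite) = n - 1"
    and "hypersurface n X1"
    and "\<exists>\<alpha> :: 'k ^ 'm \<Rightarrow> ('k, 'n) proj \<Rightarrow> ('k, 'n) proj. induced_additive_action X1 \<alpha>"
    and "hypersurface n X2"
    and "\<exists>\<alpha> :: 'k ^ 'm \<Rightarrow> ('k, 'n) proj \<Rightarrow> ('k, 'n) proj. induced_additive_action X2 \<alpha>"
  shows "\<exists>\<psi> :: ('k, 'n) proj \<Rightarrow> ('k, 'n) proj. proj_automorphism \<psi> \<and> \<psi> ` X1 = X2"
proof -
  obtain e where e: "bij_betw e {..n} (UNIV :: 'n set)"
    using finite_same_card_bij[of "{..n}" "UNIV :: 'n set"] assms(2) by auto
  obtain \<alpha>1 \<alpha>2 :: "'k ^ 'm \<Rightarrow> ('k, 'n) proj \<Rightarrow> ('k, 'n) proj"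
    where \<alpha>: "induced_additive_action X1 \<alpha>1" "induced_additive_action X2 \<alpha>2"
    using assms(5,7) by blast
  obtain B1 where B1: "lin_op B1" "bij B1"
    "\<And>p x. hom_coords p (B1 x) \<Longrightarrow> p \<in> X1 \<longleftrightarrow> standard_form n (\<lambda>i. x $ e i) = 0"
    using induced_action_normal_form[OF assms(1,2,3,4) \<alpha>(1) e] by blast
  obtain B2 where B2: "lin_op B2" "bij B2"
    "\<And>p x. hom_coords p (B2 x) \<Longrightarrow> p \<in> X2 \<longleftrightarrow> standard_form n (\<lambda>i. x $ e i) = 0"
    using induced_action_normal_form[OF assms(1,2,3,6) \<alpha>(2) e] by blast
  \<comment> \<open>Both hypersurfaces have the same equation in their coordinates, so undoing
    \<open>B1\<close> and applying \<open>B2\<close> carries one to the other.\<close>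
  obtain C where C: "lin_op C" "\<And>x. C (B1 x) = x" "\<And>x. B1 (C x) = x"
    using vec.linear_surjective_isomorphism[OF B1(1) bij_is_surj[OF B1(2)]] by auto
  have "bij C" by (rule o_bij[of B1 C]) (auto simp: C fun_eq_iff)
  then have "bij (\<lambda>x. B2 (C x))" using bij_comp[OF _ B2(2)] by (simp add: o_def)
  then obtain \<psi> where \<psi>: "proj_automorphism \<psi>" "\<And>p x. hom_coords p x \<Longrightarrow> hom_coords (\<psi> p) (B2 (C x))"
    using projectivization[OF lin_op_comp[OF B2(1) C(1)]] by blast
  have iff: "p \<in> X1 \<longleftrightarrow> \<psi> p \<in> X2" for p
  proof -
    obtain x where x: "hom_coords p x" using hom_coords_exists .
    have "p \<in> X1 \<longleftrightarrow> standard_form n (\<lambda>i. C x $ e i) = 0" by (rule B1(3)) (simp add: C(3) x)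
    also have "\<dots> \<longleftrightarrow> \<psi> p \<in> X2" by (rule B2(3)[symmetric]) (rule \<psi>(2)[OF x])
    finally show ?thesis .
  qed
  have "bij \<psi>" using \<psi>(1) by (simp add: proj_automorphism_def)
  then have "surj \<psi>" by (rule bij_is_surj)
  have "\<psi> ` X1 = X2"
  proof (intro set_eqI iffI)
    fix q assume "q \<in> X2"
    moreover obtain p where "q = \<psi> p" using \<open>surj \<psi>\<close> by (rule surjE)
    ultimately show "q \<in> \<psi> ` X1" by (simp add: iff)
  qed (auto simp: iff)
  then show ?thesis using \<psi>(1) by blast
qed

end
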